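(* Let $p\in\{0,1,\ldots,6\}$, let $D\subseteq\mathbb{R}^{p+2}$ be an open set invariant under the reflection of the $(p+2)$-th variable, let $f\in\mathcal{GS}^1(\Omega_D)$ and set $\Omega=\Omega_D$. If $U$ is a domain in $\mathbb{O}$ such that $U_{\underline{\eta}}\subset\Omega_{\underline{\eta}}$ is a bounded domain in $\mathbb{R}^{p+2}$ with smooth boundary $\partial U_{\underline{\eta}}\subset\Omega_{\underline{\eta}}$ for some $\underline{\eta}\in\mathbb{S}$, then $$f(\boldsymbol{x})=\int_{\partial U_{\underline{\eta}}}\mathcal{E}_{\boldsymbol{y}}(\boldsymbol{x})\big(\boldsymbol{n}(\boldsymbol{y})f(\boldsymbol{y})\big)\,dS(\boldsymbol{y})-\int_{U_{\underline{\eta}}}\mathcal{E}_{\boldsymbol{y}}(\boldsymbol{x})\big(D_{\underline{\eta}}f(\boldsymbol{y})\big)\,dV(\boldsymbol{y}),\qquad\boldsymbol{x}\in U,$$ where $\boldsymbol{n}(\boldsymbol{y})=\sum_{i=0}^pn_i(\boldsymbol{y})e_i+n_{p+1}(\boldsymbol{y})\underline{\eta}$ is the unit exterior normal to $\partial U_{\underline{\eta}}$ at $\boldsymbol{y}$, and $dS$ and $dV$ are the classical Lebesgue surface element and volume element in $\mathbb{R}^{p+2}$, respectively.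
   Context: $\mathbb{O}$ is the real, non-associative, alternative algebra of octonions with basis $e_0=1,e_1,\ldots,e_7$ and product $e_ie_j=-\delta_{ij}+\sum_k\epsilon_{ijk}e_k$ for $1\le i,j\le 7$, where $\epsilon_{ijk}$ is totally antisymmetric, equals $1$ on the triples $(1,2,3),(1,4,5),(2,4,6),(3,4,7),(5,3,6),(6,1,7),(7,2,5)$, and vanishes on triples that are not permutations of these. $\mathbb{O}$ is identified with $\mathbb{R}^8$ with Euclidean norm $|\cdot|$; conjugation is $\overline{x}=x_0-\sum_{i=1}^7x_ie_i$. A domain is a connected open set. Fix $p\in\{0,\ldots,6\}$. $\mathbb{R}^{p+1}$ denotes the real span of $e_0,\ldots,e_p$, with elements $\boldsymbol{x}_p=\sum_{i=0}^px_ie_i$, and $\mathbb{S}=\{\sum_{i=p+1}^7x_ie_i:\sum_{i=p+1}^7x_i^2=1\}$. For $U\subseteq\mathbb{O}$ open and $\underline{\eta}\in\mathbb{S}$, $U_{\underline{\eta}}=U\cap(\mathbb{R}^{p+1}\oplus\underline{\eta}\mathbb{R})$ is viewed as an open subset of $\mathbb{R}^{p+2}$ with coordinates $(x_0,\ldots,x_p,r)\leftrightarrow\boldsymbol{x}_p+r\underline{\eta}$. $D_{\underline{\eta}}f=\sum_{i=0}^pe_i\,\partial_{x_i}f+\underline{\eta}\,\partial_rf$. An open set $D\subseteq\mathbb{R}^{p+2}$ is invariant under the reflection of the $(p+2)$-th variable if $(\boldsymbol{x}_p,r)\in D$ implies $(\boldsymbol{x}_p,-r)\in D$. Its p-symmetric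 completion is $\Omega_D=\{\boldsymbol{x}_p+r\underline{\omega}:\underline{\omega}\in\mathbb{S},\ \boldsymbol{x}_p\in\mathbb{R}^{p+1},\ r\ge0,\ (\boldsymbol{x}_p,r)\in D\}\subseteq\mathbb{O}$. A stem function on such a $D$ is $F=(F_1,F_2):D\to\mathbb{O}^2$ with $F_1(\boldsymbol{x}_p,-r)=F_1(\boldsymbol{x}_p,r)$ and $F_2(\boldsymbol{x}_p,-r)=-F_2(\boldsymbol{x}_p,r)$; it induces the generalized partial-slice function $\mathcal{I}(F):\Omega_D\to\mathbb{O}$, $\mathcal{I}(F)(\boldsymbol{x}_p+r\underline{\omega})=F_1(\boldsymbol{x}_p,r)+\underline{\omega}F_2(\boldsymbol{x}_p,r)$. $\mathcal{GS}^1(\Omega_D)$ is the set of all $\mathcal{I}(F)$ with $F$ a $C^1$ stem function on $D$. The Cauchy kernel is $E(\boldsymbol{x})=\frac{1}{\sigma_{p+1}}\frac{\overline{\boldsymbol{x}}}{|\boldsymbol{x}|^{p+2}}$, $\boldsymbol{x}\in\mathbb{O}\setminus\{0\}$, with $\sigma_{p+1}=2\,\Gamma(\tfrac12)^{p+2}/\Gamma(\tfrac{p+2}{2})$, and $E_{\boldsymbol{y}}(\boldsymbol{x}):=E(\boldsymbol{y}-\boldsymbol{x})$. For $a\in\mathbb{O}$, $L_a:\mathbb{O}\to\mathbb{O}$ is left multiplication $L_ax=ax$. For $\boldsymbol{x}=\boldsymbol{x}_p+r\underline{\omega}$ and $\boldsymbol{y}=\boldsymbol{y}_p+\widetilde r\,\underline{\eta}$,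 the operator $\mathcal{E}_{\boldsymbol{y}}(\boldsymbol{x}):\mathbb{O}\to\mathbb{O}$ is $$\mathcal{E}_{\boldsymbol{y}}(\boldsymbol{x})=\frac12L_{E_{\boldsymbol{y}}(\boldsymbol{x}_p+r\underline{\eta})+E_{\boldsymbol{y}}(\boldsymbol{x}_p-r\underline{\eta})}+\frac12L_{\underline{\omega}}L_{\underline{\eta}}L_{E_{\boldsymbol{y}}(\boldsymbol{x}_p-r\underline{\eta})-E_{\boldsymbol{y}}(\boldsymbol{x}_p+r\underline{\eta})},$$ and in the integrals it is applied to the octonion written to its right.
   Formalization: The formula is proved for x in U_η, or for x = x_p + rω in U with both x_p + rη and x_p − rη in U (always so when U is p-symmetric); for arbitrary x in U it fails, e.g. p = 0, f = 1, U the unit ball about 10e_1, η = e_1, x = 10e_1 + e_2/2. *)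

theory Defs
  imports "HOL-Analysis.Analysis"
begin

section \<open>Calculus on the span of an orthonormal set\<close>

text \<open>
  The space $\mathbb{R}^{p+2}$ with its coordinates appears below as the linear span of a finite
  orthonormal set \<open>B\<close> of vectors, so that functions, sets and measures live on the ambient type.
\<close>

definition dir_deriv :: "'a::real_normed_vector \<Rightarrow> ('a \<Rightarrow> 'b::real_normed_vector) \<Rightarrow> 'a \<Rightarrow> 'b" where
  "dir_deriv b f x = vector_derivative (\<lambda>t::real. f (x + t *\<^sub>R b)) (at 0)"

text \<open>\<open>Ck_on k B X f\<close>: on the (relatively) open subset \<open>X\<close> of \<open>span B\<close>, all iterated partial
  derivatives of \<open>f\<close> of order at most \<open>k\<close> in the directions \<open>b \<in> B\<close> exist and are continuous.\<close>

primrec Ck_on :: "nat \<Rightarrow> 'a::real_normed_vector set \<Rightarrow> 'a set \<Rightarrow> ('a \<Rightarrow> 'b::real_normed_vector) \<Rightarrow> bool"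
where
  "Ck_on 0 B X f \<longleftrightarrow> continuous_on X f"
| "Ck_on (Suc k) B X f \<longleftrightarrow> continuous_on X f \<and>
     (\<forall>b\<in>B. (\<forall>x\<in>X. (\<lambda>t::real. f (x + t *\<^sub>R b)) differentiable (at 0)) \<and>
            Ck_on k B X (dir_deriv b f))"

definition smooth_on :: "'a::real_normed_vector set \<Rightarrow> 'a set \<Rightarrow> ('a \<Rightarrow> 'b::real_normed_vector) \<Rightarrow> bool"
where
  "smooth_on B X f \<longleftrightarrow> (\<forall>k. Ck_on k B X f)"

text \<open>Lebesgue measure on \<open>span B\<close>, as a Borel measure on the ambient space; for \<open>B = Basis\<close> this is
  the construction of \<^const>\<open>lborel\<close>.\<close>

definition lborel_span :: "'a::euclidean_space set \<Rightarrow> 'a measure" where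
  "lborel_span B = distr (\<Pi>\<^sub>M b\<in>B. lborel) borel (\<lambda>v. \<Sum>b\<in>B. v b *\<^sub>R b)"

definition boundary_in :: "'a::euclidean_space set \<Rightarrow> 'a set \<Rightarrow> 'a set" where
  "boundary_in B G = top_of_set (span B) frontier_of G"

text \<open>Removing the coordinate \<open>b\<close>.\<close>

definition drop_coord :: "'a::real_inner \<Rightarrow> 'a \<Rightarrow> 'a" where
  "drop_coord b x = x - (x \<bullet> b) *\<^sub>R b"

text \<open>Smooth boundary: after relabelling and reorienting the coordinate axes, near every boundary
  point \<open>G\<close> is the part of \<open>span B\<close> above the graph of a \<open>C\<^sup>\<infinity>\<close> function of the other coordinates.\<close>

definition has_smooth_boundary :: "'a::euclidean_space set \<Rightarrow> 'a set \<Rightarrow> bool" where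
  "has_smooth_boundary B G \<longleftrightarrow>
     (\<forall>x0 \<in> boundary_in B G. \<exists>\<epsilon>>0. \<exists>b\<in>B. \<exists>s\<in>{-1, 1::real}. \<exists>\<gamma> :: 'a \<Rightarrow> real.
        smooth_on (B - {b}) (span (B - {b})) \<gamma> \<and>
        G \<inter> ball x0 \<epsilon> = {x \<in> span B \<inter> ball x0 \<epsilon>. s * (x \<bullet> b) > \<gamma> (drop_coord b x)})"

text \<open>The unit vector in \<open>span B\<close> that is orthogonal to all tangent vectors of the boundary at \<open>y\<close> and
  points out of \<open>G\<close>.\<close>

definition exterior_normal :: "'a::euclidean_space set \<Rightarrow> 'a set \<Rightarrow> 'a \<Rightarrow> 'a" where
  "exterior_normal B G y = (THE \<nu>. \<nu> \<in> span B \<and> norm \<nu> = 1 \<and>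
     (\<forall>c v. (\<forall>t::real. c t \<in> boundary_in B G) \<and> c 0 = y \<and> (c has_vector_derivative v) (at 0)
        \<longrightarrow> \<nu> \<bullet> v = 0) \<and>
     (\<forall>\<^sub>F t in at_right (0::real). y + t *\<^sub>R \<nu> \<notin> G \<and> y - t *\<^sub>R \<nu> \<in> G))"

text \<open>The surface measure of a hypersurface \<open>M\<close> of \<open>span B\<close>: wherever \<open>M\<close> is the graph
  \<open>x\<^sub>b = \<gamma>(u)\<close> of a \<open>C\<^sup>1\<close> function of the remaining coordinates \<open>u\<close>, the surface element is
  $\sqrt{1 + |\nabla\gamma(u)|^2}\,du$.  If \<open>M\<close> is locally such a graph, this determines the measure
  uniquely.\<close>

definition is_surface_measure :: "'a::euclidean_space set \<Rightarrow> 'a set \<Rightarrow> 'a measure \<Rightarrow> bool" where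
  "is_surface_measure B M S \<longleftrightarrow>
     sets S = sets borel \<and> emeasure S (- M) = 0 \<and>
     (\<forall>b\<in>B. \<forall>(\<gamma> :: 'a \<Rightarrow> real) V A.
        Ck_on 1 (B - {b}) (span (B - {b})) \<gamma> \<and> open V \<and>
        M \<inter> V = {x \<in> span B \<inter> V. x \<bullet> b = \<gamma> (drop_coord b x)} \<and>
        A \<in> sets borel \<and> A \<subseteq> M \<inter> V
        \<longrightarrow> emeasure S A =
            (\<integral>\<^sup>+ u. indicator A (u + \<gamma> u *\<^sub>R b) *
                    ennreal (sqrt (1 + (\<Sum>c\<in>B - {b}. (dir_deriv c \<gamma> u)\<^sup>2))) \<partial>lborel_span (B - {b})))"

definition surface_measure :: "'a::euclidean_space set \<Rightarrow> 'a set \<Rightarrow> 'a measure" where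
  "surface_measure B M = (THE S. is_surface_measure B M S)"

section \<open>Octonions\<close>

type_synonym octonion = "real ^ 8"

text \<open>The index type \<open>8\<close> is \<open>{0,\<dots>,7}\<close> (with arithmetic modulo 8), so component \<open>i\<close> is \<open>x $ of_nat i\<close>.\<close>

definition oe :: "nat \<Rightarrow> octonion" where
  "oe i = axis (of_nat i) 1"

definition oct_triples :: "(nat \<times> nat \<times> nat) set" where
  "oct_triples = {(1,2,3), (1,4,5), (2,4,6), (3,4,7), (5,3,6), (6,1,7), (7,2,5)}"

definition cyclic_oct_triple :: "nat \<Rightarrow> nat \<Rightarrow> nat \<Rightarrow> bool" where
  "cyclic_oct_triple i j k \<longleftrightarrow>
     (i,j,k) \<in> oct_triples \<or> (j,k,i) \<in> oct_triples \<or> (k,i,j) \<in> oct_triples"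

definition oct_eps :: "nat \<Rightarrow> nat \<Rightarrow> nat \<Rightarrow> real" where
  "oct_eps i j k =
     (if cyclic_oct_triple i j k then 1 else if cyclic_oct_triple j i k then -1 else 0)"

definition oe_mult :: "nat \<Rightarrow> nat \<Rightarrow> octonion" where
  "oe_mult i j =
     (if i = 0 then oe j else if j = 0 then oe i
      else (if i = j then - oe 0 else 0) + (\<Sum>k=1..7. oct_eps i j k *\<^sub>R oe k))"

definition oct_mult :: "octonion \<Rightarrow> octonion \<Rightarrow> octonion" (infixl "\<odot>" 70) where
  "x \<odot> y = (\<Sum>i=0..7. \<Sum>j=0..7. (x $ of_nat i * y $ of_nat j) *\<^sub>R oe_mult i j)"

definition oct_conj :: "octonion \<Rightarrow> octonion" where
  "oct_conj x = (x $ 0) *\<^sub>R oe 0 - (\<Sum>i=1..7. (x $ of_nat i) *\<^sub>R oe i)"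

section \<open>Generalized partial-slice functions\<close>

definition Rp :: "nat \<Rightarrow> octonion set" where
  "Rp p = span (oe ` {0..p})"

definition SS :: "nat \<Rightarrow> octonion set" where
  "SS p = {(\<Sum>i=p+1..7. c i *\<^sub>R oe i) | c :: nat \<Rightarrow> real. (\<Sum>i=p+1..7. (c i)\<^sup>2) = 1}"

definition slice_basis :: "nat \<Rightarrow> octonion \<Rightarrow> octonion set" where
  "slice_basis p \<eta> = insert \<eta> (oe ` {0..p})"

definition slice :: "nat \<Rightarrow> octonion \<Rightarrow> octonion set \<Rightarrow> octonion set" where
  "slice p \<eta> U = U \<inter> span (slice_basis p \<eta>)"

definition slice_dirac :: "nat \<Rightarrow> octonion \<Rightarrow> (octonion \<Rightarrow> octonion) \<Rightarrow> octonion \<Rightarrow> octonion" where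
  "slice_dirac p \<eta> f y = (\<Sum>i=0..p. oe i \<odot> dir_deriv (oe i) f y) + \<eta> \<odot> dir_deriv \<eta> f y"

text \<open>Points \<open>(x\<^sub>0,\<dots>,x\<^sub>p,r)\<close> of $\mathbb{R}^{p+2}$ in the domain of a stem function are written as
  pairs \<open>(xp, r)\<close> with \<open>xp \<in> Rp p\<close>.\<close>

definition stem_domain :: "nat \<Rightarrow> (octonion \<times> real) set \<Rightarrow> bool" where
  "stem_domain p D \<longleftrightarrow>
     openin (top_of_set (Rp p \<times> UNIV)) D \<and> (\<forall>xp r. (xp, r) \<in> D \<longrightarrow> (xp, - r) \<in> D)"

definition stem_dirs :: "nat \<Rightarrow> (octonion \<times> real) set" where
  "stem_dirs p = insert (0, 1) ((\<lambda>i. (oe i, 0)) ` {0..p})"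

definition p_completion :: "nat \<Rightarrow> (octonion \<times> real) set \<Rightarrow> octonion set" where
  "p_completion p D =
     {xp + r *\<^sub>R \<omega> | xp r \<omega>. \<omega> \<in> SS p \<and> xp \<in> Rp p \<and> r \<ge> 0 \<and> (xp, r) \<in> D}"

definition stem_function ::
  "(octonion \<times> real) set \<Rightarrow> (octonion \<times> real \<Rightarrow> octonion) \<Rightarrow> (octonion \<times> real \<Rightarrow> octonion) \<Rightarrow> bool"
where
  "stem_function D F1 F2 \<longleftrightarrow>
     (\<forall>xp r. (xp, r) \<in> D \<longrightarrow> F1 (xp, - r) = F1 (xp, r) \<and> F2 (xp, - r) = - F2 (xp, r))"

text \<open>Elements of \<open>GS1 p D\<close> are total functions, constrained only on \<open>p_completion p D\<close>.\<close>

definition GS1 :: "nat \<Rightarrow> (octonion \<times> real) set \<Rightarrow> (octonion \<Rightarrow> octonion) set" where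
  "GS1 p D = {f. \<exists>F1 F2. stem_function D F1 F2 \<and>
     Ck_on 1 (stem_dirs p) D F1 \<and> Ck_on 1 (stem_dirs p) D F2 \<and>
     (\<forall>xp\<in>Rp p. \<forall>r\<ge>0. \<forall>\<omega>\<in>SS p. (xp, r) \<in> D \<longrightarrow>
        f (xp + r *\<^sub>R \<omega>) = F1 (xp, r) + \<omega> \<odot> F2 (xp, r))}"

section \<open>The Cauchy kernel\<close>

definition sigma_p :: "nat \<Rightarrow> real" where
  "sigma_p p = 2 * Gamma (1/2) ^ (p + 2) / Gamma (real (p + 2) / 2)"

definition cauchy_E :: "nat \<Rightarrow> octonion \<Rightarrow> octonion" where
  "cauchy_E p x = (1 / sigma_p p) *\<^sub>R ((1 / norm x ^ (p + 2)) *\<^sub>R oct_conj x)"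

text \<open>The operator $\mathcal{E}_{y}(x)$ for \<open>x = xp + r \<omega>\<close> and \<open>y\<close> in the slice of \<open>\<eta>\<close>; the nested
  products are compositions of left multiplications.\<close>

definition cauchy_op ::
  "nat \<Rightarrow> octonion \<Rightarrow> octonion \<Rightarrow> real \<Rightarrow> octonion \<Rightarrow> octonion \<Rightarrow> octonion \<Rightarrow> octonion"
where
  "cauchy_op p \<eta> xp r \<omega> y a =
     (let Eplus = cauchy_E p (y - (xp + r *\<^sub>R \<eta>)); Eminus = cauchy_E p (y - (xp - r *\<^sub>R \<eta>))
      in (1/2) *\<^sub>R ((Eplus + Eminus) \<odot> a) + (1/2) *\<^sub>R (\<omega> \<odot> (\<eta> \<odot> ((Eminus - Eplus) \<odot> a))))"

end

theory Submission
  imports Defs "HOL-Probability.Distributions"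
begin

text \<open>
  On the slice of \<open>\<eta>\<close>, which is the span of the orthonormal set \<open>B = slice_basis p \<eta>\<close> of size
  \<open>n = p + 2\<close>, the function is \<open>f = F\<^sub>1 + \<eta> \<odot> F\<^sub>2\<close> in the coordinates of the stem function, hence
  continuously differentiable.  The theorem combines a Cauchy--Pompeiu formula on this span with a
  representation formula.

  \<^bold>\<open>Cauchy--Pompeiu on a span\<close> (\<open>cauchy_pompeiu_span\<close>).  Let \<open>K\<^sub>\<epsilon> (z)\<close> be the Cauchy kernel with
  \<open>\<bar>z\<bar>\<^sup>2\<close> replaced by \<open>\<bar>z\<bar>\<^sup>2 + \<epsilon>\<^sup>2\<close>.  It is smooth, so the divergence theorem applies on all of the domain
  to \<open>\<Sum>\<^sub>b \<partial>\<^sub>b (K\<^sub>\<epsilon> (y - x) \<odot> (b \<odot> f))\<close>.  The octonions are not associative, but the terms in which the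
  kernel is differentiated reduce to products of the form \<open>oct_conj a \<odot> (a \<odot> c) = (a \<bullet> a) c\<close>; they
  add up to \<open>\<psi>\<^sub>\<epsilon> (y - x) f\<close> with \<open>\<psi>\<^sub>\<epsilon> = approx_unit n \<epsilon>\<close> (\<open>regularised_cauchy_pompeiu\<close>).  The
  functions \<open>\<psi>\<^sub>\<epsilon>\<close> have integral \<open>1\<close> and concentrate at \<open>0\<close>, so as \<open>\<epsilon>\<close> tends to \<open>0\<close> this term tends to
  \<open>f x\<close>; the other two converge by dominated convergence, because \<open>\<bar>z\<bar> powr (1 - n)\<close> is locally
  integrable.  The constant \<open>\<sigma>\<close> enters through the integral of \<open>\<psi>\<^sub>\<epsilon>\<close>, a Gamma integral.

  \<^bold>\<open>The divergence theorem\<close> (\<open>divergence_theorem\<close>).  The surface measure and the exterior normal are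
  given by definite descriptions, so both have to be identified in charts first.  Two graph charts
  of a hypersurface assign the same area to a set in their overlap: after freezing the common
  coordinates by Fubini this is a substitution in one variable (\<open>graph_measure_chart_independent\<close>).
  The exterior normal is the normalised gradient of the defining function of a chart
  (\<open>exterior_normal_eq_chart_normal\<close>).  In one chart a shear straightens the boundary and the theorem
  becomes the fundamental theorem of calculus (\<open>divergence_over_graph\<close>); a partition of unity gives
  the global statement.

  \<^bold>\<open>Representation formula\<close>.  By the parity of the stem function,
  \<open>f (x\<^sub>p + r \<omega>) = \<Lambda>\<^sub>1 (f (x\<^sub>p + r \<eta>)) + \<Lambda>\<^sub>2 (f (x\<^sub>p - r \<eta>))\<close> with the real linear maps
  \<open>\<Lambda> a = (a \<minusplus> \<omega> \<odot> (\<eta> \<odot> a)) / 2\<close>, and the operator \<open>cauchy_op\<close> is built from the Cauchy kernels at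
  \<open>x\<^sub>p \<plusminus> r \<eta>\<close> by the same maps.  Applying them to the formulas at these two points gives the theorem.
  If \<open>x\<close> lies in the slice, the operator is left multiplication by the kernel at \<open>x\<close>, and a single
  formula suffices.
\<close>

section \<open>Orthonormal sets and coordinates on their span\<close>

definition orthonormal :: "'a::real_inner set \<Rightarrow> bool" where
  "orthonormal B \<longleftrightarrow> finite B \<and> (\<forall>b\<in>B. \<forall>c\<in>B. b \<bullet> c = (if b = c then 1 else 0))"

definition oproj :: "'a::real_inner set \<Rightarrow> 'a \<Rightarrow> 'a" where
  "oproj B x = (\<Sum>b\<in>B. (x \<bullet> b) *\<^sub>R b)"

lemma orthonormal_finite: "orthonormal B \<Longrightarrow> finite B"
  by (simp add: orthonormal_def)

lemma orthonormal_subset: "orthonormal B \<Longrightarrow> C \<subseteq> B \<Longrightarrow> orthonormal C"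
  unfolding orthonormal_def by (meson finite_subset subsetD)

lemma orthonormal_inner: "orthonormal B \<Longrightarrow> b \<in> B \<Longrightarrow> c \<in> B \<Longrightarrow> b \<bullet> c = (if b = c then 1 else 0)"
  by (simp add: orthonormal_def)

lemma inner_orthonormal_sum:
  assumes "orthonormal B" "c \<in> B"
  shows "(\<Sum>b\<in>B. a b *\<^sub>R b) \<bullet> c = a c"
proof -
  have "(\<Sum>b\<in>B. a b *\<^sub>R b) \<bullet> c = (\<Sum>b\<in>B. if b = c then a b else 0)"
    unfolding inner_sum_left by (rule sum.cong) (use assms in \<open>auto simp: orthonormal_inner\<close>)
  then show ?thesis using assms by (simp add: orthonormal_finite)
qed

lemma bounded_linear_proj: "bounded_linear (oproj B)"
  unfolding oproj_def[abs_def]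
  by (intro bounded_linear_sum bounded_linear_compose[OF bounded_linear_scaleR_left] bounded_linear_inner_left)

lemma linear_proj: "linear (oproj B)"
  using bounded_linear.linear[OF bounded_linear_proj] .

lemma continuous_on_proj [continuous_intros]:
  "continuous_on X g \<Longrightarrow> continuous_on X (\<lambda>x. oproj B (g x))"
  by (rule bounded_linear.continuous_on[OF bounded_linear_proj])

lemma measurable_proj [measurable]: "oproj B \<in> borel_measurable (borel :: 'a::euclidean_space measure)"
  by (intro borel_measurable_continuous_onI continuous_on_proj continuous_on_id)

lemma proj_in_span: "oproj B x \<in> span B"
  unfolding oproj_def by (intro span_sum span_scale span_base)

lemma proj_ident:
  assumes "orthonormal B" "x \<in> span B"
  shows "oproj B x = x"
  using assms(2)
proof (induction rule: span_induct_alt)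
  case base
  show ?case by (simp add: oproj_def)
next
  case (step c x y)
  have "oproj B x = (\<Sum>b\<in>B. if x = b then b else 0)"
    unfolding oproj_def by (rule sum.cong) (use assms step in \<open>auto simp: orthonormal_inner\<close>)
  also have "\<dots> = x" using assms step by (simp add: orthonormal_finite)
  finally show ?case using step by (simp add: linear_add[OF linear_proj] linear_cmul[OF linear_proj])
qed

lemma proj_inner: "orthonormal B \<Longrightarrow> c \<in> B \<Longrightarrow> oproj B x \<bullet> c = x \<bullet> c"
  unfolding oproj_def by (rule inner_orthonormal_sum)

lemma span_expansion: "orthonormal B \<Longrightarrow> x \<in> span B \<Longrightarrow> x = (\<Sum>b\<in>B. (x \<bullet> b) *\<^sub>R b)"
  using proj_ident[of B x] by (simp add: oproj_def)

lemma inner_span_expansion: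
  assumes "orthonormal B" "x \<in> span B"
  shows "x \<bullet> y = (\<Sum>b\<in>B. (x \<bullet> b) * (y \<bullet> b))"
proof -
  have "x \<bullet> y = (\<Sum>b\<in>B. (x \<bullet> b) *\<^sub>R b) \<bullet> y" using span_expansion[OF assms] by simp
  then show ?thesis unfolding inner_sum_left by (simp only: inner_scaleR_left inner_commute[of y])
qed

lemma norm_span_expansion:
  assumes "orthonormal B" "x \<in> span B"
  shows "(norm x)\<^sup>2 = (\<Sum>b\<in>B. (x \<bullet> b)\<^sup>2)"
  using inner_span_expansion[OF assms, of x] by (simp only: power2_norm_eq_inner) (simp only: power2_eq_square)

lemma abs_inner_orthonormal_le: "orthonormal B \<Longrightarrow> b \<in> B \<Longrightarrow> \<bar>x \<bullet> b\<bar> \<le> norm x"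
  using Cauchy_Schwarz_ineq2[of x b] by (auto simp: orthonormal_inner norm_eq_sqrt_inner)

lemma norm_orthonormal: "orthonormal B \<Longrightarrow> b \<in> B \<Longrightarrow> norm b = 1"
  by (auto simp: orthonormal_inner norm_eq_sqrt_inner)

lemma norm_proj_le:
  assumes "orthonormal B" shows "norm (oproj B x) \<le> norm x"
proof -
  have "(norm (oproj B x))\<^sup>2 = oproj B x \<bullet> x"
    using inner_span_expansion[OF assms proj_in_span, of x x] norm_span_expansion[OF assms proj_in_span, of x]
    by (simp add: proj_inner[OF assms] power2_eq_square)
  also have "\<dots> \<le> norm (oproj B x) * norm x" by (rule norm_cauchy_schwarz)
  finally have "norm (oproj B x) * norm (oproj B x) \<le> norm (oproj B x) * norm x"
    by (simp add: power2_eq_square)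
  then show ?thesis by (cases "oproj B x = 0") (auto simp: mult_le_cancel_left_pos)
qed

lemma span_eqI:
  assumes "orthonormal B" "x \<in> span B" "y \<in> span B" "\<And>b. b \<in> B \<Longrightarrow> x \<bullet> b = y \<bullet> b"
  shows "x = y"
proof -
  have "oproj B x = oproj B y" unfolding oproj_def by (rule sum.cong) (simp_all add: assms(4))
  then show ?thesis using proj_ident[OF assms(1)] assms(2,3) by simp
qed

lemma span_remove_inner:
  assumes "orthonormal B" "b \<in> B" "u \<in> span (B - {b})"
  shows "u \<bullet> b = 0"
proof -
  have o: "orthonormal (B - {b})" by (rule orthonormal_subset[OF assms(1) Diff_subset])
  have "u \<bullet> b = (\<Sum>c\<in>B-{b}. (u \<bullet> c) * (b \<bullet> c))" by (rule inner_span_expansion[OF o assms(3)])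
  also have "\<dots> = 0" by (rule sum.neutral) (use assms in \<open>auto simp: orthonormal_inner\<close>)
  finally show ?thesis .
qed

lemma span_Diff_mono: "u \<in> span (B - C) \<Longrightarrow> u \<in> span B"
  by (meson Diff_subset in_mono span_mono)

lemma drop_coord_eq_proj:
  assumes "orthonormal B" "b \<in> B" "x \<in> span B"
  shows "drop_coord b x = oproj (B - {b}) x"
proof -
  have "x = (x \<bullet> b) *\<^sub>R b + oproj (B-{b}) x"
    using span_expansion[OF assms(1,3)] assms
    by (simp add: oproj_def sum.remove[OF orthonormal_finite[OF assms(1)] assms(2)])
  then show ?thesis by (simp add: drop_coord_def algebra_simps)
qed

lemma drop_coord_in_span:
  assumes "orthonormal B" "b \<in> B" "x \<in> span B"
  shows "drop_coord b x \<in> span (B - {b})"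
  using drop_coord_eq_proj[OF assms] proj_in_span by metis

lemma drop_coord_add_span:
  assumes "orthonormal B" "b \<in> B" "u \<in> span (B - {b})"
  shows "drop_coord b (u + t *\<^sub>R b) = u" "(u + t *\<^sub>R b) \<bullet> b = t" "u + t *\<^sub>R b \<in> span B"
proof -
  have b: "(u + t *\<^sub>R b) \<bullet> b = t"
    using span_remove_inner[OF assms] assms by (simp add: inner_add_left orthonormal_inner)
  then show "(u + t *\<^sub>R b) \<bullet> b = t" "drop_coord b (u + t *\<^sub>R b) = u" by (simp_all add: drop_coord_def)
  show "u + t *\<^sub>R b \<in> span B"
    using assms by (intro span_add span_scale span_Diff_mono[OF assms(3)]) (rule span_base)
qed

lemma drop_coord_decomp: "drop_coord b x + (x \<bullet> b) *\<^sub>R b = x"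
  by (simp add: drop_coord_def)

section \<open>Continuously differentiable functions on a span\<close>

text \<open>A function on (an open subset of) \<open>span B\<close> is extended to an open subset of the ambient space
  by composing it with the orthogonal projection.  For the extension, continuity of the partial
  derivatives in the directions of \<open>B\<close> gives a Frechet derivative, so that the usual chain and
  product rules apply.\<close>

definition C1_on :: "'a::real_inner set \<Rightarrow> 'a set \<Rightarrow> ('a \<Rightarrow> 'b::real_normed_vector) \<Rightarrow> ('a \<Rightarrow> 'a \<Rightarrow> 'b) \<Rightarrow> bool" where
  "C1_on B X f f' \<longleftrightarrow> open X \<and>
     (\<forall>x\<in>X. (f has_derivative (\<lambda>h. \<Sum>b\<in>B. (h \<bullet> b) *\<^sub>R f' b x)) (at x)) \<and>
     (\<forall>b\<in>B. continuous_on X (f' b))"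

lemma C1_onD:
  assumes "C1_on B X f f'"
  shows "open X" "\<And>x. x \<in> X \<Longrightarrow> (f has_derivative (\<lambda>h. \<Sum>b\<in>B. (h \<bullet> b) *\<^sub>R f' b x)) (at x)"
    "\<And>b. b \<in> B \<Longrightarrow> continuous_on X (f' b)"
  using assms by (auto simp: C1_on_def)

lemma C1_on_imp_continuous_on: "C1_on B X f f' \<Longrightarrow> continuous_on X f"
  by (meson C1_onD continuous_at_imp_continuous_on has_derivative_continuous)

lemma C1_on_partial:
  assumes "orthonormal B" "C1_on B X f f'" "x + t *\<^sub>R b \<in> X" "b \<in> B"
  shows "((\<lambda>t. f (x + t *\<^sub>R b)) has_vector_derivative f' b (x + t *\<^sub>R b)) (at t)"
proof -
  have d: "((\<lambda>t. x + t *\<^sub>R b) has_derivative (\<lambda>s. s *\<^sub>R b)) (at t)"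
    by (auto intro!: derivative_eq_intros)
  have "((\<lambda>t. f (x + t *\<^sub>R b)) has_derivative (\<lambda>s. \<Sum>c\<in>B. ((s *\<^sub>R b) \<bullet> c) *\<^sub>R f' c (x + t *\<^sub>R b))) (at t)"
    by (rule has_derivative_compose[OF d C1_onD(2)[OF assms(2,3)]])
  moreover have "(\<Sum>c\<in>B. ((s *\<^sub>R b) \<bullet> c) *\<^sub>R f' c (x + t *\<^sub>R b)) = s *\<^sub>R f' b (x + t *\<^sub>R b)" for s
  proof -
    have "(\<Sum>c\<in>B. ((s *\<^sub>R b) \<bullet> c) *\<^sub>R f' c (x + t *\<^sub>R b)) = (\<Sum>c\<in>B. if c = b then s *\<^sub>R f' b (x + t *\<^sub>R b) else 0)"
      by (rule sum.cong) (use assms in \<open>auto simp: orthonormal_inner\<close>)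
    then show ?thesis using assms by (simp add: orthonormal_finite)
  qed
  ultimately show ?thesis by (simp add: has_vector_derivative_def)
qed

lemma C1_on_dir_deriv:
  assumes "orthonormal B" "C1_on B X f f'" "x \<in> X" "b \<in> B"
  shows "dir_deriv b f x = f' b x"
  using C1_on_partial[OF assms(1,2) _ assms(4), of x 0] assms(3)
  by (simp add: dir_deriv_def vector_derivative_at)

lemma C1_on_subset: "C1_on B X f f' \<Longrightarrow> open Y \<Longrightarrow> Y \<subseteq> X \<Longrightarrow> C1_on B Y f f'"
  unfolding C1_on_def by (meson continuous_on_subset subset_eq)

text \<open>Moving from \<open>y\<close> to \<open>y + h\<close> one coordinate at a time, each step is controlled by the mean value
  inequality and the continuity at \<open>x\<close> of the corresponding partial derivative.\<close>

lemma partials_strict_differentiable: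
  fixes f :: "'a::euclidean_space \<Rightarrow> 'b::real_normed_vector"
  assumes B: "orthonormal B" and X: "openin (top_of_set (span B)) X" and x: "x \<in> X"
    and der: "\<And>b y. b \<in> B \<Longrightarrow> y \<in> X \<Longrightarrow> ((\<lambda>t::real. f (y + t *\<^sub>R b)) has_vector_derivative f' b y) (at 0)"
    and cont: "\<And>b. b \<in> B \<Longrightarrow> continuous_on X (f' b)"
    and I: "I \<subseteq> B" and e: "e > 0"
  shows "\<exists>d>0. \<forall>y\<in>span B. \<forall>a. norm (y - x) < d \<longrightarrow> (\<forall>b\<in>I. \<bar>a b\<bar> < d) \<longrightarrow>
           norm (f (y + (\<Sum>b\<in>I. a b *\<^sub>R b)) - f y - (\<Sum>b\<in>I. a b *\<^sub>R f' b x)) \<le> e * (\<Sum>b\<in>I. \<bar>a b\<bar>)"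
proof -
  have "finite I" using I B orthonormal_finite finite_subset by blast
  then show ?thesis using I
  proof (induction I)
    case empty
    show ?case by (intro exI[of _ 1]) auto
  next
    case (insert c I)
    then have cB: "c \<in> B" and IB: "I \<subseteq> B" by auto
    obtain d1 where d1: "d1 > 0" and IH: "\<And>y a. y\<in>span B \<Longrightarrow> norm (y - x) < d1 \<Longrightarrow> (\<forall>b\<in>I. \<bar>a b\<bar> < d1) \<Longrightarrow>
           norm (f (y + (\<Sum>b\<in>I. a b *\<^sub>R b)) - f y - (\<Sum>b\<in>I. a b *\<^sub>R f' b x)) \<le> e * (\<Sum>b\<in>I. \<bar>a b\<bar>)"
      using insert.IH[OF IB] by blast
    obtain d2 where d2: "d2 > 0" "\<And>z. z \<in> span B \<Longrightarrow> dist z x < d2 \<Longrightarrow> z \<in> X"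
      using X x unfolding openin_euclidean_subtopology_iff by blast
    obtain d3 where d3: "d3 > 0" "\<And>z. z \<in> X \<Longrightarrow> dist z x < d3 \<Longrightarrow> dist (f' c z) (f' c x) < e"
      using cont[OF cB] x e unfolding continuous_on_iff by metis
    define d4 where "d4 = min d2 d3"
    have d4: "d4 > 0" using d2 d3 by (simp add: d4_def)
    define d where "d = min d1 (d4 / (real (card I) + 3))"
    have d: "d > 0" "d \<le> d1" "d * (real (card I) + 3) \<le> d4"
    proof -
      show "d > 0" "d \<le> d1" using d1 d4 by (auto simp: d_def)
      have "d * (real (card I) + 3) \<le> d4 / (real (card I) + 3) * (real (card I) + 3)"
        unfolding d_def by (intro mult_right_mono) auto
      also have "\<dots> = d4" by (simp add: add_nonneg_eq_0_iff)
      finally show "d * (real (card I) + 3) \<le> d4" .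
    qed
    show ?case
    proof (intro exI[of _ d] conjI ballI allI impI)
      fix y a assume y: "y \<in> span B" "norm (y - x) < d" and a: "\<forall>b\<in>insert c I. \<bar>a b\<bar> < d"
      define z where "z = y + (\<Sum>b\<in>I. a b *\<^sub>R b)"
      have zB: "z \<in> span B" unfolding z_def
        using y IB by (intro span_add span_sum span_scale) (auto intro: span_base)
      have nI: "norm (\<Sum>b\<in>I. a b *\<^sub>R b) \<le> real (card I) * d"
      proof -
        have "norm (\<Sum>b\<in>I. a b *\<^sub>R b) \<le> (\<Sum>b\<in>I. d)"
        proof (rule sum_norm_le)
          fix b assume "b \<in> I"
          then show "norm (a b *\<^sub>R b) \<le> d" using a IB norm_orthonormal[OF B, of b] by (auto simp: less_imp_le)
        qed
        then show ?thesis by simp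
      qed
      have near: "z + t *\<^sub>R c \<in> X \<and> dist (z + t *\<^sub>R c) x < d4" if "\<bar>t\<bar> \<le> \<bar>a c\<bar>" for t
      proof -
        have tc: "norm (t *\<^sub>R c) \<le> d" using that a norm_orthonormal[OF B cB] by auto
        have "norm (z + t *\<^sub>R c - x) \<le> norm (y - x) + norm (\<Sum>b\<in>I. a b *\<^sub>R b) + norm (t *\<^sub>R c)"
          unfolding z_def by (smt (verit) norm_triangle_ineq add.commute add.left_commute add_diff_eq)
        also have "\<dots> < d * (real (card I) + 3)" using y nI tc d(1) by (simp add: algebra_simps)
        finally have "dist (z + t *\<^sub>R c) x < d4" using d by (simp add: dist_norm)
        moreover have "z + t *\<^sub>R c \<in> span B" using zB cB by (intro span_add span_scale) (auto intro: span_base)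
        ultimately show ?thesis using d2 by (auto simp: d4_def)
      qed
      define g where "g t = f (z + t *\<^sub>R c) - t *\<^sub>R f' c x" for t
      have gd: "(g has_vector_derivative (f' c (z + t *\<^sub>R c) - f' c x)) (at t within closed_segment 0 (a c))"
        if t: "t \<in> closed_segment 0 (a c)" for t
      proof -
        have ta: "\<bar>t\<bar> \<le> \<bar>a c\<bar>" using t by (auto simp: closed_segment_eq_real_ivl split: if_splits)
        have "((\<lambda>s. f ((z + t *\<^sub>R c) + s *\<^sub>R c)) has_vector_derivative f' c (z + t *\<^sub>R c)) (at (t - t))"
          using der[OF cB] near[OF ta] by simp
        moreover have "((\<lambda>s. s - t) has_vector_derivative 1) (at t)"
          by (auto intro!: derivative_eq_intros simp: has_vector_derivative_def)
        ultimately have "(((\<lambda>s. f ((z + t *\<^sub>R c) + s *\<^sub>R c)) \<circ> (\<lambda>s. s - t)) has_vector_derivative 1 *\<^sub>R f' c (z + t *\<^sub>R c)) (at t)"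
          by (intro vector_diff_chain_at)
        then have "((\<lambda>s. f (z + s *\<^sub>R c)) has_vector_derivative f' c (z + t *\<^sub>R c)) (at t)"
          by (simp add: o_def algebra_simps)
        then have "(g has_vector_derivative (f' c (z + t *\<^sub>R c) - f' c x)) (at t)"
          unfolding g_def by (auto intro!: derivative_eq_intros)
        then show ?thesis by (rule has_vector_derivative_at_within)
      qed
      have "norm (g (a c) - g 0) \<le> e * norm (a c - 0)"
      proof (rule differentiable_bound[where S = "closed_segment 0 (a c)"])
        show "(g has_derivative (\<lambda>h. h *\<^sub>R (f' c (z + t *\<^sub>R c) - f' c x))) (at t within closed_segment 0 (a c))"
          if "t \<in> closed_segment 0 (a c)" for t
          using gd[OF that] by (simp add: has_vector_derivative_def)
        show "onorm (\<lambda>h. h *\<^sub>R (f' c (z + t *\<^sub>R c) - f' c x)) \<le> e" if t: "t \<in> closed_segment 0 (a c)" for t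
        proof -
          have ta: "\<bar>t\<bar> \<le> \<bar>a c\<bar>" using t by (auto simp: closed_segment_eq_real_ivl split: if_splits)
          have "norm (f' c (z + t *\<^sub>R c) - f' c x) \<le> e"
            using d3(2)[of "z + t *\<^sub>R c"] near[OF ta] by (auto simp: dist_norm d4_def)
          then show ?thesis
            using mult_left_mono[of "norm (f' c (z + t *\<^sub>R c) - f' c x)" e]
            by (intro onorm_bound) (auto simp: e less_imp_le mult.commute[of e])
        qed
      qed auto
      then have 1: "norm (f (z + a c *\<^sub>R c) - f z - a c *\<^sub>R f' c x) \<le> e * \<bar>a c\<bar>"
        by (simp add: g_def algebra_simps)
      have 2: "norm (f z - f y - (\<Sum>b\<in>I. a b *\<^sub>R f' b x)) \<le> e * (\<Sum>b\<in>I. \<bar>a b\<bar>)"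
        unfolding z_def using y a d by (intro IH) auto
      have "f (y + (\<Sum>b\<in>insert c I. a b *\<^sub>R b)) - f y - (\<Sum>b\<in>insert c I. a b *\<^sub>R f' b x)
         = (f (z + a c *\<^sub>R c) - f z - a c *\<^sub>R f' c x) + (f z - f y - (\<Sum>b\<in>I. a b *\<^sub>R f' b x))"
        using insert.hyps by (simp add: z_def algebra_simps)
      then show "norm (f (y + (\<Sum>b\<in>insert c I. a b *\<^sub>R b)) - f y - (\<Sum>b\<in>insert c I. a b *\<^sub>R f' b x))
          \<le> e * (\<Sum>b\<in>insert c I. \<bar>a b\<bar>)"
        using 1 2 insert.hyps norm_triangle_ineq[of "f (z + a c *\<^sub>R c) - f z - a c *\<^sub>R f' c x" "f z - f y - (\<Sum>b\<in>I. a b *\<^sub>R f' b x)"]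
        by (simp add: algebra_simps)
    qed (rule d)
  qed
qed

lemma open_proj_vimage:
  fixes B :: "'a::euclidean_space set"
  assumes "openin (top_of_set (span B)) X"
  shows "open (oproj B -` X)"
proof -
  obtain T where "open T" and T: "X = span B \<inter> T" using assms by (metis openin_open)
  then have "oproj B -` X = oproj B -` T" using proj_in_span by auto
  then show ?thesis using \<open>open T\<close> by (simp add: open_vimage continuous_on_proj continuous_on_id)
qed

lemma Ck_on_imp_C1_on_proj:
  fixes f :: "'a::euclidean_space \<Rightarrow> 'b::real_normed_vector"
  assumes B: "orthonormal B" and X: "openin (top_of_set (span B)) X" and f: "Ck_on 1 B X f"
  shows "C1_on B (oproj B -` X) (f \<circ> oproj B) (\<lambda>b. dir_deriv b f \<circ> oproj B)"
  unfolding C1_on_def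
proof (intro conjI ballI)
  have diff: "\<And>b y. b \<in> B \<Longrightarrow> y \<in> X \<Longrightarrow> (\<lambda>t::real. f (y + t *\<^sub>R b)) differentiable (at 0)"
    and cont: "\<And>b. b \<in> B \<Longrightarrow> continuous_on X (dir_deriv b f)"
    using f by auto
  have der: "((\<lambda>t::real. f (y + t *\<^sub>R b)) has_vector_derivative dir_deriv b f y) (at 0)"
    if "b \<in> B" "y \<in> X" for b y
    using diff[OF that] unfolding dir_deriv_def using vector_derivative_works by blast
  show "open (oproj B -` X)" by (rule open_proj_vimage[OF X])
  show "continuous_on (oproj B -` X) (dir_deriv b f \<circ> oproj B)" if "b \<in> B" for b
    using cont[OF that] by (intro continuous_on_compose continuous_on_proj continuous_on_id)
      (auto intro: continuous_on_subset)
  fix x assume x: "x \<in> oproj B -` X"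
  let ?D = "\<lambda>h. \<Sum>b\<in>B. (h \<bullet> b) *\<^sub>R (dir_deriv b f \<circ> oproj B) x"
  show "(f \<circ> oproj B has_derivative ?D) (at x)"
    unfolding has_derivative_at_alt
  proof (intro conjI allI impI)
    show "bounded_linear ?D"
      by (intro bounded_linear_sum bounded_linear_compose[OF bounded_linear_scaleR_left] bounded_linear_inner_left)
    fix e :: real assume e: "e > 0"
    define e' where "e' = e / (real (card B) + 1)"
    have e': "e' > 0" "e' * real (card B) \<le> e" using e by (auto simp: e'_def field_simps)
    obtain d where d: "d > 0" and *: "\<And>y a. y\<in>span B \<Longrightarrow> norm (y - oproj B x) < d \<Longrightarrow> (\<forall>b\<in>B. \<bar>a b\<bar> < d) \<Longrightarrow>
           norm (f (y + (\<Sum>b\<in>B. a b *\<^sub>R b)) - f y - (\<Sum>b\<in>B. a b *\<^sub>R dir_deriv b f (oproj B x))) \<le> e' * (\<Sum>b\<in>B. \<bar>a b\<bar>)"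
      using partials_strict_differentiable[OF B X _ der cont order_refl e'(1), of "oproj B x"] x by auto
    show "\<exists>d>0. \<forall>y. norm (y - x) < d \<longrightarrow>
             norm ((f \<circ> oproj B) y - (f \<circ> oproj B) x - ?D (y - x)) \<le> e * norm (y - x)"
    proof (intro exI[of _ d] conjI allI impI d)
      fix y assume y: "norm (y - x) < d"
      have le: "\<bar>(y - x) \<bullet> b\<bar> \<le> norm (y - x)" if "b \<in> B" for b by (rule abs_inner_orthonormal_le[OF B that])
      have "norm (f (oproj B x + (\<Sum>b\<in>B. ((y-x) \<bullet> b) *\<^sub>R b)) - f (oproj B x) - (\<Sum>b\<in>B. ((y - x) \<bullet> b) *\<^sub>R dir_deriv b f (oproj B x)))
         \<le> e' * (\<Sum>b\<in>B. \<bar>(y - x) \<bullet> b\<bar>)"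
        using d y le by (intro *) (auto simp: proj_in_span intro: le_less_trans)
      moreover have "oproj B x + (\<Sum>b\<in>B. ((y-x) \<bullet> b) *\<^sub>R b) = oproj B y"
        by (simp add: oproj_def sum.distrib[symmetric] algebra_simps)
      moreover have "(\<Sum>b\<in>B. \<bar>(y - x) \<bullet> b\<bar>) \<le> real (card B) * norm (y - x)"
        using sum_bounded_above[of B "\<lambda>b. \<bar>(y - x) \<bullet> b\<bar>" "norm (y - x)"] le by simp
      ultimately show "norm ((f \<circ> oproj B) y - (f \<circ> oproj B) x - ?D (y - x)) \<le> e * norm (y - x)"
        using e' by (simp add: o_def) (smt (verit) mult.assoc mult_left_mono mult_right_mono norm_ge_zero)
    qed
  qed
qed

section \<open>Lebesgue measure on a span\<close>

lemma sets_lborel_span [simp, measurable_cong]: "sets (lborel_span B) = sets borel"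
  by (simp add: lborel_span_def)

lemma space_lborel_span [simp]: "space (lborel_span B) = UNIV"
  by (simp add: lborel_span_def)

lemma measurable_coordinate_sum [measurable]:
  fixes B :: "'a::euclidean_space set"
  shows "(\<lambda>v. \<Sum>b\<in>B. v b *\<^sub>R b) \<in> borel_measurable (\<Pi>\<^sub>M b\<in>B. (lborel :: real measure))"
  by measurable

lemma nn_integral_lborel_span:
  fixes B :: "'a::euclidean_space set"
  assumes [measurable]: "F \<in> borel_measurable borel"
  shows "(\<integral>\<^sup>+ x. F x \<partial>lborel_span B) = (\<integral>\<^sup>+ v. F (\<Sum>b\<in>B. v b *\<^sub>R b) \<partial>(\<Pi>\<^sub>M b\<in>B. lborel))"
  unfolding lborel_span_def by (subst nn_integral_distr) (auto intro: measurable_coordinate_sum)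

lemma AE_lborel_span:
  fixes B :: "'a::euclidean_space set"
  shows "AE x in lborel_span B. x \<in> span B"
  unfolding lborel_span_def
  by (subst AE_distr_iff[OF measurable_coordinate_sum])
     (auto intro!: AE_I2 span_sum span_scale simp: span_base)

lemma product_sigma_finite_lborel: "product_sigma_finite (\<lambda>_::'a. (lborel :: real measure))"
  by (simp add: product_sigma_finite_def sigma_finite_lborel)

lemma nn_integral_lborel_span_prod:
  fixes B :: "'a::euclidean_space set"
  assumes B: "orthonormal B" and [measurable]: "\<And>b. b \<in> B \<Longrightarrow> g b \<in> borel_measurable borel"
  shows "(\<integral>\<^sup>+ x. (\<Prod>b\<in>B. g b (x \<bullet> b)) \<partial>lborel_span B) = (\<Prod>b\<in>B. \<integral>\<^sup>+ t. g b t \<partial>lborel)"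
proof -
  interpret product_sigma_finite "\<lambda>_::'a. (lborel :: real measure)" by (rule product_sigma_finite_lborel)
  have "(\<integral>\<^sup>+ x. (\<Prod>b\<in>B. g b (x \<bullet> b)) \<partial>lborel_span B)
      = (\<integral>\<^sup>+ v. (\<Prod>b\<in>B. g b ((\<Sum>b\<in>B. v b *\<^sub>R b) \<bullet> b)) \<partial>(\<Pi>\<^sub>M b\<in>B. lborel))"
    by (rule nn_integral_lborel_span) measurable
  also have "\<dots> = (\<integral>\<^sup>+ v. (\<Prod>b\<in>B. g b (v b)) \<partial>(\<Pi>\<^sub>M b\<in>B. lborel))"
    by (intro nn_integral_cong prod.cong refl) (simp add: inner_orthonormal_sum[OF B])
  also have "\<dots> = (\<Prod>b\<in>B. \<integral>\<^sup>+ t. g b t \<partial>lborel)"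
    by (rule product_nn_integral_prod) (use B in \<open>auto simp: orthonormal_finite\<close>)
  finally show ?thesis .
qed

lemma emeasure_lborel_span_cube:
  fixes B :: "'a::euclidean_space set"
  assumes B: "orthonormal B"
  shows "emeasure (lborel_span B) {x. \<forall>b\<in>B. \<bar>x \<bullet> b\<bar> \<le> R} < \<infinity>"
proof -
  have [measurable]: "{x::'a. \<forall>b\<in>B. \<bar>x \<bullet> b\<bar> \<le> R} \<in> sets borel"
    using orthonormal_finite[OF B] by measurable
  have "emeasure (lborel_span B) {x. \<forall>b\<in>B. \<bar>x \<bullet> b\<bar> \<le> R} = (\<integral>\<^sup>+ x. (\<Prod>b\<in>B. indicator {-R..R} (x \<bullet> b)) \<partial>lborel_span B)"
  proof -
    have "(\<Prod>b\<in>B. indicator {-R..R} (x \<bullet> b)) = (indicator {x. \<forall>b\<in>B. \<bar>x \<bullet> b\<bar> \<le> R} x :: ennreal)" for x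
    proof (cases "\<forall>b\<in>B. \<bar>x \<bullet> b\<bar> \<le> R")
      case True
      then show ?thesis by (auto intro!: prod.neutral simp: indicator_def abs_le_iff)
    next
      case False
      then obtain b where "b \<in> B" "x \<bullet> b \<notin> {-R..R}" by force
      then show ?thesis using False orthonormal_finite[OF B] by (auto simp: prod_zero_iff intro!: bexI[of _ b])
    qed
    then show ?thesis by simp
  qed
  also have "\<dots> = (\<Prod>b\<in>B. emeasure lborel {-R..R})"
    by (subst nn_integral_lborel_span_prod[OF B]) auto
  also have "\<dots> < \<infinity>" by (auto simp: emeasure_lborel_Icc_eq power_less_top_ennreal)
  finally show ?thesis .
qed

lemma emeasure_lborel_span_bounded:
  fixes B :: "'a::euclidean_space set"
  assumes B: "orthonormal B" and A: "bounded A"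
  shows "emeasure (lborel_span B) A < \<infinity>"
proof -
  obtain R where R: "\<And>x. x \<in> A \<Longrightarrow> norm x \<le> R" using A by (auto simp: bounded_iff)
  have [measurable]: "{x::'a. \<forall>b\<in>B. \<bar>x \<bullet> b\<bar> \<le> R} \<in> sets borel"
    using orthonormal_finite[OF B] by measurable
  have "emeasure (lborel_span B) A \<le> emeasure (lborel_span B) {x. \<forall>b\<in>B. \<bar>x \<bullet> b\<bar> \<le> R}"
    using R abs_inner_orthonormal_le[OF B] by (intro emeasure_mono) (auto intro: order_trans)
  then show ?thesis using emeasure_lborel_span_cube[OF B, of R] by simp
qed

lemma sigma_finite_lborel_span:
  fixes B :: "'a::euclidean_space set"
  assumes B: "orthonormal B"
  shows "sigma_finite_measure (lborel_span B)"
proof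
  let ?A = "range (\<lambda>k::nat. cball (0::'a) (real k))"
  have "\<exists>k::nat. norm x \<le> real k" for x :: 'a by (rule real_arch_simple)
  then show "\<exists>A. countable A \<and> A \<subseteq> sets (lborel_span B) \<and> \<Union> A = space (lborel_span B) \<and> (\<forall>a\<in>A. emeasure (lborel_span B) a \<noteq> \<infinity>)"
    by (intro exI[of _ ?A]) (use emeasure_lborel_span_bounded[OF B bounded_cball] in \<open>auto simp: less_top\<close>)
qed

lemma nn_integral_lborel_span_split:
  fixes B :: "'a::euclidean_space set"
  assumes B: "orthonormal B" and b: "b \<in> B" and [measurable]: "F \<in> borel_measurable borel"
  shows "(\<integral>\<^sup>+ x. F x \<partial>lborel_span B) = (\<integral>\<^sup>+ u. (\<integral>\<^sup>+ t. F (u + t *\<^sub>R b) \<partial>lborel) \<partial>lborel_span (B - {b}))"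
proof -
  interpret product_sigma_finite "\<lambda>_::'a. (lborel :: real measure)" by (rule product_sigma_finite_lborel)
  let ?C = "B - {b}"
  have fin: "finite ?C" and ins: "insert b ?C = B" using B b by (auto simp: orthonormal_finite)
  have "(\<integral>\<^sup>+ x. F x \<partial>lborel_span B) = (\<integral>\<^sup>+ v. F (\<Sum>c\<in>insert b ?C. v c *\<^sub>R c) \<partial>(\<Pi>\<^sub>M c\<in>insert b ?C. lborel))"
    unfolding ins by (rule nn_integral_lborel_span) simp
  also have "\<dots> = (\<integral>\<^sup>+ v. (\<integral>\<^sup>+ t. F (\<Sum>c\<in>insert b ?C. (v(b := t)) c *\<^sub>R c) \<partial>lborel) \<partial>(\<Pi>\<^sub>M c\<in>?C. lborel))"
    by (rule product_nn_integral_insert) (use fin in auto)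
  also have "\<dots> = (\<integral>\<^sup>+ v. (\<integral>\<^sup>+ t. F ((\<Sum>c\<in>?C. v c *\<^sub>R c) + t *\<^sub>R b) \<partial>lborel) \<partial>(\<Pi>\<^sub>M c\<in>?C. lborel))"
  proof (intro nn_integral_cong)
    fix v :: "'a \<Rightarrow> real" and t :: real
    have "(\<Sum>c\<in>?C. (v(b := t)) c *\<^sub>R c) = (\<Sum>c\<in>?C. v c *\<^sub>R c)" by (rule sum.cong) auto
    then show "F (\<Sum>c\<in>insert b ?C. (v(b := t)) c *\<^sub>R c) = F ((\<Sum>c\<in>?C. v c *\<^sub>R c) + t *\<^sub>R b)"
      using fin by (subst sum.insert) (simp_all del: sum.insert_remove add: add.commute)
  qed
  also have "\<dots> = (\<integral>\<^sup>+ u. (\<integral>\<^sup>+ t. F (u + t *\<^sub>R b) \<partial>lborel) \<partial>lborel_span ?C)"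
    by (rule nn_integral_lborel_span[symmetric]) measurable
  finally show ?thesis .
qed

lemma lborel_span_split:
  fixes B :: "'a::euclidean_space set"
  assumes B: "orthonormal B" and b: "b \<in> B"
  shows "lborel_span B = distr (lborel_span (B - {b}) \<Otimes>\<^sub>M lborel) borel (\<lambda>(u, t). u + t *\<^sub>R b)"
proof (rule measure_eqI)
  fix A assume "A \<in> sets (lborel_span B)"
  then have [measurable]: "A \<in> sets borel" by simp
  have "emeasure (lborel_span B) A = (\<integral>\<^sup>+ u. (\<integral>\<^sup>+ t. indicator A (u + t *\<^sub>R b) \<partial>lborel) \<partial>lborel_span (B - {b}))"
    by (subst nn_integral_lborel_span_split[OF B b, symmetric]) auto
  also have "\<dots> = (\<integral>\<^sup>+ z. indicator A (case z of (u, t) \<Rightarrow> u + t *\<^sub>R b) \<partial>(lborel_span (B - {b}) \<Otimes>\<^sub>M lborel))"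
    by (subst lborel.nn_integral_fst[symmetric]) (auto simp: split_def)
  also have "\<dots> = (\<integral>\<^sup>+ x. indicator A x \<partial>distr (lborel_span (B - {b}) \<Otimes>\<^sub>M lborel) borel (\<lambda>(u, t). u + t *\<^sub>R b))"
    by (rule nn_integral_distr[symmetric]) measurable
  finally show "emeasure (lborel_span B) A = emeasure (distr (lborel_span (B - {b}) \<Otimes>\<^sub>M lborel) borel (\<lambda>(u, t). u + t *\<^sub>R b)) A"
    by simp
qed simp

lemma pair_sigma_finite_lborel_span:
  fixes B :: "'a::euclidean_space set"
  assumes "orthonormal B"
  shows "pair_sigma_finite (lborel_span B) (lborel :: real measure)"
  using sigma_finite_lborel_span[OF assms] sigma_finite_lborel by (simp add: pair_sigma_finite_def)

lemma integral_lborel_span_split: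
  fixes B :: "'a::euclidean_space set" and F :: "'a \<Rightarrow> 'b::{banach, second_countable_topology}"
  assumes B: "orthonormal B" and b: "b \<in> B" and F: "integrable (lborel_span B) F"
  shows "(\<integral> x. F x \<partial>lborel_span B) = (\<integral> u. (\<integral> t. F (u + t *\<^sub>R b) \<partial>lborel) \<partial>lborel_span (B - {b}))"
    and "(\<integral> x. F x \<partial>lborel_span B) = (\<integral> t. (\<integral> u. F (u + t *\<^sub>R b) \<partial>lborel_span (B - {b})) \<partial>lborel)"
proof -
  let ?M = "lborel_span (B - {b})"
  interpret pair_sigma_finite ?M "lborel :: real measure"
    by (rule pair_sigma_finite_lborel_span[OF orthonormal_subset[OF B]]) blast
  have [measurable]: "F \<in> borel_measurable borel"
    using borel_measurable_integrable[OF F] by (simp cong: measurable_cong_sets)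
  have int: "integrable (?M \<Otimes>\<^sub>M lborel) (\<lambda>(u, t). F (u + t *\<^sub>R b))"
    using F unfolding lborel_span_split[OF B b] by (subst (asm) integrable_distr_eq) (auto simp: split_def)
  have eq: "(\<integral> x. F x \<partial>lborel_span B) = (\<integral> z. (case z of (u, t) \<Rightarrow> F (u + t *\<^sub>R b)) \<partial>(?M \<Otimes>\<^sub>M lborel))"
    unfolding lborel_span_split[OF B b] by (subst integral_distr) (auto simp: split_def)
  show "(\<integral> x. F x \<partial>lborel_span B) = (\<integral> u. (\<integral> t. F (u + t *\<^sub>R b) \<partial>lborel) \<partial>?M)"
    unfolding eq using integral_fst'[OF int] by simp
  show "(\<integral> x. F x \<partial>lborel_span B) = (\<integral> t. (\<integral> u. F (u + t *\<^sub>R b) \<partial>?M) \<partial>lborel)"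
    unfolding eq using integral_snd[OF int] by simp
qed

lemma integrable_lborel_span_bounded_support:
  fixes B :: "'a::euclidean_space set" and F :: "'a \<Rightarrow> 'b::{banach, second_countable_topology}"
  assumes B: "orthonormal B" and F: "F \<in> borel_measurable borel" and A: "bounded A"
    and supp: "\<And>x. x \<in> span B \<Longrightarrow> x \<notin> A \<Longrightarrow> F x = 0" and C: "\<And>x. x \<in> span B \<Longrightarrow> norm (F x) \<le> C"
  shows "integrable (lborel_span B) F"
proof -
  obtain R where R: "A \<subseteq> cball 0 R" using A unfolding bounded_iff by (metis mem_cball_0 subsetI)
  have "integrable (lborel_span B) (\<lambda>x. indicator (cball 0 R) x *\<^sub>R C)"
    by (rule integrable_real_indicator[THEN integrable_scaleR_left])
       (use emeasure_lborel_span_bounded[OF B, of "cball 0 R"] in auto)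
  then show ?thesis
  proof (rule Bochner_Integration.integrable_bound)
    show "F \<in> borel_measurable (lborel_span B)" using F by (simp cong: measurable_cong_sets)
    show "AE x in lborel_span B. norm (F x) \<le> norm (indicator (cball 0 R) x *\<^sub>R C)"
      using AE_lborel_span
    proof eventually_elim
      fix x :: 'a assume x: "x \<in> span B"
      show "norm (F x) \<le> norm (indicator (cball 0 R) x *\<^sub>R C)"
      proof (cases "x \<in> A")
        case True then show ?thesis using R C[OF x] by (auto simp: indicator_def)
      qed (simp add: supp[OF x])
    qed
  qed
qed

section \<open>Radial integrals and an approximate identity\<close>

lemma nn_integral_powr_interval_finite:
  fixes a R :: real
  assumes "a < 1" "R \<ge> 0"
  shows "(\<integral>\<^sup>+ t. (if t = 0 then \<infinity> else ennreal (indicator {-R..R} t * \<bar>t\<bar> powr (-a))) \<partial>lborel) < \<infinity>"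
proof -
  let ?h = "\<lambda>t::real. indicator {0..R} t * ennreal (t powr (-a))"
  have 1: "(\<integral>\<^sup>+ t. ?h t \<partial>lborel) < \<infinity>"
    using nn_integral_has_integral_lebesgue'[OF _ has_integral_powr_from_0[of "-a" R]] assms
    by (simp add: mult.commute)
  have "(\<integral>\<^sup>+ t. ?h t \<partial>lborel) = ennreal \<bar>-1\<bar> * (\<integral>\<^sup>+ t. ?h (0 + (-1) * t) \<partial>lborel)"
    by (rule nn_integral_real_affine) auto
  then have 2: "(\<integral>\<^sup>+ t. ?h (- t) \<partial>lborel) < \<infinity>" using 1 by simp
  have "(\<integral>\<^sup>+ t. (if t = 0 then \<infinity> else ennreal (indicator {-R..R} t * \<bar>t\<bar> powr (-a))) \<partial>lborel) \<le> (\<integral>\<^sup>+ t. ?h t + ?h (- t) \<partial>lborel)"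
    by (rule nn_integral_mono_AE) (use AE_lborel_singleton[of "0::real"] in eventually_elim, auto simp: indicator_def)
  also have "\<dots> = (\<integral>\<^sup>+ t. ?h t \<partial>lborel) + (\<integral>\<^sup>+ t. ?h (- t) \<partial>lborel)" by (rule nn_integral_add) auto
  also have "\<dots> < \<infinity>" using 1 2 by simp
  finally show ?thesis .
qed

text \<open>Every coordinate of \<open>z\<close> is at most \<open>norm z\<close>, so with \<open>n = card B\<close> the singularity
  \<open>1 / norm z ^ (n - 1)\<close> is at most the product over the coordinates \<open>t\<close> of \<open>z\<close> of the functions
  \<open>\<bar>t\<bar> powr (- (n - 1) / n)\<close>, which are locally integrable on the line.\<close>

lemma norm_power_locally_integrable:
  fixes B :: "'a::euclidean_space set"
  assumes B: "orthonormal B" and n: "card B = Suc n" "n > 0" and x: "x \<in> span B" and A: "bounded A"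
  shows "(\<integral>\<^sup>+ y. indicator A y * ennreal (1 / norm (y - x) ^ n) \<partial>lborel_span B) < \<infinity>"
proof -
  define a where "a = real n / real (Suc n)"
  have a: "a < 1" "a > 0" using n by (auto simp: a_def)
  obtain R where R: "\<And>y. y \<in> A \<Longrightarrow> norm (y - x) \<le> R" and R0: "R \<ge> 0"
  proof -
    obtain R0 where "A \<subseteq> cball x R0" using A unfolding bounded_any_center[of _ x] by (metis mem_cball subsetI)
    then have "\<And>y. y \<in> A \<Longrightarrow> norm (y - x) \<le> max R0 0" by (auto simp: dist_norm norm_minus_commute subset_eq le_max_iff_disj)
    then show ?thesis using that[of "max R0 0"] by auto
  qed
  let ?h = "\<lambda>t. (if t = 0 then \<infinity> else ennreal (indicator {-R..R} t * \<bar>t\<bar> powr (-a)))"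
  have "(\<integral>\<^sup>+ y. indicator A y * ennreal (1 / norm (y - x) ^ n) \<partial>lborel_span B) \<le>
        (\<integral>\<^sup>+ y. (\<Prod>b\<in>B. ?h (y \<bullet> b - x \<bullet> b)) \<partial>lborel_span B)"
  proof (rule nn_integral_mono_AE)
    show "AE y in lborel_span B. indicator A y * ennreal (1 / norm (y - x) ^ n) \<le> (\<Prod>b\<in>B. ?h (y \<bullet> b - x \<bullet> b))"
      using AE_lborel_span
    proof eventually_elim
      fix y assume y: "y \<in> span B"
      show "indicator A y * ennreal (1 / norm (y - x) ^ n) \<le> (\<Prod>b\<in>B. ?h (y \<bullet> b - x \<bullet> b))"
      proof (cases "y \<in> A \<and> y \<noteq> x")
        case True
        let ?r = "norm (y - x)"
        have r: "0 < ?r" "?r \<le> R" using True R by auto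
        have "(?r powr (-a)) ^ Suc n = ?r powr (- real n)"
          using r(1) by (simp only: powr_realpow[symmetric] powr_gt_zero powr_powr) (simp add: a_def powr_powr)
        then have "1 / ?r ^ n = (\<Prod>b\<in>B. ?r powr (-a))"
          using r n by (simp add: powr_minus powr_realpow divide_inverse)
        then have "ennreal (1 / ?r ^ n) = (\<Prod>b\<in>B. ennreal (?r powr (-a)))"
          by (simp add: prod_ennreal del: prod_constant)
        also have "\<dots> \<le> (\<Prod>b\<in>B. ?h (y \<bullet> b - x \<bullet> b))"
        proof (rule prod_mono_ennreal)
          fix b assume b: "b \<in> B"
          have le: "\<bar>y \<bullet> b - x \<bullet> b\<bar> \<le> ?r"
            using abs_inner_orthonormal_le[OF B b, of "y - x"] by (simp add: inner_diff_left)
          show "ennreal (?r powr (-a)) \<le> ?h (y \<bullet> b - x \<bullet> b)"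
          proof (cases "y \<bullet> b = x \<bullet> b")
            case False
            have "?r powr (-a) \<le> \<bar>y \<bullet> b - x \<bullet> b\<bar> powr (-a)"
              using le False a by (intro powr_mono2') auto
            moreover have "y \<bullet> b - x \<bullet> b \<in> {-R..R}" using le r by auto
            ultimately show ?thesis using False by (simp add: indicator_def)
          qed simp
        qed
        finally show ?thesis using True by simp
      next
        case False
        then show ?thesis using n(2) by (auto simp: indicator_def power_0_left)
      qed
    qed
  qed
  also have "\<dots> = (\<Prod>b\<in>B. \<integral>\<^sup>+ t. ?h (t - x \<bullet> b) \<partial>lborel)"
    by (rule nn_integral_lborel_span_prod[OF B, where g="\<lambda>b t. ?h (t - x \<bullet> b)"]) measurable
  also have "\<dots> = (\<Prod>b\<in>B. \<integral>\<^sup>+ t. ?h t \<partial>lborel)"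
  proof (rule prod.cong[OF refl])
    fix b
    show "(\<integral>\<^sup>+ t. ?h (t - x \<bullet> b) \<partial>lborel) = (\<integral>\<^sup>+ t. ?h t \<partial>lborel)"
    proof -
      have "(\<integral>\<^sup>+ t. ?h t \<partial>lborel) = ennreal \<bar>1\<bar> * (\<integral>\<^sup>+ t. ?h (- (x \<bullet> b) + 1 * t) \<partial>lborel)"
        by (rule nn_integral_real_affine) auto
      moreover have "- (x \<bullet> b) + 1 * t = t - x \<bullet> b" for t by simp
      ultimately show ?thesis by (simp only: abs_one ennreal_1 mult_1_left)
    qed
  qed
  also have "\<dots> < \<infinity>"
    using nn_integral_powr_interval_finite[OF a(1) R0] by (simp add: power_less_top_ennreal)
  finally show ?thesis .
qed

lemma nn_integral_Gamma_scaled: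
  fixes s a :: real
  assumes "s > 0" "a > 0"
  shows "(\<integral>\<^sup>+ t. ennreal (indicator {0<..} t * t powr (s - 1) * exp (- a * t)) \<partial>lborel) = ennreal (Gamma s * a powr (- s))"
proof -
  let ?g = "\<lambda>t::real. ennreal (indicator {0..} t * t powr (s - 1) / exp t)"
  let ?f = "\<lambda>t::real. ennreal (indicator {0<..} t * t powr (s - 1) * exp (- a * t))"
  have "ennreal (Gamma s) = (\<integral>\<^sup>+ t. ?g t \<partial>lborel)" by (rule Gamma_conv_nn_integral_real[OF assms(1)])
  also have "\<dots> = ennreal \<bar>a\<bar> * (\<integral>\<^sup>+ t. ?g (0 + a * t) \<partial>lborel)"
    by (rule nn_integral_real_affine) (use assms in auto)
  also have "(\<integral>\<^sup>+ t. ?g (0 + a * t) \<partial>lborel) = (\<integral>\<^sup>+ t. ennreal (a powr (s - 1)) * ?f t \<partial>lborel)"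
  proof (rule nn_integral_cong_AE)
    show "AE t in lborel. ?g (0 + a * t) = ennreal (a powr (s - 1)) * ?f t"
      using AE_lborel_singleton[of "0::real"]
    proof eventually_elim
      fix t :: real assume "t \<noteq> 0"
      then show "?g (0 + a * t) = ennreal (a powr (s - 1)) * ?f t"
        using assms by (cases "t > 0")
          (auto simp: indicator_def ennreal_mult[symmetric] powr_mult exp_minus field_simps zero_le_mult_iff)
    qed
  qed
  also have "\<dots> = ennreal (a powr (s - 1)) * (\<integral>\<^sup>+ t. ?f t \<partial>lborel)" by (rule nn_integral_cmult) measurable
  finally have eq: "ennreal (Gamma s) = ennreal (a powr s) * (\<integral>\<^sup>+ t. ?f t \<partial>lborel)"
    using assms by (simp add: mult.assoc[symmetric] ennreal_mult[symmetric] powr_mult_base)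
  have "ennreal (Gamma s * a powr (- s)) = ennreal (a powr (-s)) * ennreal (Gamma s)"
    using assms by (subst ennreal_mult[symmetric]) (auto simp: mult.commute less_imp_le Gamma_real_pos)
  also have "\<dots> = (ennreal (a powr (-s)) * ennreal (a powr s)) * (\<integral>\<^sup>+ t. ?f t \<partial>lborel)"
    by (simp add: eq mult.assoc)
  also have "ennreal (a powr (-s)) * ennreal (a powr s) = 1"
    using assms by (simp add: ennreal_mult[symmetric] powr_add[symmetric])
  finally show ?thesis by simp
qed

lemma nn_integral_Gaussian:
  fixes t m :: real
  assumes "t > 0"
  shows "(\<integral>\<^sup>+ x. ennreal (exp (- t * (x - m)\<^sup>2)) \<partial>lborel) = ennreal (sqrt (pi / t))"
proof -
  define s where "s = sqrt (1 / (2 * t))"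
  have s: "s > 0" "2 * s\<^sup>2 = 1 / t" using assms by (auto simp: s_def)
  have e: "exp (- t * (x - m)\<^sup>2) = sqrt (pi / t) * normal_density m s x" for x
  proof -
    have "2 * pi * s\<^sup>2 = pi / t" using s(2) by (metis mult.assoc mult.commute mult.right_neutral times_divide_eq_right)
    then show ?thesis using assms s(2) by (simp add: normal_density_def)
  qed
  have "(\<integral>\<^sup>+ x. ennreal (exp (- t * (x - m)\<^sup>2)) \<partial>lborel) = (\<integral>\<^sup>+ x. ennreal (sqrt (pi / t)) * ennreal (normal_density m s x) \<partial>lborel)"
    unfolding e using assms by (intro nn_integral_cong) (simp add: ennreal_mult)
  also have "\<dots> = ennreal (sqrt (pi / t)) * (\<integral>\<^sup>+ x. ennreal (normal_density m s x) \<partial>lborel)"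
    by (rule nn_integral_cmult) measurable
  also have "(\<integral>\<^sup>+ x. ennreal (normal_density m s x) \<partial>lborel) = 1"
    using s by (subst nn_integral_eq_integral) (auto intro: integral_normal_density)
  finally show ?thesis by simp
qed

text \<open>Writing the power as a Gamma integral turns the integrand into a mixture of Gaussians, whose
  integrals over \<open>span B\<close> factor into one-dimensional ones.\<close>

lemma nn_integral_norm_powr:
  fixes B :: "'a::euclidean_space set"
  assumes B: "orthonormal B" and x: "x \<in> span B" and e: "\<epsilon> \<noteq> (0::real)"
  defines "h \<equiv> real (card B) / 2"
  shows "(\<integral>\<^sup>+ y. ennreal (\<epsilon>\<^sup>2 * Gamma (h + 1) / pi powr h * ((norm (y - x))\<^sup>2 + \<epsilon>\<^sup>2) powr (- h - 1)) \<partial>lborel_span B) = 1"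
proof -
  let ?N = "\<lambda>y. (norm (y - x))\<^sup>2 + \<epsilon>\<^sup>2"
  have h: "h \<ge> 0" by (simp add: h_def)
  have N: "?N y > 0" for y using e by (simp add: add_nonneg_pos)
  interpret S: sigma_finite_measure "lborel_span B" by (rule sigma_finite_lborel_span[OF B])
  interpret P: pair_sigma_finite "lborel_span B" "lborel :: real measure" by (rule pair_sigma_finite_lborel_span[OF B])
  have G: "Gamma (h + 1) > 0" using h by (intro Gamma_real_pos) auto
  let ?w = "\<lambda>t::real. indicator {0<..} t * t powr h * exp (- \<epsilon>\<^sup>2 * t)"
  have "(\<integral>\<^sup>+ y. ennreal (Gamma (h + 1) * ?N y powr (- h - 1)) \<partial>lborel_span B)
      = (\<integral>\<^sup>+ y. (\<integral>\<^sup>+ t. ennreal (indicator {0<..} t * t powr h * exp (- ?N y * t)) \<partial>lborel) \<partial>lborel_span B)"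
    using nn_integral_Gamma_scaled[of "h + 1" "?N _"] h N by (intro nn_integral_cong) simp
  also have "\<dots> = (\<integral>\<^sup>+ t. (\<integral>\<^sup>+ y. ennreal (indicator {0<..} t * t powr h * exp (- ?N y * t)) \<partial>lborel_span B) \<partial>lborel)"
    by (rule P.Fubini'[symmetric]) measurable
  also have "\<dots> = (\<integral>\<^sup>+ t. ennreal (pi powr h) * ennreal (indicator {0<..} t * t powr (1 - 1) * exp (- \<epsilon>\<^sup>2 * t)) \<partial>lborel)"
  proof (rule nn_integral_cong)
    fix t :: real
    show "(\<integral>\<^sup>+ y. ennreal (indicator {0<..} t * t powr h * exp (- ?N y * t)) \<partial>lborel_span B)
        = ennreal (pi powr h) * ennreal (indicator {0<..} t * t powr (1 - 1) * exp (- \<epsilon>\<^sup>2 * t))"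
    proof (cases "t > 0")
      case t: True
      have "(\<integral>\<^sup>+ y. ennreal (indicator {0<..} t * t powr h * exp (- ?N y * t)) \<partial>lborel_span B)
          = (\<integral>\<^sup>+ y. ennreal (?w t) * (\<Prod>b\<in>B. ennreal (exp (- t * (y \<bullet> b - x \<bullet> b)\<^sup>2))) \<partial>lborel_span B)"
      proof (rule nn_integral_cong_AE)
        show "AE y in lborel_span B. ennreal (indicator {0<..} t * t powr h * exp (- ?N y * t)) =
                ennreal (?w t) * (\<Prod>b\<in>B. ennreal (exp (- t * (y \<bullet> b - x \<bullet> b)\<^sup>2)))"
          using AE_lborel_span
        proof eventually_elim
          fix y assume y: "y \<in> span B"
          have "(norm (y - x))\<^sup>2 = (\<Sum>b\<in>B. (y \<bullet> b - x \<bullet> b)\<^sup>2)"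
            using norm_span_expansion[OF B, of "y - x"] x y by (simp add: span_diff inner_diff_left)
          then have "exp (- ?N y * t) = exp (- \<epsilon>\<^sup>2 * t) * (\<Prod>b\<in>B. exp (- t * (y \<bullet> b - x \<bullet> b)\<^sup>2))"
            using orthonormal_finite[OF B]
            by (simp add: exp_sum[symmetric] exp_add[symmetric] sum_negf sum_distrib_left[symmetric] algebra_simps)
          then show "ennreal (indicator {0<..} t * t powr h * exp (- ?N y * t)) =
                ennreal (?w t) * (\<Prod>b\<in>B. ennreal (exp (- t * (y \<bullet> b - x \<bullet> b)\<^sup>2)))"
            by (simp add: prod_ennreal ennreal_mult[symmetric] prod_nonneg mult.assoc)
        qed
      qed
      also have "\<dots> = ennreal (?w t) * (\<integral>\<^sup>+ y. (\<Prod>b\<in>B. ennreal (exp (- t * (y \<bullet> b - x \<bullet> b)\<^sup>2))) \<partial>lborel_span B)"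
        by (rule nn_integral_cmult) measurable
      also have "(\<integral>\<^sup>+ y. (\<Prod>b\<in>B. ennreal (exp (- t * (y \<bullet> b - x \<bullet> b)\<^sup>2))) \<partial>lborel_span B) = (\<Prod>b\<in>B. ennreal (sqrt (pi / t)))"
        using nn_integral_lborel_span_prod[OF B, where g="\<lambda>b s. ennreal (exp (- t * (s - x \<bullet> b)\<^sup>2))"]
        unfolding nn_integral_Gaussian[OF t] by measurable
      also have "\<dots> = ennreal ((pi / t) powr h)"
      proof -
        have "sqrt (pi / t) ^ card B = (pi / t) powr h"
          using t by (simp add: h_def powr_half_sqrt[symmetric] powr_realpow[symmetric] powr_powr)
        then show ?thesis by (simp add: prod_ennreal ennreal_power t less_imp_le)
      qed
      finally show ?thesis using t
        by (simp add: ennreal_mult[symmetric] powr_divide algebra_simps)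
    qed (simp add: indicator_def)
  qed
  also have "\<dots> = ennreal (pi powr h) * (\<integral>\<^sup>+ t. ennreal (indicator {0<..} t * t powr (1 - 1) * exp (- \<epsilon>\<^sup>2 * t)) \<partial>lborel)"
    by (rule nn_integral_cmult) measurable
  also have "\<dots> = ennreal (pi powr h) * ennreal (Gamma 1 * (\<epsilon>\<^sup>2) powr (- 1))"
    using nn_integral_Gamma_scaled[of 1 "\<epsilon>\<^sup>2"] e by simp
  also have "\<dots> = ennreal (pi powr h / \<epsilon>\<^sup>2)"
    using e by (simp add: ennreal_mult[symmetric] powr_minus divide_inverse)
  finally have *: "(\<integral>\<^sup>+ y. ennreal (Gamma (h + 1) * ?N y powr (- h - 1)) \<partial>lborel_span B) = ennreal (pi powr h / \<epsilon>\<^sup>2)" .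
  have "(\<integral>\<^sup>+ y. ennreal (\<epsilon>\<^sup>2 * Gamma (h + 1) / pi powr h * ?N y powr (- h - 1)) \<partial>lborel_span B)
      = (\<integral>\<^sup>+ y. ennreal (\<epsilon>\<^sup>2 / pi powr h) * ennreal (Gamma (h + 1) * ?N y powr (- h - 1)) \<partial>lborel_span B)"
    using G by (intro nn_integral_cong) (simp add: ennreal_mult[symmetric])
  also have "\<dots> = ennreal (\<epsilon>\<^sup>2 / pi powr h) * ennreal (pi powr h / \<epsilon>\<^sup>2)"
    by (subst nn_integral_cmult) (measurable, simp add: *)
  also have "\<dots> = 1" using e by (simp add: ennreal_mult[symmetric])
  finally show ?thesis .
qed

text \<open>The image of the regularised Cauchy kernel under the Dirac operator.  With \<open>n = card B\<close> these
  functions form an approximate identity on \<open>span B\<close> as \<open>\<epsilon>\<close> tends to \<open>0\<close>.\<close>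

definition approx_unit :: "nat \<Rightarrow> real \<Rightarrow> 'a::real_normed_vector \<Rightarrow> real" where
  "approx_unit n \<epsilon> z = \<epsilon>\<^sup>2 * Gamma (real n / 2 + 1) / pi powr (real n / 2) * ((norm z)\<^sup>2 + \<epsilon>\<^sup>2) powr (- (real n / 2) - 1)"

lemma approx_unit_nonneg: "approx_unit n \<epsilon> z \<ge> 0"
  unfolding approx_unit_def by (intro mult_nonneg_nonneg divide_nonneg_nonneg less_imp_le[OF Gamma_real_pos]) auto

lemma approx_unit_measurable [measurable]:
  "(\<lambda>y. approx_unit n \<epsilon> (y - x)) \<in> borel_measurable (borel :: 'a::euclidean_space measure)"
  unfolding approx_unit_def by measurable

lemma approx_unit_integral:
  fixes B :: "'a::euclidean_space set"
  assumes B: "orthonormal B" and x: "x \<in> span B" and e: "\<epsilon> \<noteq> (0::real)"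
  shows "integrable (lborel_span B) (\<lambda>y. approx_unit (card B) \<epsilon> (y - x))"
    and "(\<integral> y. approx_unit (card B) \<epsilon> (y - x) \<partial>lborel_span B) = 1"
proof -
  have *: "(\<integral>\<^sup>+ y. ennreal (approx_unit (card B) \<epsilon> (y - x)) \<partial>lborel_span B) = ennreal 1"
    unfolding approx_unit_def using nn_integral_norm_powr[OF B x e] by simp
  have m: "(\<lambda>y. approx_unit (card B) \<epsilon> (y - x)) \<in> borel_measurable (lborel_span B)"
    by (simp cong: measurable_cong_sets)
  show "integrable (lborel_span B) (\<lambda>y. approx_unit (card B) \<epsilon> (y - x))"
    by (rule integrableI_nn_integral_finite[OF m _ *]) (simp add: approx_unit_nonneg)
  show "(\<integral> y. approx_unit (card B) \<epsilon> (y - x) \<partial>lborel_span B) = 1"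
    using * m by (subst integral_eq_nn_integral) (auto simp: approx_unit_nonneg)
qed

text \<open>Away from the centre, \<open>approx_unit n \<epsilon>\<close> is at most a constant times
  \<open>\<epsilon>\<^sup>2 * approx_unit n 1\<close>, which is how the mass concentrates.\<close>

lemma approx_unit_tail:
  assumes d: "d > 0" and z: "norm z \<ge> d" and e: "\<epsilon> \<noteq> 0"
  shows "approx_unit n \<epsilon> z \<le> ((1 + d\<^sup>2) / d\<^sup>2) powr (real n / 2 + 1) * \<epsilon>\<^sup>2 * approx_unit n 1 z"
proof -
  define s where "s = real n / 2 + 1"
  define K where "K = (1 + d\<^sup>2) / d\<^sup>2"
  have K: "K > 0" using d by (auto simp: K_def intro!: divide_pos_pos add_pos_nonneg)
  have d2: "d\<^sup>2 \<le> (norm z)\<^sup>2" using z d by (intro power_mono) auto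
  have "0 \<le> \<epsilon>\<^sup>2 + \<epsilon>\<^sup>2 * d\<^sup>2" by simp
  then have "d\<^sup>2 * ((norm z)\<^sup>2 + 1) \<le> (1 + d\<^sup>2) * ((norm z)\<^sup>2 + \<epsilon>\<^sup>2)"
    using d2 by (simp only: distrib_left distrib_right mult_1_left mult_1_right mult.commute[of "d\<^sup>2" "\<epsilon>\<^sup>2"] mult.commute[of "d\<^sup>2" "(norm z)\<^sup>2"])
  then have le: "((norm z)\<^sup>2 + 1) \<le> K * ((norm z)\<^sup>2 + \<epsilon>\<^sup>2)"
    using d by (simp add: K_def field_simps)
  have pos: "(norm z)\<^sup>2 + 1 > 0" "(norm z)\<^sup>2 + \<epsilon>\<^sup>2 > 0" using e by (auto intro: add_nonneg_pos)
  have "(K * ((norm z)\<^sup>2 + \<epsilon>\<^sup>2)) powr (-s) \<le> ((norm z)\<^sup>2 + 1) powr (-s)"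
    using le pos by (intro powr_mono2') (auto simp: s_def)
  then have "K powr s * (K powr (-s) * ((norm z)\<^sup>2 + \<epsilon>\<^sup>2) powr (-s)) \<le> K powr s * ((norm z)\<^sup>2 + 1) powr (-s)"
    using K pos by (intro mult_left_mono) (auto simp: powr_mult)
  then have "((norm z)\<^sup>2 + \<epsilon>\<^sup>2) powr (-s) \<le> K powr s * ((norm z)\<^sup>2 + 1) powr (-s)"
    using K by (simp add: mult.assoc[symmetric] powr_add[symmetric])
  then have "\<epsilon>\<^sup>2 * Gamma s / pi powr (real n / 2) * ((norm z)\<^sup>2 + \<epsilon>\<^sup>2) powr (-s) \<le>
     \<epsilon>\<^sup>2 * Gamma s / pi powr (real n / 2) * (K powr s * ((norm z)\<^sup>2 + 1) powr (-s))"
    by (rule mult_left_mono)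
       (intro mult_nonneg_nonneg divide_nonneg_nonneg less_imp_le[OF Gamma_real_pos], auto simp: s_def)
  moreover have "- (real n / 2) - 1 = - s" by (simp add: s_def)
  ultimately show ?thesis unfolding approx_unit_def K_def[symmetric] s_def[symmetric]
    by (simp only: power_one mult_1_left mult_ac times_divide_eq_right times_divide_eq_left)
qed

text \<open>Within a small distance \<open>d\<close> of \<open>x\<close> the oscillation of \<open>g\<close> is small; farther away \<open>g\<close> is bounded
  and the tail of the kernel contributes \<open>O(\<epsilon>\<^sup>2)\<close>.\<close>

lemma approx_unit_tendsto:
  fixes B :: "'a::euclidean_space set" and g :: "'a \<Rightarrow> 'b::euclidean_space"
  assumes B: "orthonormal B" and x: "x \<in> span B"
    and g: "g \<in> borel_measurable borel" and C: "\<And>y. norm (g y) \<le> C"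
    and cont: "continuous (at x within span B) g"
  shows "(\<lambda>k. \<integral> y. approx_unit (card B) (1 / real (Suc k)) (y - x) *\<^sub>R g y \<partial>lborel_span B) \<longlonglongrightarrow> g x"
proof (rule LIMSEQ_I)
  fix e :: real assume e: "e > 0"
  let ?M = "lborel_span B" and ?n = "card B"
  let ?\<psi> = "\<lambda>\<epsilon> y. approx_unit ?n \<epsilon> (y - x)"
  have C0: "C \<ge> 0" using C[of x] norm_ge_zero order_trans by blast
  obtain d where d: "d > 0" "\<And>y. y \<in> span B \<Longrightarrow> dist y x < d \<Longrightarrow> dist (g y) (g x) < e / 2"
    using cont e unfolding continuous_within_eps_delta by (metis half_gt_zero)
  define K where "K = ((1 + d\<^sup>2) / d\<^sup>2) powr (real ?n / 2 + 1)"
  have gm: "g \<in> borel_measurable ?M" using g by (simp cong: measurable_cong_sets)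
  have bound: "norm ((\<integral> y. ?\<psi> \<epsilon> y *\<^sub>R g y \<partial>?M) - g x) \<le> e / 2 + 2 * C * K * \<epsilon>\<^sup>2" if \<epsilon>: "\<epsilon> \<noteq> 0" for \<epsilon>
  proof -
    note I = approx_unit_integral[OF B x \<epsilon>] and I1 = approx_unit_integral[OF B x, of 1, simplified]
    have ig: "integrable ?M (\<lambda>y. ?\<psi> \<epsilon> y *\<^sub>R h y)" if h: "h \<in> borel_measurable ?M" "\<And>y. norm (h y) \<le> c" for h :: "'a \<Rightarrow> 'b" and c
    proof (rule Bochner_Integration.integrable_bound[OF integrable_mult_right[OF I(1), of c]])
      show "(\<lambda>y. ?\<psi> \<epsilon> y *\<^sub>R h y) \<in> borel_measurable ?M"
        using h(1) by (intro borel_measurable_scaleR) (auto cong: measurable_cong_sets)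
      show "AE y in ?M. norm (?\<psi> \<epsilon> y *\<^sub>R h y) \<le> norm (c * ?\<psi> \<epsilon> y)"
      proof (intro AE_I2)
        fix y
        have "?\<psi> \<epsilon> y * norm (h y) \<le> ?\<psi> \<epsilon> y * \<bar>c\<bar>"
          using h(2)[of y] by (intro mult_left_mono approx_unit_nonneg) auto
        then show "norm (?\<psi> \<epsilon> y *\<^sub>R h y) \<le> norm (c * ?\<psi> \<epsilon> y)"
          by (simp add: approx_unit_nonneg abs_mult mult.commute)
      qed
    qed
    have i1: "integrable ?M (\<lambda>y. ?\<psi> \<epsilon> y *\<^sub>R g y)" by (rule ig[OF gm C])
    have i2: "integrable ?M (\<lambda>y. ?\<psi> \<epsilon> y *\<^sub>R g x)" by (rule integrable_scaleR_left[OF I(1)])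
    have "(\<integral> y. ?\<psi> \<epsilon> y *\<^sub>R g y \<partial>?M) - g x = (\<integral> y. ?\<psi> \<epsilon> y *\<^sub>R g y \<partial>?M) - (\<integral> y. ?\<psi> \<epsilon> y *\<^sub>R g x \<partial>?M)"
      using I by (subst integral_scaleR_left) auto
    also have "\<dots> = (\<integral> y. ?\<psi> \<epsilon> y *\<^sub>R g y - ?\<psi> \<epsilon> y *\<^sub>R g x \<partial>?M)"
      by (rule Bochner_Integration.integral_diff[OF i1 i2, symmetric])
    also have "norm \<dots> \<le> (\<integral> y. e / 2 * ?\<psi> \<epsilon> y + 2 * C * K * \<epsilon>\<^sup>2 * ?\<psi> 1 y \<partial>?M)"
    proof (rule order_trans[OF integral_norm_bound integral_mono_AE])
      show "integrable ?M (\<lambda>y. norm (?\<psi> \<epsilon> y *\<^sub>R g y - ?\<psi> \<epsilon> y *\<^sub>R g x))" using i1 i2 by simp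
      show "integrable ?M (\<lambda>y. e / 2 * ?\<psi> \<epsilon> y + 2 * C * K * \<epsilon>\<^sup>2 * ?\<psi> 1 y)" using I I1 by simp
      show "AE y in ?M. norm (?\<psi> \<epsilon> y *\<^sub>R g y - ?\<psi> \<epsilon> y *\<^sub>R g x) \<le> e / 2 * ?\<psi> \<epsilon> y + 2 * C * K * \<epsilon>\<^sup>2 * ?\<psi> 1 y"
        using AE_lborel_span
      proof eventually_elim
        fix y assume y: "y \<in> span B"
        have n: "norm (?\<psi> \<epsilon> y *\<^sub>R g y - ?\<psi> \<epsilon> y *\<^sub>R g x) = ?\<psi> \<epsilon> y * dist (g y) (g x)"
          by (simp add: scaleR_diff_right[symmetric] approx_unit_nonneg dist_norm)
        show "norm (?\<psi> \<epsilon> y *\<^sub>R g y - ?\<psi> \<epsilon> y *\<^sub>R g x) \<le> e / 2 * ?\<psi> \<epsilon> y + 2 * C * K * \<epsilon>\<^sup>2 * ?\<psi> 1 y"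
        proof (cases "dist y x < d")
          case True
          then have "?\<psi> \<epsilon> y * dist (g y) (g x) \<le> ?\<psi> \<epsilon> y * (e / 2)"
            using d y by (intro mult_left_mono approx_unit_nonneg) (auto intro: less_imp_le)
          moreover have "0 \<le> 2 * C * K * \<epsilon>\<^sup>2 * ?\<psi> 1 y"
            using C0 by (intro mult_nonneg_nonneg approx_unit_nonneg) (auto simp: K_def)
          ultimately show ?thesis unfolding n by (simp only: mult.commute[of "e / 2"])
        next
          case False
          then have "?\<psi> \<epsilon> y \<le> K * \<epsilon>\<^sup>2 * ?\<psi> 1 y"
            unfolding K_def using d \<epsilon> by (intro approx_unit_tail) (auto simp: dist_norm)
          moreover have "dist (g y) (g x) \<le> 2 * C"
            using C[of x] C[of y] norm_triangle_ineq4[of "g y" "g x"] by (simp add: dist_norm)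
          ultimately have "?\<psi> \<epsilon> y * dist (g y) (g x) \<le> (K * \<epsilon>\<^sup>2 * ?\<psi> 1 y) * (2 * C)"
            by (intro mult_mono mult_nonneg_nonneg approx_unit_nonneg) (auto simp: K_def)
          moreover have "0 \<le> e / 2 * ?\<psi> \<epsilon> y" using e by (simp add: approx_unit_nonneg)
          ultimately show ?thesis unfolding n by (simp add: algebra_simps)
        qed
      qed
    qed
    also have "\<dots> = e / 2 + 2 * C * K * \<epsilon>\<^sup>2" using I I1 by simp
    finally show ?thesis .
  qed
  have "(\<lambda>k. 2 * C * K * (1 / real (Suc k))\<^sup>2) \<longlonglongrightarrow> 2 * C * K * 0\<^sup>2"
    by (intro tendsto_intros LIMSEQ_Suc[OF lim_1_over_n])
  then have "\<forall>\<^sub>F k in sequentially. 2 * C * K * (1 / real (Suc k))\<^sup>2 < e / 2"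
    using e by (intro order_tendstoD(2)) auto
  then obtain k0 where "\<And>k. k \<ge> k0 \<Longrightarrow> 2 * C * K * (1 / real (Suc k))\<^sup>2 < e / 2"
    by (auto simp: eventually_sequentially)
  then show "\<exists>k0. \<forall>k\<ge>k0. norm ((\<integral> y. ?\<psi> (1 / real (Suc k)) y *\<^sub>R g y \<partial>?M) - g x) < e"
    by (intro exI[of _ k0] allI impI le_less_trans[OF bound]) (auto simp: field_simps)
qed

section \<open>Hypersurfaces that are locally graphs\<close>

definition graph_chart :: "'a::euclidean_space set \<Rightarrow> 'a set \<Rightarrow> 'a \<Rightarrow> ('a \<Rightarrow> real) \<Rightarrow> 'a set \<Rightarrow> bool" where
  "graph_chart B M b \<gamma> V \<longleftrightarrow> b \<in> B \<and> Ck_on 1 (B - {b}) (span (B - {b})) \<gamma> \<and> open V \<and>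
     M \<inter> V = {x \<in> span B \<inter> V. x \<bullet> b = \<gamma> (drop_coord b x)}"

definition graph_density :: "'a::euclidean_space set \<Rightarrow> 'a \<Rightarrow> ('a \<Rightarrow> real) \<Rightarrow> 'a \<Rightarrow> real" where
  "graph_density B b \<gamma> u = sqrt (1 + (\<Sum>c\<in>B - {b}. (dir_deriv c \<gamma> u)\<^sup>2))"

text \<open>The area of the graph of \<open>\<gamma>\<close>.  The projections make the density and the graph map continuous on the
  whole ambient type; on \<open>span (B - {b})\<close>, where the Lebesgue measure is concentrated, they are the
  identity.\<close>

definition graph_measure :: "'a::euclidean_space set \<Rightarrow> 'a \<Rightarrow> ('a \<Rightarrow> real) \<Rightarrow> 'a measure" where
  "graph_measure B b \<gamma> =
     distr (density (lborel_span (B - {b})) (\<lambda>u. ennreal (graph_density B b \<gamma> (oproj (B - {b}) u)))) borel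
           (\<lambda>u. u + \<gamma> (oproj (B - {b}) u) *\<^sub>R b)"

lemma graph_density_pos: "graph_density B b \<gamma> u > 0"
  unfolding graph_density_def by (simp add: add_pos_nonneg sum_nonneg)

lemma sets_graph_measure [simp, measurable_cong]: "sets (graph_measure B b \<gamma>) = sets borel"
  by (simp add: graph_measure_def)

lemma C1_graph_function:
  fixes B :: "'a::euclidean_space set"
  assumes "orthonormal B" "Ck_on 1 B (span B) (\<gamma> :: 'a \<Rightarrow> real)"
  shows "C1_on B UNIV (\<gamma> \<circ> oproj B) (\<lambda>b. dir_deriv b \<gamma> \<circ> oproj B)"
proof -
  have "oproj B -` span B = UNIV" using proj_in_span by auto
  then show ?thesis using Ck_on_imp_C1_on_proj[OF assms(1) _ assms(2)] by simp
qed

context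
  fixes B :: "'a::euclidean_space set" and b :: 'a and \<gamma> :: "'a \<Rightarrow> real"
  assumes B: "orthonormal B" and b: "b \<in> B" and \<gamma>: "Ck_on 1 (B - {b}) (span (B - {b})) \<gamma>"
begin

lemma orthonormal_remove: "orthonormal (B - {b})"
  by (rule orthonormal_subset[OF B Diff_subset])

lemma graph_function_continuous: "continuous_on UNIV (\<lambda>u. \<gamma> (oproj (B - {b}) u))"
  using C1_on_imp_continuous_on[OF C1_graph_function[OF orthonormal_remove \<gamma>]] by (simp add: o_def)

lemma graph_density_continuous: "continuous_on UNIV (\<lambda>u. graph_density B b \<gamma> (oproj (B - {b}) u))"
proof -
  have "continuous_on UNIV (\<lambda>u. dir_deriv c \<gamma> (oproj (B - {b}) u))" if "c \<in> B - {b}" for c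
    using C1_onD(3)[OF C1_graph_function[OF orthonormal_remove \<gamma>] that] by (simp add: o_def)
  then show ?thesis unfolding graph_density_def
    by (intro continuous_intros) auto
qed

lemma graph_function_measurable [measurable]: "(\<lambda>u. \<gamma> (oproj (B - {b}) u)) \<in> borel_measurable borel"
  by (rule borel_measurable_continuous_onI[OF graph_function_continuous])

lemma graph_density_measurable [measurable]: "(\<lambda>u. graph_density B b \<gamma> (oproj (B - {b}) u)) \<in> borel_measurable borel"
  by (rule borel_measurable_continuous_onI[OF graph_density_continuous])

lemma nn_integral_graph_measure_proj:
  assumes [measurable]: "F \<in> borel_measurable borel"
  shows "(\<integral>\<^sup>+ y. F y \<partial>graph_measure B b \<gamma>) =
     (\<integral>\<^sup>+ u. ennreal (graph_density B b \<gamma> (oproj (B - {b}) u)) * F (u + \<gamma> (oproj (B - {b}) u) *\<^sub>R b) \<partial>lborel_span (B - {b}))"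
  unfolding graph_measure_def by (subst nn_integral_distr, measurable, subst nn_integral_density, measurable)

lemma nn_integral_graph_measure:
  assumes [measurable]: "F \<in> borel_measurable borel"
  shows "(\<integral>\<^sup>+ y. F y \<partial>graph_measure B b \<gamma>) = (\<integral>\<^sup>+ u. ennreal (graph_density B b \<gamma> u) * F (u + \<gamma> u *\<^sub>R b) \<partial>lborel_span (B - {b}))"
proof -
  have "(\<integral>\<^sup>+ y. F y \<partial>graph_measure B b \<gamma>) =
     (\<integral>\<^sup>+ u. ennreal (graph_density B b \<gamma> (oproj (B - {b}) u)) * F (u + \<gamma> (oproj (B - {b}) u) *\<^sub>R b) \<partial>lborel_span (B - {b}))"
    by (rule nn_integral_graph_measure_proj[OF assms])
  also have "\<dots> = (\<integral>\<^sup>+ u. ennreal (graph_density B b \<gamma> u) * F (u + \<gamma> u *\<^sub>R b) \<partial>lborel_span (B - {b}))"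
    by (rule nn_integral_cong_AE, use AE_lborel_span[of "B - {b}"] in eventually_elim) (simp add: proj_ident[OF orthonormal_remove])
  finally show ?thesis .
qed

lemma emeasure_graph_measure:
  assumes [measurable]: "A \<in> sets borel"
  shows "emeasure (graph_measure B b \<gamma>) A =
    (\<integral>\<^sup>+ u. indicator A (u + \<gamma> u *\<^sub>R b) * ennreal (graph_density B b \<gamma> u) \<partial>lborel_span (B - {b}))"
proof -
  have "emeasure (graph_measure B b \<gamma>) A = (\<integral>\<^sup>+ y. indicator A y \<partial>graph_measure B b \<gamma>)" by simp
  also have "\<dots> = (\<integral>\<^sup>+ u. ennreal (graph_density B b \<gamma> u) * indicator A (u + \<gamma> u *\<^sub>R b) \<partial>lborel_span (B - {b}))"
    by (rule nn_integral_graph_measure) measurable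
  finally show ?thesis by (simp add: mult.commute)
qed

lemma integral_graph_measure:
  fixes F :: "'a \<Rightarrow> 'b::{banach, second_countable_topology}"
  assumes [measurable]: "F \<in> borel_measurable borel"
  shows "(\<integral> y. F y \<partial>graph_measure B b \<gamma>) =
     (\<integral> u. graph_density B b \<gamma> (oproj (B - {b}) u) *\<^sub>R F (u + \<gamma> (oproj (B - {b}) u) *\<^sub>R b) \<partial>lborel_span (B - {b}))"
  unfolding graph_measure_def
  by (subst integral_distr, measurable, subst integral_density, measurable)
     (auto simp: graph_density_pos less_imp_le)

end

text \<open>Differentiating the equation of the hypersurface along a curve in it.\<close>

lemma graph_chart_tangent:
  fixes \<kappa> :: "real \<Rightarrow> 'a::euclidean_space"
  assumes B: "orthonormal B" and ch: "graph_chart B M b \<gamma> V"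
    and \<kappa>: "\<forall>\<^sub>F t in at 0. \<kappa> t \<in> M" "\<kappa> 0 \<in> M \<inter> V" and v: "(\<kappa> has_vector_derivative v) (at 0)"
  shows "v \<bullet> b = (\<Sum>c\<in>B - {b}. (v \<bullet> c) * dir_deriv c \<gamma> (drop_coord b (\<kappa> 0)))" and "v \<in> span B"
proof -
  have b: "b \<in> B" and \<gamma>: "Ck_on 1 (B - {b}) (span (B - {b})) \<gamma>" and V: "open V"
    and M: "M \<inter> V = {x \<in> span B \<inter> V. x \<bullet> b = \<gamma> (drop_coord b x)}"
    using ch by (auto simp: graph_chart_def)
  let ?P = "oproj (B - {b})"
  have o: "orthonormal (B - {b})" by (rule orthonormal_subset[OF B Diff_subset])
  have P: "?P x = drop_coord b x" if "x \<in> span B" for x using drop_coord_eq_proj[OF B b that] by simp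
  have "continuous (at 0) \<kappa>" using v by (rule has_vector_derivative_continuous)
  then have "(\<kappa> \<longlongrightarrow> \<kappa> 0) (at 0)" by (simp add: continuous_within)
  then have "\<forall>\<^sub>F t in at 0. \<kappa> t \<in> V" using topological_tendstoD[OF _ V, of \<kappa> "\<kappa> 0"] \<kappa>(2) by auto
  with \<kappa>(1) have ev: "\<forall>\<^sub>F t in at 0. \<kappa> t \<in> M \<inter> V" by eventually_elim simp
  then have evB: "\<forall>\<^sub>F t in at 0. \<kappa> t \<in> span B" by eventually_elim (simp add: M)
  have k0: "\<kappa> 0 \<in> span B" using \<kappa>(2) by (simp add: M)
  have der: "(\<kappa> has_derivative (\<lambda>h. h *\<^sub>R v)) (at 0)" using v by (simp add: has_vector_derivative_def)
  have "((\<lambda>t. oproj B (\<kappa> t)) has_derivative (\<lambda>h. oproj B (h *\<^sub>R v))) (at 0)"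
    by (rule bounded_linear.has_derivative[OF bounded_linear_proj der])
  moreover have "\<forall>\<^sub>F t in at 0. oproj B (\<kappa> t) = \<kappa> t" using evB by eventually_elim (rule proj_ident[OF B])
  ultimately have "(\<kappa> has_derivative (\<lambda>h. oproj B (h *\<^sub>R v))) (at 0)"
    using has_derivative_transform_eventually[of "\<lambda>t. oproj B (\<kappa> t)" _ 0 UNIV \<kappa>] proj_ident[OF B k0] by simp
  from fun_cong[OF has_derivative_unique[OF this der], of 1] have "oproj B v = v" by simp
  then show vB: "v \<in> span B" using proj_in_span[of B v] by simp
  let ?L = "\<lambda>h. \<Sum>c\<in>B - {b}. (h \<bullet> c) *\<^sub>R dir_deriv c \<gamma> (?P (\<kappa> 0))"
  have "(\<gamma> \<circ> ?P has_derivative ?L) (at (\<kappa> 0))"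
    using C1_onD(2)[OF C1_graph_function[OF o \<gamma>], of "\<kappa> 0"] by (simp add: o_def)
  then have 1: "((\<lambda>t. (\<gamma> \<circ> ?P) (\<kappa> t)) has_derivative (\<lambda>h. ?L (h *\<^sub>R v))) (at 0)"
    by (rule has_derivative_compose[OF der])
  have 2: "((\<lambda>t. \<kappa> t \<bullet> b) has_derivative (\<lambda>h. (h *\<^sub>R v) \<bullet> b)) (at 0)"
    by (rule has_derivative_inner_left[OF der])
  have "\<forall>\<^sub>F t in at 0. \<kappa> t \<bullet> b = (\<gamma> \<circ> ?P) (\<kappa> t)"
    using ev by eventually_elim (simp add: M P)
  moreover have "\<kappa> 0 \<bullet> b = (\<gamma> \<circ> ?P) (\<kappa> 0)" using \<kappa>(2) by (simp add: M P)
  ultimately have "((\<lambda>t. (\<gamma> \<circ> ?P) (\<kappa> t)) has_derivative (\<lambda>h. (h *\<^sub>R v) \<bullet> b)) (at 0)"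
    by (intro has_derivative_transform_eventually[OF 2]) auto
  from fun_cong[OF has_derivative_unique[OF this 1], of 1] have "v \<bullet> b = ?L v" by simp
  then show "v \<bullet> b = (\<Sum>c\<in>B - {b}. (v \<bullet> c) * dir_deriv c \<gamma> (drop_coord b (\<kappa> 0)))"
    using P[OF k0] by simp
qed

lemma graph_chart_point:
  assumes B: "orthonormal B" and ch: "graph_chart B M b \<gamma> V" and u: "u \<in> span (B - {b})" and V: "u + \<gamma> u *\<^sub>R b \<in> V"
  shows "u + \<gamma> u *\<^sub>R b \<in> M"
proof -
  have b: "b \<in> B" and M: "M \<inter> V = {x \<in> span B \<inter> V. x \<bullet> b = \<gamma> (drop_coord b x)}"
    using ch by (auto simp: graph_chart_def)
  have "u + \<gamma> u *\<^sub>R b \<in> {x \<in> span B \<inter> V. x \<bullet> b = \<gamma> (drop_coord b x)}"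
    using drop_coord_add_span[OF B b u, of "\<gamma> u"] V by simp
  then show ?thesis unfolding M[symmetric] by simp
qed

lemma graph_chart_unique_point:
  assumes B: "orthonormal B" and ch: "graph_chart B M b \<gamma> V" and u: "u \<in> span (B - {b})" and V: "u + t *\<^sub>R b \<in> M \<inter> V"
  shows "t = \<gamma> u"
proof -
  have b: "b \<in> B" and M: "M \<inter> V = {x \<in> span B \<inter> V. x \<bullet> b = \<gamma> (drop_coord b x)}"
    using ch by (auto simp: graph_chart_def)
  have "u + t *\<^sub>R b \<in> {x \<in> span B \<inter> V. x \<bullet> b = \<gamma> (drop_coord b x)}"
    using V unfolding M by simp
  then show ?thesis using drop_coord_add_span[OF B b u, of t] by simp
qed

text \<open>The curves over the coordinate lines of the parameter space supply enough tangent vectors to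
  determine the gradient of any other graph function at the same point.\<close>

lemma graph_coordinate_curve:
  fixes B :: "'a::euclidean_space set"
  assumes B: "orthonormal B" and ch: "graph_chart B M b \<gamma> V"
    and u: "u \<in> span (B - {b})" and V: "u + \<gamma> u *\<^sub>R b \<in> V" and c: "c \<in> B - {b}"
  defines "\<kappa> \<equiv> \<lambda>t::real. (u + t *\<^sub>R c) + \<gamma> (u + t *\<^sub>R c) *\<^sub>R b"
  shows "(\<kappa> has_vector_derivative c + dir_deriv c \<gamma> u *\<^sub>R b) (at 0)" and "\<forall>\<^sub>F t in at 0. \<kappa> t \<in> M \<inter> V"
proof -
  have b: "b \<in> B" and \<gamma>: "Ck_on 1 (B - {b}) (span (B - {b})) \<gamma>" and oV: "open V"
    using ch by (auto simp: graph_chart_def)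
  have o: "orthonormal (B - {b})" by (rule orthonormal_subset[OF B Diff_subset])
  have us: "u + t *\<^sub>R c \<in> span (B - {b})" for t
    using u c by (intro span_add span_scale) (auto intro: span_base)
  have "((\<lambda>t. (\<gamma> \<circ> oproj (B - {b})) (u + t *\<^sub>R c)) has_vector_derivative (dir_deriv c \<gamma> \<circ> oproj (B - {b})) (u + 0 *\<^sub>R c)) (at 0)"
    by (rule C1_on_partial[OF o C1_graph_function[OF o \<gamma>] _ c]) simp
  then have d: "((\<lambda>t. \<gamma> (u + t *\<^sub>R c)) has_vector_derivative dir_deriv c \<gamma> u) (at 0)"
    by (simp add: proj_ident[OF o us] proj_ident[OF o u])
  show k: "(\<kappa> has_vector_derivative c + dir_deriv c \<gamma> u *\<^sub>R b) (at 0)"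
    unfolding \<kappa>_def using d by (auto intro!: derivative_eq_intros simp: has_real_derivative_iff_has_vector_derivative)
  have "continuous (at 0) \<kappa>" using k by (rule has_vector_derivative_continuous)
  then have "(\<kappa> \<longlongrightarrow> \<kappa> 0) (at 0)" by (simp add: continuous_within)
  then have "\<forall>\<^sub>F t in at 0. \<kappa> t \<in> V" using topological_tendstoD[OF _ oV, of \<kappa> "\<kappa> 0"] V by (auto simp: \<kappa>_def)
  then show "\<forall>\<^sub>F t in at 0. \<kappa> t \<in> M \<inter> V"
    by eventually_elim (use graph_chart_point[OF B ch us] in \<open>auto simp: \<kappa>_def\<close>)
qed

lemma graph_charts_same_direction:
  fixes B :: "'a::euclidean_space set"
  assumes B: "orthonormal B" and ch: "graph_chart B M b \<gamma> V" and ch': "graph_chart B M b \<gamma>' V'"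
    and u: "u \<in> span (B - {b})" and V: "u + \<gamma> u *\<^sub>R b \<in> V \<inter> V'"
  shows "\<gamma>' u = \<gamma> u" "graph_density B b \<gamma>' u = graph_density B b \<gamma> u"
proof -
  have b: "b \<in> B" using ch by (auto simp: graph_chart_def)
  show eq: "\<gamma>' u = \<gamma> u"
    using graph_chart_unique_point[OF B ch' u] graph_chart_point[OF B ch u] V by auto
  have dd: "dir_deriv c \<gamma>' u = dir_deriv c \<gamma> u" if c: "c \<in> B - {b}" for c
  proof -
    let ?\<kappa> = "\<lambda>t::real. (u + t *\<^sub>R c) + \<gamma> (u + t *\<^sub>R c) *\<^sub>R b"
    let ?v = "c + dir_deriv c \<gamma> u *\<^sub>R b"
    note k = graph_coordinate_curve[OF B ch u _ c]
    have ev: "\<forall>\<^sub>F t in at 0. ?\<kappa> t \<in> M" using k(2) V by (auto elim: eventually_mono)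
    have k0: "?\<kappa> 0 \<in> M \<inter> V'" using V graph_chart_point[OF B ch u] by auto
    have "?v \<bullet> b = (\<Sum>d\<in>B - {b}. (?v \<bullet> d) * dir_deriv d \<gamma>' (drop_coord b (?\<kappa> 0)))"
      by (rule graph_chart_tangent(1)[OF B ch' ev k0 k(1)]) (use V in auto)
    moreover have "drop_coord b (?\<kappa> 0) = u" using drop_coord_add_span[OF B b u] by simp
    moreover have "?v \<bullet> b = dir_deriv c \<gamma> u" using c B b by (simp add: inner_add_left orthonormal_inner)
    moreover have "(\<Sum>d\<in>B - {b}. (?v \<bullet> d) * dir_deriv d \<gamma>' u) = (\<Sum>d\<in>B - {b}. if d = c then dir_deriv d \<gamma>' u else 0)"
      by (rule sum.cong) (use c B b in \<open>auto simp: inner_add_left orthonormal_inner\<close>)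
    ultimately show ?thesis using c orthonormal_finite[OF B] by simp
  qed
  show "graph_density B b \<gamma>' u = graph_density B b \<gamma> u"
    unfolding graph_density_def by (simp add: dd)
qed

text \<open>Between charts over different coordinates \<open>b\<close> and \<open>b'\<close>, tangency of the coordinate curves of the
  first chart expresses the gradient of the second graph function by that of the first.\<close>

lemma graph_charts_change_direction:
  fixes B :: "'a::euclidean_space set"
  assumes B: "orthonormal B" and ch: "graph_chart B M b \<gamma> V" and ch': "graph_chart B M b' \<gamma>' V'" and ne: "b \<noteq> b'"
    and w: "w \<in> span (B - {b, b'})" and V: "w + s *\<^sub>R b' + t *\<^sub>R b \<in> V \<inter> V'" and t: "t = \<gamma> (w + s *\<^sub>R b')"
  shows "\<gamma>' (w + t *\<^sub>R b) = s"
    and "graph_density B b' \<gamma>' (w + t *\<^sub>R b) * \<bar>dir_deriv b' \<gamma> (w + s *\<^sub>R b')\<bar> = graph_density B b \<gamma> (w + s *\<^sub>R b')"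
proof -
  have b: "b \<in> B" and b': "b' \<in> B" using ch ch' by (auto simp: graph_chart_def)
  define u where "u = w + s *\<^sub>R b'"
  define u' where "u' = w + t *\<^sub>R b"
  have w1: "w \<in> span (B - {b})" "w \<in> span (B - {b'})"
    using w span_mono[of "B - {b, b'}" "B - {b}"] span_mono[of "B - {b, b'}" "B - {b'}"] by auto
  have u: "u \<in> span (B - {b})" unfolding u_def using w1 b' ne by (intro span_add span_scale) (auto intro: span_base)
  have u': "u' \<in> span (B - {b'})" unfolding u'_def using w1 b ne by (intro span_add span_scale) (auto intro: span_base)
  have x: "w + s *\<^sub>R b' + t *\<^sub>R b = u + \<gamma> u *\<^sub>R b" "w + s *\<^sub>R b' + t *\<^sub>R b = u' + s *\<^sub>R b'"
    by (simp_all add: u_def u'_def t algebra_simps)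
  have VV: "u + \<gamma> u *\<^sub>R b \<in> V" "u + \<gamma> u *\<^sub>R b \<in> V'" using V x by auto
  have xM: "u + \<gamma> u *\<^sub>R b \<in> M" by (rule graph_chart_point[OF B ch u VV(1)])
  then have "s = \<gamma>' u'" using graph_chart_unique_point[OF B ch' u'] VV(2) x by auto
  then show "\<gamma>' (w + t *\<^sub>R b) = s" by (simp add: u'_def)
  let ?g = "\<lambda>c. dir_deriv c \<gamma> u" and ?g' = "\<lambda>c. dir_deriv c \<gamma>' u'"
  have tang: "(c + ?g c *\<^sub>R b) \<bullet> b' = (\<Sum>d\<in>B - {b'}. ((c + ?g c *\<^sub>R b) \<bullet> d) * ?g' d)" if c: "c \<in> B - {b}" for c
  proof -
    let ?\<kappa> = "\<lambda>t::real. (u + t *\<^sub>R c) + \<gamma> (u + t *\<^sub>R c) *\<^sub>R b"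
    note k = graph_coordinate_curve[OF B ch u VV(1) c]
    have ev: "\<forall>\<^sub>F t in at 0. ?\<kappa> t \<in> M" using k(2) by (auto elim: eventually_mono)
    have k0: "?\<kappa> 0 \<in> M \<inter> V'" using VV xM by auto
    have "drop_coord b' (?\<kappa> 0) = u'" using drop_coord_add_span(1)[OF B b' u', of s] x by simp
    then show ?thesis using graph_chart_tangent(1)[OF B ch' ev k0 k(1)] by simp
  qed
  let ?C = "B - {b, b'}"
  have fin: "finite ?C" using orthonormal_finite[OF B] by simp
  have split: "(\<Sum>d\<in>B - {b'}. F d) = F b + (\<Sum>d\<in>?C. F d)" "(\<Sum>d\<in>B - {b}. F d) = F b' + (\<Sum>d\<in>?C. F d)" for F :: "'a \<Rightarrow> real"
  proof -
    have e: "B - {b'} = insert b ?C" "B - {b} = insert b' ?C" using b b' ne by auto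
    have n: "b \<notin> ?C" "b' \<notin> ?C" by auto
    show "(\<Sum>d\<in>B - {b'}. F d) = F b + (\<Sum>d\<in>?C. F d)" by (simp only: e(1) sum.insert[OF fin n(1)])
    show "(\<Sum>d\<in>B - {b}. F d) = F b' + (\<Sum>d\<in>?C. F d)" by (simp only: e(2) sum.insert[OF fin n(2)])
  qed
  have 1: "1 = ?g b' * ?g' b"
  proof -
    have "(b' + ?g b' *\<^sub>R b) \<bullet> b' = (\<Sum>d\<in>B - {b'}. ((b' + ?g b' *\<^sub>R b) \<bullet> d) * ?g' d)"
      using tang[of b'] b' ne by auto
    moreover have "(\<Sum>d\<in>?C. ((b' + ?g b' *\<^sub>R b) \<bullet> d) * ?g' d) = 0"
      by (rule sum.neutral) (use B b b' in \<open>auto simp: inner_add_left orthonormal_inner\<close>)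
    ultimately show ?thesis using B b b' ne by (simp add: split inner_add_left orthonormal_inner)
  qed
  have 2: "0 = ?g' c + ?g c * ?g' b" if c: "c \<in> ?C" for c
  proof -
    have "(c + ?g c *\<^sub>R b) \<bullet> b' = (\<Sum>d\<in>B - {b'}. ((c + ?g c *\<^sub>R b) \<bullet> d) * ?g' d)"
      using tang[of c] c by auto
    moreover have "(\<Sum>d\<in>?C. ((c + ?g c *\<^sub>R b) \<bullet> d) * ?g' d) = (\<Sum>d\<in>?C. if d = c then ?g' d else 0)"
      by (rule sum.cong) (use c B b b' in \<open>auto simp: inner_add_left orthonormal_inner\<close>)
    ultimately show ?thesis using B b b' ne c fin by (auto simp: split inner_add_left orthonormal_inner)
  qed
  have g0: "?g b' \<noteq> 0" using 1 by auto
  have gb: "?g' b = 1 / ?g b'" using 1 g0 by (simp add: field_simps)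
  have gc: "?g' c = - ?g c / ?g b'" if "c \<in> ?C" for c using 2[OF that] gb by simp
  have "(1 + (\<Sum>c\<in>B - {b'}. (?g' c)\<^sup>2)) * (?g b')\<^sup>2 = 1 + (\<Sum>c\<in>B - {b}. (?g c)\<^sup>2)"
  proof -
    have "(\<Sum>c\<in>?C. (?g' c)\<^sup>2) = (\<Sum>c\<in>?C. (?g c)\<^sup>2 / (?g b')\<^sup>2)"
      by (rule sum.cong) (auto simp: gc power_divide)
    then have "(\<Sum>c\<in>?C. (?g' c)\<^sup>2) * (?g b')\<^sup>2 = (\<Sum>c\<in>?C. (?g c)\<^sup>2)"
      using g0 by (simp add: sum_divide_distrib[symmetric])
    moreover have "(?g' b)\<^sup>2 * (?g b')\<^sup>2 = 1" using g0 by (simp add: gb power_divide)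
    ultimately show ?thesis unfolding split by (simp add: algebra_simps)
  qed
  then have "sqrt ((1 + (\<Sum>c\<in>B - {b'}. (?g' c)\<^sup>2)) * (?g b')\<^sup>2) = sqrt (1 + (\<Sum>c\<in>B - {b}. (?g c)\<^sup>2))"
    by simp
  then show "graph_density B b' \<gamma>' (w + t *\<^sub>R b) * \<bar>dir_deriv b' \<gamma> (w + s *\<^sub>R b')\<bar> = graph_density B b \<gamma> (w + s *\<^sub>R b')"
    unfolding graph_density_def u_def[symmetric] u'_def[symmetric] by (simp add: real_sqrt_mult)
qed

text \<open>Injective substitution on the line for nonnegative functions, both sides possibly infinite.\<close>

lemma nn_integral_inj_image:
  fixes g g' F :: "real \<Rightarrow> real"
  assumes S: "S \<in> sets borel" and T: "g ` S \<in> sets borel"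
    and der: "\<And>s. s \<in> S \<Longrightarrow> (g has_field_derivative g' s) (at s)" and inj: "inj_on g S"
    and F: "F \<in> borel_measurable borel" "\<And>t. F t \<ge> 0"
    and G: "(\<lambda>s. \<bar>g' s\<bar> * F (g s)) \<in> borel_measurable borel"
  shows "(\<integral>\<^sup>+ t. ennreal (indicator (g ` S) t * F t) \<partial>lborel) = (\<integral>\<^sup>+ s. ennreal (indicator S s * (\<bar>g' s\<bar> * F (g s))) \<partial>lborel)"
proof -
  let ?G = "\<lambda>s. \<bar>g' s\<bar> * F (g s)"
  have nn: "(\<integral>\<^sup>+ t. ennreal (indicator A t * H t) \<partial>lborel) = (if H absolutely_integrable_on A then ennreal (integral A H) else \<infinity>)"
    if A: "A \<in> sets borel" and H: "H \<in> borel_measurable borel" "\<And>t. H t \<ge> 0" for A and H :: "real \<Rightarrow> real"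
  proof -
    let ?k = "\<lambda>t. indicator A t * H t"
    have k: "?k \<in> borel_measurable borel" using A H by measurable
    have ai: "H absolutely_integrable_on A \<longleftrightarrow> integrable lborel ?k"
      unfolding set_integrable_def using k by (simp add: integrable_completion)
    show ?thesis
    proof (cases "integrable lborel ?k")
      case True
      then have "(\<integral>\<^sup>+ t. ennreal (?k t) \<partial>lborel) = ennreal (integral\<^sup>L lborel ?k)"
        using H by (intro nn_integral_eq_integral) auto
      moreover have "integral\<^sup>L lborel ?k = integral A H"
        using set_lebesgue_integral_eq_integral(2)[of A H] ai True k
        unfolding set_lebesgue_integral_def by (simp add: integral_completion)
      ultimately show ?thesis using ai True by simp
    next
      case False
      have "\<not> (\<integral>\<^sup>+ t. ennreal (?k t) \<partial>lborel) < \<infinity>"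
      proof
        assume fin: "(\<integral>\<^sup>+ t. ennreal (?k t) \<partial>lborel) < \<infinity>"
        have "AE t in lborel. 0 \<le> ?k t" using H(2) by (intro AE_I2 mult_nonneg_nonneg) auto
        moreover have "?k \<in> borel_measurable lborel" using k by simp
        ultimately have "integrable lborel ?k" using fin by (intro integrableI_nonneg)
        then show False using False by simp
      qed
      then show ?thesis using ai False by (simp add: not_less top_unique)
    qed
  qed
  have SL: "S \<in> sets lebesgue" using S by auto
  note cv = has_absolute_integral_change_of_variables_1'[OF SL has_field_derivative_at_within[OF der] inj, of F]
  show ?thesis
    unfolding nn[OF T F] nn[OF S G mult_nonneg_nonneg[OF abs_ge_zero F(2)]]
    using cv[of "integral (g ` S) F"] cv[of "integral S (\<lambda>s. \<bar>g' s\<bar> * F (g s))"] by auto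
qed

text \<open>For charts over different coordinates \<open>b\<close> and \<open>b'\<close>, all coordinates other than \<open>b\<close> and \<open>b'\<close>
  are frozen by Fubini; what remains is the substitution \<open>t = \<gamma> (w + s b')\<close> in one variable.\<close>

lemma graph_measure_chart_independent:
  fixes B :: "'a::euclidean_space set"
  assumes B: "orthonormal B" and ch: "graph_chart B M b \<gamma> V" and ch': "graph_chart B M b' \<gamma>' V'"
    and A[measurable]: "A \<in> sets borel" and AV: "A \<subseteq> M \<inter> V \<inter> V'"
  shows "emeasure (graph_measure B b \<gamma>) A = emeasure (graph_measure B b' \<gamma>') A"
proof (cases "b = b'")
  case True
  have b: "b \<in> B" and \<gamma>: "Ck_on 1 (B - {b}) (span (B - {b})) \<gamma>" and \<gamma>': "Ck_on 1 (B - {b}) (span (B - {b})) \<gamma>'"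
    using ch ch' True by (auto simp: graph_chart_def)
  note ch'' = ch'[folded True]
  show ?thesis
    unfolding True[symmetric] emeasure_graph_measure[OF B b \<gamma> A] emeasure_graph_measure[OF B b \<gamma>' A]
  proof (rule nn_integral_cong_AE, use AE_lborel_span[of "B - {b}"] in eventually_elim)
    fix u assume u: "u \<in> span (B - {b})"
    show "indicator A (u + \<gamma> u *\<^sub>R b) * ennreal (graph_density B b \<gamma> u) = indicator A (u + \<gamma>' u *\<^sub>R b) * ennreal (graph_density B b \<gamma>' u)"
    proof (cases "u + \<gamma> u *\<^sub>R b \<in> A")
      case True
      then have "u + \<gamma> u *\<^sub>R b \<in> V \<inter> V'" using AV by auto
      from graph_charts_same_direction[OF B ch ch'' u this] show ?thesis using True by simp
    next
      case n: False
      show ?thesis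
      proof (cases "u + \<gamma>' u *\<^sub>R b \<in> A")
        case True
        then have "u + \<gamma>' u *\<^sub>R b \<in> V' \<inter> V" using AV by auto
        from graph_charts_same_direction[OF B ch'' ch u this] show ?thesis using True by simp
      qed (use n in simp)
    qed
  qed
next
  case ne: False
  have b: "b \<in> B" and \<gamma>: "Ck_on 1 (B - {b}) (span (B - {b})) \<gamma>"
    and b': "b' \<in> B" and \<gamma>': "Ck_on 1 (B - {b'}) (span (B - {b'})) \<gamma>'"
    using ch ch' by (auto simp: graph_chart_def)
  let ?P = "oproj (B - {b})" and ?P' = "oproj (B - {b'})" and ?C = "B - {b, b'}"
  have o: "orthonormal (B - {b})" "orthonormal (B - {b'})" by (rule orthonormal_subset[OF B Diff_subset])+
  have C: "B - {b} - {b'} = ?C" "B - {b'} - {b} = ?C" by auto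
  have m: "b' \<in> B - {b}" "b \<in> B - {b'}" using b b' ne by auto
  note [measurable] = graph_function_measurable[OF B b \<gamma>] graph_density_measurable[OF B b \<gamma>]
    graph_function_measurable[OF B b' \<gamma>'] graph_density_measurable[OF B b' \<gamma>']
  let ?G = "\<lambda>u. ennreal (graph_density B b \<gamma> (?P u)) * indicator A (u + \<gamma> (?P u) *\<^sub>R b)"
  let ?G' = "\<lambda>u. ennreal (graph_density B b' \<gamma>' (?P' u)) * indicator A (u + \<gamma>' (?P' u) *\<^sub>R b')"
  have Gm[measurable]: "?G \<in> borel_measurable borel" "?G' \<in> borel_measurable borel" by measurable
  have 1: "emeasure (graph_measure B b \<gamma>) A = (\<integral>\<^sup>+ w. (\<integral>\<^sup>+ s. ?G (w + s *\<^sub>R b') \<partial>lborel) \<partial>lborel_span ?C)"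
    using nn_integral_graph_measure_proj[OF B b \<gamma>, of "indicator A"] nn_integral_lborel_span_split[OF o(1) m(1) Gm(1)]
    unfolding C by simp
  have 2: "emeasure (graph_measure B b' \<gamma>') A = (\<integral>\<^sup>+ w. (\<integral>\<^sup>+ t. ?G' (w + t *\<^sub>R b) \<partial>lborel) \<partial>lborel_span ?C)"
    using nn_integral_graph_measure_proj[OF B b' \<gamma>', of "indicator A"] nn_integral_lborel_span_split[OF o(2) m(2) Gm(2)]
    unfolding C by simp
  show ?thesis unfolding 1 2
  proof (rule nn_integral_cong_AE, use AE_lborel_span[of ?C] in eventually_elim)
    fix w assume w: "w \<in> span ?C"
    then have w1: "w \<in> span (B - {b})" "w \<in> span (B - {b'})"
      using span_mono[of ?C "B - {b}"] span_mono[of ?C "B - {b'}"] by auto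
    have Pw: "?P (w + s *\<^sub>R b') = w + s *\<^sub>R b'" for s
      by (rule proj_ident[OF o(1)]) (use w1 m in \<open>auto intro!: span_add span_scale intro: span_base\<close>)
    have Pw': "?P' (w + t *\<^sub>R b) = w + t *\<^sub>R b" for t
      by (rule proj_ident[OF o(2)]) (use w1 m in \<open>auto intro!: span_add span_scale intro: span_base\<close>)
    have u: "w + s *\<^sub>R b' \<in> span (B - {b})" for s using Pw[of s] proj_in_span by metis
    have u': "w + t *\<^sub>R b \<in> span (B - {b'})" for t using Pw'[of t] proj_in_span by metis
    define g where "g s = \<gamma> (?P (w + s *\<^sub>R b'))" for s
    define g' where "g' s = dir_deriv b' \<gamma> (?P (w + s *\<^sub>R b'))" for s
    define h where "h t = \<gamma>' (?P' (w + t *\<^sub>R b))" for t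
    define F where "F t = graph_density B b' \<gamma>' (?P' (w + t *\<^sub>R b))" for t
    define S where "S = {s. w + s *\<^sub>R b' + g s *\<^sub>R b \<in> A}"
    define T where "T = {t. w + t *\<^sub>R b + h t *\<^sub>R b' \<in> A}"
    have [measurable]: "g \<in> borel_measurable borel" "h \<in> borel_measurable borel" "F \<in> borel_measurable borel"
      unfolding g_def h_def F_def by measurable
    have [measurable]: "g' \<in> borel_measurable borel"
    proof -
      have c: "continuous_on UNIV (\<lambda>u. dir_deriv b' \<gamma> (?P u))"
        using C1_onD(3)[OF C1_graph_function[OF o(1) \<gamma>] m(1)] by (simp add: o_def)
      show ?thesis unfolding g'_def
        by (intro borel_measurable_continuous_onI continuous_on_compose2[OF c] continuous_intros) auto
    qed
    have SB: "S \<in> sets borel" and TB: "T \<in> sets borel" unfolding S_def T_def by measurable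
    have der: "(g has_field_derivative g' s) (at s)" for s
      using C1_on_partial[OF o(1) C1_graph_function[OF o(1) \<gamma>] _ m(1), of w s]
      by (simp add: g_def[abs_def] g'_def has_real_derivative_iff_has_vector_derivative)
    have gS: "g s \<in> T \<and> h (g s) = s \<and> F (g s) * \<bar>g' s\<bar> = graph_density B b \<gamma> (?P (w + s *\<^sub>R b'))" if s: "s \<in> S" for s
    proof -
      have x: "w + s *\<^sub>R b' + g s *\<^sub>R b \<in> A" using s by (simp add: S_def)
      then have xV: "w + s *\<^sub>R b' + g s *\<^sub>R b \<in> V \<inter> V'" using AV by auto
      have gs: "g s = \<gamma> (w + s *\<^sub>R b')" by (simp add: g_def Pw)
      note cd = graph_charts_change_direction[OF B ch ch' ne w xV gs]
      have hs: "h (g s) = s" using cd(1) by (simp add: h_def Pw')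
      then have "g s \<in> T" using x by (simp add: T_def algebra_simps)
      then show ?thesis using cd(2) hs by (simp add: F_def g'_def Pw Pw')
    qed
    have hT: "h t \<in> S \<and> g (h t) = t" if t: "t \<in> T" for t
    proof -
      have x: "w + t *\<^sub>R b + h t *\<^sub>R b' \<in> A" using t by (simp add: T_def)
      then have xM: "(w + h t *\<^sub>R b') + t *\<^sub>R b \<in> M \<inter> V" using AV by (auto simp: algebra_simps)
      then have "g (h t) = t" using graph_chart_unique_point[OF B ch u xM] by (simp add: g_def Pw)
      then show ?thesis using x by (simp add: S_def algebra_simps)
    qed
    have img: "g ` S = T" using gS hT by (metis image_eqI subsetI image_subset_iff subset_antisym)
    have inj: "inj_on g S" using gS by (metis inj_on_inverseI)
    have "(\<integral>\<^sup>+ s. ?G (w + s *\<^sub>R b') \<partial>lborel) = (\<integral>\<^sup>+ s. ennreal (indicator S s * (\<bar>g' s\<bar> * F (g s))) \<partial>lborel)"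
    proof (rule nn_integral_cong)
      fix s :: real
      show "?G (w + s *\<^sub>R b') = ennreal (indicator S s * (\<bar>g' s\<bar> * F (g s)))"
      proof (cases "s \<in> S")
        case True
        then show ?thesis using gS[OF True] by (simp add: S_def g_def mult.commute)
      next
        case False
        then show ?thesis by (simp add: S_def g_def)
      qed
    qed
    also have "\<dots> = (\<integral>\<^sup>+ t. ennreal (indicator (g ` S) t * F t) \<partial>lborel)"
      by (rule nn_integral_inj_image[symmetric, OF SB _ der inj])
         (use TB img in \<open>auto simp: F_def graph_density_pos less_imp_le intro: borel_measurable_times\<close>)
    also have "\<dots> = (\<integral>\<^sup>+ t. ?G' (w + t *\<^sub>R b) \<partial>lborel)"
      unfolding img by (rule nn_integral_cong) (auto simp: T_def h_def F_def indicator_def)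
    finally show "(\<integral>\<^sup>+ s. ?G (w + s *\<^sub>R b') \<partial>lborel) = (\<integral>\<^sup>+ t. ?G' (w + t *\<^sub>R b) \<partial>lborel)" .
  qed
qed

lemma finite_sum_of_measures:
  fixes N :: "nat \<Rightarrow> 'a::topological_space measure"
  assumes "\<And>i. i < m \<Longrightarrow> sets (N i) = sets borel"
  obtains S where "sets S = sets borel" "\<And>A. A \<in> sets borel \<Longrightarrow> emeasure S A = (\<Sum>i<m. emeasure (N i) A)"
proof -
  let ?\<mu> = "\<lambda>A. \<Sum>i<m. emeasure (N i) A"
  define S where "S = measure_of UNIV (sets borel) ?\<mu>"
  have sa: "sigma_algebra UNIV (sets (borel :: 'a measure))"
    using sets.sigma_algebra_axioms[of "borel :: 'a measure"] by simp
  have S: "sets S = sets borel" unfolding S_def using sigma_algebra.sets_measure_of_eq[OF sa] by simp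
  have "emeasure S A = ?\<mu> A" if A: "A \<in> sets borel" for A
    unfolding S_def
  proof (rule emeasure_measure_of_sigma[OF sa])
    show "positive (sets borel) ?\<mu>" by (simp add: positive_def)
    show "countably_additive (sets borel) ?\<mu>"
    proof (rule countably_additiveI)
      fix A :: "nat \<Rightarrow> 'a set"
      assume A: "range A \<subseteq> sets borel" "disjoint_family A"
      have "(\<Sum>j. ?\<mu> (A j)) = (\<Sum>i<m. \<Sum>j. emeasure (N i) (A j))"
        by (rule suminf_sum) (rule summableI)
      also have "\<dots> = ?\<mu> (\<Union>j. A j)"
        by (rule sum.cong[OF refl], rule suminf_emeasure) (use A assms in auto)
      finally show "(\<Sum>j. ?\<mu> (A j)) = ?\<mu> (\<Union>j. A j)" .
    qed
  qed (rule A)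
  then show ?thesis using that S by blast
qed

definition locally_graph :: "'a::euclidean_space set \<Rightarrow> 'a set \<Rightarrow> bool" where
  "locally_graph B M \<longleftrightarrow> (\<forall>x\<in>M. \<exists>b \<gamma> V. graph_chart B M b \<gamma> V \<and> x \<in> V)"

lemma is_surface_measure_iff:
  assumes B: "orthonormal B"
  shows "is_surface_measure B M S \<longleftrightarrow> sets S = sets borel \<and> emeasure S (- M) = 0 \<and>
     (\<forall>b \<gamma> V A. graph_chart B M b \<gamma> V \<and> A \<in> sets borel \<and> A \<subseteq> M \<inter> V \<longrightarrow>
        emeasure S A = emeasure (graph_measure B b \<gamma>) A)"
proof -
  have "emeasure (graph_measure B b \<gamma>) A =
     (\<integral>\<^sup>+ u. indicator A (u + \<gamma> u *\<^sub>R b) * ennreal (sqrt (1 + (\<Sum>c\<in>B - {b}. (dir_deriv c \<gamma> u)\<^sup>2))) \<partial>lborel_span (B - {b}))"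
    if "graph_chart B M b \<gamma> V" "A \<in> sets borel" for b \<gamma> V A
    using that by (subst emeasure_graph_measure[OF B]) (auto simp: graph_chart_def graph_density_def)
  note area = this
  have conv: "(\<forall>b\<in>B. \<forall>(\<gamma> :: 'a \<Rightarrow> real) V A.
        Ck_on 1 (B - {b}) (span (B - {b})) \<gamma> \<and> open V \<and>
        M \<inter> V = {x \<in> span B \<inter> V. x \<bullet> b = \<gamma> (drop_coord b x)} \<and> A \<in> sets borel \<and> A \<subseteq> M \<inter> V \<longrightarrow> Q b \<gamma> A)
     \<longleftrightarrow> (\<forall>b \<gamma> V A. graph_chart B M b \<gamma> V \<and> A \<in> sets borel \<and> A \<subseteq> M \<inter> V \<longrightarrow> Q b \<gamma> A)" for Q
    unfolding graph_chart_def by blast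
  have "(\<forall>b \<gamma> V A. graph_chart B M b \<gamma> V \<and> A \<in> sets borel \<and> A \<subseteq> M \<inter> V \<longrightarrow> emeasure S A =
     (\<integral>\<^sup>+ u. indicator A (u + \<gamma> u *\<^sub>R b) * ennreal (sqrt (1 + (\<Sum>c\<in>B - {b}. (dir_deriv c \<gamma> u)\<^sup>2))) \<partial>lborel_span (B - {b})))
     \<longleftrightarrow> (\<forall>b \<gamma> V A. graph_chart B M b \<gamma> V \<and> A \<in> sets borel \<and> A \<subseteq> M \<inter> V \<longrightarrow>
        emeasure S A = emeasure (graph_measure B b \<gamma>) A)"
    using area by (intro iff_allI imp_cong refl) (elim conjE, simp only:)
  then show ?thesis unfolding is_surface_measure_def conv by (intro conj_cong refl)
qed

text \<open>A compact hypersurface is cut into finitely many Borel pieces, each inside one chart.  A surface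
  measure is determined by its values on the pieces; conversely the graph measures of the pieces add
  up to one, by independence of the chart.\<close>

lemma compact_chart_pieces:
  fixes M :: "'a::euclidean_space set"
  assumes M: "compact M" "locally_graph B M"
  obtains m :: nat and b \<gamma> V P where
    "\<And>i. i < m \<Longrightarrow> graph_chart B M (b i) (\<gamma> i) (V i)" "\<And>i. i < m \<Longrightarrow> P i \<in> sets borel"
    "\<And>i. i < m \<Longrightarrow> P i \<subseteq> M \<inter> V i" "disjoint_family_on P {..<m}" "(\<Union>i<m. P i) = M"
proof -
  define Z where "Z = {(b, \<gamma>, V). graph_chart B M b \<gamma> V}"
  obtain X where X: "X \<subseteq> Z" "finite X" "M \<subseteq> (\<Union>z\<in>X. snd (snd z))"
  proof (rule compactE_image[OF M(1), of Z "\<lambda>z. snd (snd z)"])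
    show "open (snd (snd z))" if "z \<in> Z" for z using that unfolding Z_def graph_chart_def by auto
    show "M \<subseteq> (\<Union>z\<in>Z. snd (snd z))" using M(2) unfolding locally_graph_def Z_def by fastforce
  qed
  obtain e where e: "bij_betw e {0..<card X} X" using ex_bij_betw_nat_finite[OF X(2)] by blast
  define m where "m = card X"
  define b where "b i = fst (e i)" for i
  define \<gamma> where "\<gamma> i = fst (snd (e i))" for i
  define V where "V i = snd (snd (e i))" for i
  have ch: "graph_chart B M (b i) (\<gamma> i) (V i)" if "i < m" for i
  proof -
    have "e i \<in> Z" using e X(1) that by (auto simp: bij_betw_def m_def)
    then show ?thesis by (auto simp: Z_def b_def \<gamma>_def V_def split: prod.splits)
  qed
  have cov: "M \<subseteq> (\<Union>i<m. V i)"
  proof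
    fix x assume "x \<in> M"
    then obtain z where z: "z \<in> X" "x \<in> snd (snd z)" using X(3) by (auto simp: split_def)
    then obtain i where "i < m" "e i = z" using e by (force simp: bij_betw_def m_def)
    then show "x \<in> (\<Union>i<m. V i)" using z by (auto simp: V_def)
  qed
  define P where "P i = M \<inter> V i - (\<Union>j<i. V j)" for i
  show ?thesis
  proof (rule that[of m b \<gamma> V P])
    have oV: "open (V i)" if "i < m" for i using ch[OF that] by (simp add: graph_chart_def)
    have "open (\<Union>j<i. V j)" if "i < m" for i using oV that by (intro open_UN ballI) auto
    then show "P i \<in> sets borel" if "i < m" for i
      using that oV M(1) unfolding P_def by (intro sets.Diff sets.Int) (auto intro: borel_closed compact_imp_closed)
    show "disjoint_family_on P {..<m}"
      unfolding disjoint_family_on_def P_def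
    proof (intro ballI impI)
      fix i j :: nat assume "i \<noteq> j"
      then show "(M \<inter> V i - (\<Union>k<i. V k)) \<inter> (M \<inter> V j - (\<Union>k<j. V k)) = {}"
        by (cases "i < j") (auto simp: nat_neq_iff)
    qed
    show "(\<Union>i<m. P i) = M"
    proof
      show "M \<subseteq> (\<Union>i<m. P i)"
      proof
        fix x assume x: "x \<in> M"
        define i where "i = (LEAST i. i < m \<and> x \<in> V i)"
        have ex: "\<exists>i. i < m \<and> x \<in> V i" using cov x by auto
        have i: "i < m \<and> x \<in> V i" unfolding i_def by (rule LeastI_ex[OF ex])
        have "x \<notin> V j" if "j < i" for j
          using not_less_Least[OF that[unfolded i_def]] that i by auto
        then show "x \<in> (\<Union>i<m. P i)" using x i by (auto simp: P_def)
      qed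
    qed (auto simp: P_def)
  qed (auto simp: ch P_def)
qed

lemma emeasure_eq_sum_pieces:
  fixes m :: nat
  assumes S: "sets S = sets borel" "emeasure S (- M) = 0" and A: "A \<in> sets borel"
    and P: "\<And>i. i < m \<Longrightarrow> P i \<in> sets borel" "disjoint_family_on P {..<m}" "(\<Union>i<m. P i) = (M :: 'a::topological_space set)"
  shows "emeasure S A = (\<Sum>i<m. emeasure S (A \<inter> P i))"
proof -
  have M: "M \<in> sets borel" unfolding P(3)[symmetric] by (rule sets.finite_UN) (auto intro: P(1))
  have "emeasure S A = emeasure S (A \<inter> M \<union> (A - M))" by (simp add: Int_Diff_Un)
  also have "\<dots> = emeasure S (A \<inter> M) + emeasure S (A - M)"
    by (rule plus_emeasure[symmetric]) (use A M S in auto)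
  also have "emeasure S (A - M) = 0"
    using emeasure_mono[of "A - M" "- M" S] S M by auto
  also have "A \<inter> M = (\<Union>i<m. A \<inter> P i)" unfolding P(3)[symmetric] by auto
  also have "emeasure S (\<Union>i<m. A \<inter> P i) = (\<Sum>i<m. emeasure S (A \<inter> P i))"
    by (rule sum_emeasure[symmetric]) (use A P S in \<open>auto simp: disjoint_family_on_def\<close>)
  finally show ?thesis by simp
qed

lemma is_surface_measure_surface_measure:
  fixes M :: "'a::euclidean_space set"
  assumes B: "orthonormal B" and M: "compact M" "locally_graph B M"
  shows "is_surface_measure B M (surface_measure B M)"
proof -
  obtain m :: nat and b \<gamma> V P where
    ch: "\<And>i. i < m \<Longrightarrow> graph_chart B M (b i) (\<gamma> i) (V i)" and P: "\<And>i. i < m \<Longrightarrow> P i \<in> sets borel"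
    "disjoint_family_on P {..<m}" "(\<Union>i<m. P i) = M" and PV: "\<And>i. i < m \<Longrightarrow> P i \<subseteq> M \<inter> V i"
    using compact_chart_pieces[OF M] by metis
  define N where "N i = density (graph_measure B (b i) (\<gamma> i)) (indicator (P i))" for i
  have N: "emeasure (N i) A = emeasure (graph_measure B (b i) (\<gamma> i)) (A \<inter> P i)" if "i < m" "A \<in> sets borel" for i A
  proof -
    have "emeasure (N i) A = (\<integral>\<^sup>+ y. indicator (P i) y * indicator A y \<partial>graph_measure B (b i) (\<gamma> i))"
      unfolding N_def using that P(1) by (subst emeasure_density) auto
    also have "\<dots> = (\<integral>\<^sup>+ y. indicator (A \<inter> P i) y \<partial>graph_measure B (b i) (\<gamma> i))"
      by (intro nn_integral_cong) (auto simp: indicator_def)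
    also have "\<dots> = emeasure (graph_measure B (b i) (\<gamma> i)) (A \<inter> P i)" using that P(1) by (intro nn_integral_indicator) auto
    finally show ?thesis .
  qed
  obtain S where S: "sets S = sets borel" "\<And>A. A \<in> sets borel \<Longrightarrow> emeasure S A = (\<Sum>i<m. emeasure (N i) A)"
    by (rule finite_sum_of_measures[of m N]) (auto simp: N_def)
  have SN: "emeasure S A = (\<Sum>i<m. emeasure (graph_measure B (b i) (\<gamma> i)) (A \<inter> P i))" if "A \<in> sets borel" for A
    using S(2)[OF that] N that by simp
  have Mb: "M \<in> sets borel" using M(1) by (intro borel_closed compact_imp_closed)
  have "is_surface_measure B M S"
    unfolding is_surface_measure_iff[OF B]
  proof (intro conjI allI impI)
    show "sets S = sets borel" by (rule S)
    have "- M \<inter> P i = {}" if "i < m" for i using PV[OF that] by auto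
    then show "emeasure S (- M) = 0" using Mb by (subst SN) auto
    fix b' \<gamma>' V' A assume "graph_chart B M b' \<gamma>' V' \<and> A \<in> sets borel \<and> A \<subseteq> M \<inter> V'"
    then have ch': "graph_chart B M b' \<gamma>' V'" and A: "A \<in> sets borel" "A \<subseteq> M \<inter> V'" by auto
    have "emeasure S A = (\<Sum>i<m. emeasure (graph_measure B b' \<gamma>') (A \<inter> P i))"
      unfolding SN[OF A(1)]
    proof (rule sum.cong[OF refl])
      fix i assume "i \<in> {..<m}"
      then show "emeasure (graph_measure B (b i) (\<gamma> i)) (A \<inter> P i) = emeasure (graph_measure B b' \<gamma>') (A \<inter> P i)"
        using P A PV by (intro graph_measure_chart_independent[OF B ch ch']) auto
    qed
    also have "\<dots> = emeasure (graph_measure B b' \<gamma>') (\<Union>i<m. A \<inter> P i)"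
      by (rule sum_emeasure) (use A P in \<open>auto simp: disjoint_family_on_def\<close>)
    also have "(\<Union>i<m. A \<inter> P i) = A" using A P(3) by auto
    finally show "emeasure S A = emeasure (graph_measure B b' \<gamma>') A" .
  qed
  moreover have "S' = S''" if S': "is_surface_measure B M S'" and S'': "is_surface_measure B M S''" for S' S''
  proof (rule measure_eqI)
    note S' = S'[unfolded is_surface_measure_iff[OF B]] and S'' = S''[unfolded is_surface_measure_iff[OF B]]
    show "sets S' = sets S''" using S' S'' by simp
    fix A assume "A \<in> sets S'"
    then have A: "A \<in> sets borel" using S' by simp
    have "emeasure S' (A \<inter> P i) = emeasure S'' (A \<inter> P i)" if i: "i < m" for i
    proof -
      have "A \<inter> P i \<in> sets borel" "A \<inter> P i \<subseteq> M \<inter> V i" using A P PV i by auto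
      then show ?thesis using S' S'' ch[OF i] by metis
    qed
    moreover have "emeasure S' A = (\<Sum>i<m. emeasure S' (A \<inter> P i))"
      by (rule emeasure_eq_sum_pieces[where M=M]) (use S' A P in auto)
    moreover have "emeasure S'' A = (\<Sum>i<m. emeasure S'' (A \<inter> P i))"
      by (rule emeasure_eq_sum_pieces[where M=M]) (use S'' A P in auto)
    ultimately show "emeasure S' A = emeasure S'' A" by simp
  qed
  ultimately show ?thesis unfolding surface_measure_def by (metis theI)
qed

lemma locally_graph_subset_span:
  assumes "locally_graph B M" shows "M \<subseteq> span B"
proof
  fix x assume x: "x \<in> M"
  then obtain b \<gamma> V where "graph_chart B M b \<gamma> V" "x \<in> V" using assms unfolding locally_graph_def by blast
  then have "x \<in> {x \<in> span B \<inter> V. x \<bullet> b = \<gamma> (drop_coord b x)}" using x unfolding graph_chart_def by (metis IntI)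
  then show "x \<in> span B" by simp
qed

text \<open>On \<open>M \<inter> V\<close> the surface measure and the graph measure coincide, and \<open>F\<close> vanishes at the points of
  the graph outside \<open>V\<close>, where the graph may leave \<open>M\<close>.\<close>

lemma surface_integral_chart:
  fixes M :: "'a::euclidean_space set" and F :: "'a \<Rightarrow> 'b::{banach, second_countable_topology}"
  assumes B: "orthonormal B" and M: "compact M" "locally_graph B M" and ch: "graph_chart B M b \<gamma> V"
    and F[measurable]: "F \<in> borel_measurable borel" and supp: "\<And>y. y \<in> span B \<Longrightarrow> y \<notin> V \<Longrightarrow> F y = 0"
  shows "(\<integral> y. indicator M y *\<^sub>R F y \<partial>surface_measure B M) =
     (\<integral> u. graph_density B b \<gamma> (oproj (B - {b}) u) *\<^sub>R F (oproj (B - {b}) u + \<gamma> (oproj (B - {b}) u) *\<^sub>R b) \<partial>lborel_span (B - {b}))"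
proof -
  let ?S = "surface_measure B M" and ?N = "graph_measure B b \<gamma>" and ?P = "oproj (B - {b})"
  have b: "b \<in> B" and \<gamma>: "Ck_on 1 (B - {b}) (span (B - {b})) \<gamma>" and oV: "open V"
    using ch by (auto simp: graph_chart_def)
  have o: "orthonormal (B - {b})" by (rule orthonormal_subset[OF B Diff_subset])
  note S = is_surface_measure_surface_measure[OF B M, unfolded is_surface_measure_iff[OF B]]
  have sS: "sets ?S = sets borel" using S by simp
  have MV[measurable]: "M \<inter> V \<in> sets borel"
    using M(1) oV by (intro sets.Int) (auto intro: borel_closed compact_imp_closed)
  have dens: "density ?S (\<lambda>y. ennreal (indicator (M \<inter> V) y)) = density ?N (\<lambda>y. ennreal (indicator (M \<inter> V) y))"
  proof (rule measure_eqI)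
    show "sets (density ?S (\<lambda>y. ennreal (indicator (M \<inter> V) y))) = sets (density ?N (\<lambda>y. ennreal (indicator (M \<inter> V) y)))"
      using sS by simp
    fix A assume "A \<in> sets (density ?S (\<lambda>y. ennreal (indicator (M \<inter> V) y)))"
    then have A: "A \<in> sets borel" using sS by simp
    have e: "emeasure (density L (\<lambda>y. ennreal (indicator (M \<inter> V) y))) A = emeasure L (A \<inter> (M \<inter> V))"
      if L: "sets L = sets borel" for L
    proof -
      have "emeasure (density L (\<lambda>y. ennreal (indicator (M \<inter> V) y))) A = (\<integral>\<^sup>+ y. ennreal (indicator (M \<inter> V) y) * indicator A y \<partial>L)"
        by (rule emeasure_density) (use L A in \<open>auto simp: measurable_cong_sets[OF L]\<close>)
      also have "\<dots> = (\<integral>\<^sup>+ y. indicator (A \<inter> (M \<inter> V)) y \<partial>L)"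
        by (intro nn_integral_cong) (auto simp: indicator_def)
      also have "\<dots> = emeasure L (A \<inter> (M \<inter> V))" using L A by (intro nn_integral_indicator) auto
      finally show ?thesis .
    qed
    have "emeasure ?S (A \<inter> (M \<inter> V)) = emeasure ?N (A \<inter> (M \<inter> V))"
    proof -
      have "A \<inter> (M \<inter> V) \<in> sets borel" "A \<inter> (M \<inter> V) \<subseteq> M \<inter> V" using A MV by auto
      then show ?thesis using S ch by metis
    qed
    then show "emeasure (density ?S (\<lambda>y. ennreal (indicator (M \<inter> V) y))) A = emeasure (density ?N (\<lambda>y. ennreal (indicator (M \<inter> V) y))) A"
      by (simp add: e sS)
  qed
  have "indicator M y *\<^sub>R F y = indicator (M \<inter> V) y *\<^sub>R F y" for y
    using supp[of y] locally_graph_subset_span[OF M(2)] by (auto simp: indicator_def)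
  then have "(\<integral> y. indicator M y *\<^sub>R F y \<partial>?S) = (\<integral> y. indicator (M \<inter> V) y *\<^sub>R F y \<partial>?S)"
    by (intro Bochner_Integration.integral_cong refl)
  also have "\<dots> = (\<integral> y. F y \<partial>density ?S (\<lambda>y. ennreal (indicator (M \<inter> V) y)))"
    by (rule integral_density[symmetric]) (auto simp: measurable_cong_sets[OF sS])
  also have "\<dots> = (\<integral> y. indicator (M \<inter> V) y *\<^sub>R F y \<partial>?N)"
    unfolding dens by (rule integral_density) (auto simp: measurable_cong_sets[OF sets_graph_measure])
  also have "\<dots> = (\<integral> u. graph_density B b \<gamma> (?P u) *\<^sub>R (indicator (M \<inter> V) (u + \<gamma> (?P u) *\<^sub>R b) *\<^sub>R F (u + \<gamma> (?P u) *\<^sub>R b)) \<partial>lborel_span (B - {b}))"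
    by (rule integral_graph_measure[OF B b \<gamma>]) measurable
  also have "\<dots> = (\<integral> u. graph_density B b \<gamma> (?P u) *\<^sub>R F (?P u + \<gamma> (?P u) *\<^sub>R b) \<partial>lborel_span (B - {b}))"
  proof (rule integral_cong_AE)
    note [measurable] = graph_function_measurable[OF B b \<gamma>] graph_density_measurable[OF B b \<gamma>]
    show "(\<lambda>u. graph_density B b \<gamma> (?P u) *\<^sub>R (indicator (M \<inter> V) (u + \<gamma> (?P u) *\<^sub>R b) *\<^sub>R F (u + \<gamma> (?P u) *\<^sub>R b))) \<in> borel_measurable (lborel_span (B - {b}))"
      by measurable
    show "(\<lambda>u. graph_density B b \<gamma> (?P u) *\<^sub>R F (?P u + \<gamma> (?P u) *\<^sub>R b)) \<in> borel_measurable (lborel_span (B - {b}))"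
      by measurable
    show "AE u in lborel_span (B - {b}). graph_density B b \<gamma> (?P u) *\<^sub>R (indicator (M \<inter> V) (u + \<gamma> (?P u) *\<^sub>R b) *\<^sub>R F (u + \<gamma> (?P u) *\<^sub>R b))
        = graph_density B b \<gamma> (?P u) *\<^sub>R F (?P u + \<gamma> (?P u) *\<^sub>R b)"
      using AE_lborel_span
    proof eventually_elim
      fix u assume u: "u \<in> span (B - {b})"
      show "graph_density B b \<gamma> (?P u) *\<^sub>R (indicator (M \<inter> V) (u + \<gamma> (?P u) *\<^sub>R b) *\<^sub>R F (u + \<gamma> (?P u) *\<^sub>R b))
        = graph_density B b \<gamma> (?P u) *\<^sub>R F (?P u + \<gamma> (?P u) *\<^sub>R b)"
        using graph_chart_point[OF B ch u] supp[OF drop_coord_add_span(3)[OF B b u, of "\<gamma> u"]]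
        by (cases "u + \<gamma> u *\<^sub>R b \<in> V") (simp_all add: proj_ident[OF o u])
    qed
  qed
  finally show ?thesis .
qed

text \<open>Near each of its points \<open>M\<close> is parametrised by a bounded set with a bounded density.\<close>

lemma emeasure_surface_measure_finite:
  fixes M :: "'a::euclidean_space set"
  assumes B: "orthonormal B" and M: "compact M" "locally_graph B M"
  shows "emeasure (surface_measure B M) UNIV < \<infinity>"
proof -
  let ?S = "surface_measure B M"
  note S = is_surface_measure_surface_measure[OF B M, unfolded is_surface_measure_iff[OF B]]
  have sS: "sets ?S = sets borel" using S by simp
  have Mb: "M \<in> sets borel" using M(1) by (intro borel_closed compact_imp_closed)
  have loc: "\<exists>r>0. emeasure ?S (M \<inter> cball x r) < \<infinity>" if x: "x \<in> M" for x
  proof -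
    obtain b \<gamma> V where ch: "graph_chart B M b \<gamma> V" and xV: "x \<in> V"
      using M(2) x unfolding locally_graph_def by blast
    have b: "b \<in> B" and \<gamma>: "Ck_on 1 (B - {b}) (span (B - {b})) \<gamma>" and oV: "open V"
      using ch by (auto simp: graph_chart_def)
    have o: "orthonormal (B - {b})" by (rule orthonormal_subset[OF B Diff_subset])
    obtain r where r: "r > 0" "cball x r \<subseteq> V" using oV xV open_contains_cball by metis
    let ?d = "\<lambda>u. graph_density B b \<gamma> (oproj (B - {b}) u)"
    let ?A = "M \<inter> cball x r"
    have A: "?A \<in> sets borel" using Mb by auto
    have "compact (?d ` cball 0 (norm x + r))"
      by (intro compact_continuous_image continuous_on_subset[OF graph_density_continuous[OF B b \<gamma>]]) auto
    then obtain K where K: "\<And>u. u \<in> cball 0 (norm x + r) \<Longrightarrow> ?d u \<le> K"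
      using compact_imp_bounded bounded_imp_bdd_above unfolding bdd_above_def by (metis image_eqI)
    have "emeasure ?S ?A = emeasure (graph_measure B b \<gamma>) ?A"
    proof -
      have "?A \<subseteq> M \<inter> V" using r by auto
      then show ?thesis using S ch A by metis
    qed
    also have "\<dots> = (\<integral>\<^sup>+ u. indicator ?A (u + \<gamma> u *\<^sub>R b) * ennreal (graph_density B b \<gamma> u) \<partial>lborel_span (B - {b}))"
      by (rule emeasure_graph_measure[OF B b \<gamma> A])
    also have "\<dots> \<le> (\<integral>\<^sup>+ u. ennreal K * indicator (cball 0 (norm x + r)) u \<partial>lborel_span (B - {b}))"
    proof (rule nn_integral_mono_AE, use AE_lborel_span[of "B - {b}"] in eventually_elim)
      fix u assume u: "u \<in> span (B - {b})"
      show "indicator ?A (u + \<gamma> u *\<^sub>R b) * ennreal (graph_density B b \<gamma> u) \<le> ennreal K * indicator (cball 0 (norm x + r)) u"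
      proof (cases "u + \<gamma> u *\<^sub>R b \<in> ?A")
        case True
        let ?y = "u + \<gamma> u *\<^sub>R b"
        have "u = oproj (B - {b}) ?y"
          using drop_coord_add_span[OF B b u, of "\<gamma> u"] drop_coord_eq_proj[OF B b, of ?y] by simp
        then have "norm u \<le> norm ?y" using norm_proj_le[OF o, of ?y] by simp
        also have "\<dots> \<le> norm x + r"
          using True norm_triangle_ineq2[of ?y x] by (auto simp: dist_norm norm_minus_commute)
        finally have "u \<in> cball 0 (norm x + r)" by simp
        then show ?thesis using K[of u] True by (simp add: proj_ident[OF o u] ennreal_leI)
      qed simp
    qed
    also have "\<dots> = ennreal K * emeasure (lborel_span (B - {b})) (cball 0 (norm x + r))"
      by (rule nn_integral_cmult_indicator) simp
    also have "\<dots> < \<infinity>"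
      using emeasure_lborel_span_bounded[OF o bounded_cball, of 0 "norm x + r"] by (simp add: ennreal_mult_less_top)
    finally show ?thesis using r by blast
  qed
  then obtain r where r: "\<And>x. x \<in> M \<Longrightarrow> r x > 0 \<and> emeasure ?S (M \<inter> cball x (r x)) < \<infinity>" by metis
  obtain X where X: "X \<subseteq> M" "finite X" "M \<subseteq> (\<Union>x\<in>X. ball x (r x))"
  proof (rule compactE_image[OF M(1), of M "\<lambda>x. ball x (r x)"])
    show "M \<subseteq> (\<Union>x\<in>M. ball x (r x))" using r by force
  qed auto
  have U: "(\<Union>x\<in>X. M \<inter> cball x (r x)) \<in> sets ?S"
    by (rule sets.finite_UN) (use Mb X(2) in \<open>auto simp: sS\<close>)
  have "UNIV \<subseteq> - M \<union> (\<Union>x\<in>X. M \<inter> cball x (r x))" using X(3) by force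
  then have "emeasure ?S UNIV \<le> emeasure ?S (- M \<union> (\<Union>x\<in>X. M \<inter> cball x (r x)))"
    by (rule emeasure_mono[OF _ sets.Un[OF _ U]]) (use Mb in \<open>auto simp: sS\<close>)
  also have "\<dots> \<le> emeasure ?S (- M) + emeasure ?S (\<Union>x\<in>X. M \<inter> cball x (r x))"
    by (rule emeasure_subadditive[OF _ U]) (use Mb in \<open>auto simp: sS\<close>)
  also have "\<dots> \<le> 0 + (\<Sum>x\<in>X. emeasure ?S (M \<inter> cball x (r x)))"
    using S Mb by (intro add_mono emeasure_subadditive_finite X(2)) (auto simp: sS)
  also have "\<dots> < \<infinity>" using X r by (auto simp: subset_eq)
  finally show ?thesis .
qed

section \<open>Boundary charts and the exterior normal\<close>

text \<open>A boundary chart presents \<open>G\<close> near a boundary point as one side of the graph of \<open>\<delta>\<close>: above it for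
  \<open>s = 1\<close>, below it for \<open>s = - 1\<close>.\<close>

definition side_chart :: "'a::euclidean_space set \<Rightarrow> 'a set \<Rightarrow> real \<Rightarrow> 'a \<Rightarrow> ('a \<Rightarrow> real) \<Rightarrow> 'a set \<Rightarrow> bool" where
  "side_chart B G s b \<delta> V \<longleftrightarrow> b \<in> B \<and> s \<in> {-1, 1} \<and> Ck_on 1 (B - {b}) (span (B - {b})) \<delta> \<and> open V \<and>
     G \<inter> V = {x \<in> span B \<inter> V. s * \<delta> (drop_coord b x) < s * (x \<bullet> b)}"

text \<open>The gradient of \<open>x \<mapsto> s (\<delta> - x\<^sub>b)\<close>, which is negative on \<open>G\<close>, divided by its norm.\<close>

definition chart_normal :: "'a::euclidean_space set \<Rightarrow> real \<Rightarrow> 'a \<Rightarrow> ('a \<Rightarrow> real) \<Rightarrow> 'a \<Rightarrow> 'a" where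
  "chart_normal B s b \<delta> u =
     (s / graph_density B b \<delta> u) *\<^sub>R ((\<Sum>c\<in>B - {b}. dir_deriv c \<delta> u *\<^sub>R c) - b)"

lemma boundary_in_eq:
  fixes B :: "'a::euclidean_space set"
  assumes "openin (top_of_set (span B)) G"
  shows "boundary_in B G = closure G - G"
proof -
  have G: "G \<subseteq> span B" using openin_imp_subset[OF assms] .
  have "closure G \<subseteq> span B" by (rule closure_minimal[OF G]) simp
  then show ?thesis using G assms
    by (auto simp: boundary_in_def frontier_of_def closure_of_subtopology interior_of_openin Int_absorb1)
qed

lemma compact_boundary_in:
  fixes B :: "'a::euclidean_space set"
  assumes "openin (top_of_set (span B)) G" "bounded G"
  shows "compact (boundary_in B G)"
proof -
  obtain T where T: "open T" "G = span B \<inter> T" using assms(1) by (metis openin_open)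
  have "closure G \<subseteq> span B" using T by (intro closure_minimal) auto
  then have "closure G - G = closure G - T" using T by auto
  then show ?thesis unfolding boundary_in_eq[OF assms(1)] using T assms(2) by (simp add: compact_diff)
qed

lemma Ck_on_1_uminus:
  fixes f :: "'a::real_normed_vector \<Rightarrow> 'b::real_normed_vector"
  assumes "Ck_on 1 B X f"
  shows "Ck_on 1 B X (\<lambda>x. - f x)"
proof -
  have c: "continuous_on X f" and d: "\<And>b x. b \<in> B \<Longrightarrow> x \<in> X \<Longrightarrow> (\<lambda>t::real. f (x + t *\<^sub>R b)) differentiable (at 0)"
    and dc: "\<And>b. b \<in> B \<Longrightarrow> continuous_on X (dir_deriv b f)" using assms by auto
  have "dir_deriv b (\<lambda>x. - f x) x = - dir_deriv b f x" if "b \<in> B" "x \<in> X" for b x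
    using d[OF that] unfolding dir_deriv_def
    by (intro vector_derivative_at has_vector_derivative_minus) (simp add: vector_derivative_works)
  then have "continuous_on X (dir_deriv b (\<lambda>x. - f x))" if "b \<in> B" for b
    using continuous_on_minus[OF dc[OF that]] that by (simp cong: continuous_on_cong)
  then show ?thesis using c d by (simp add: continuous_on_minus differentiable_minus)
qed

lemma smooth_boundary_side_chart:
  fixes B :: "'a::euclidean_space set"
  assumes "has_smooth_boundary B G" "x0 \<in> boundary_in B G"
  obtains s b \<delta> V where "side_chart B G s b \<delta> V" "x0 \<in> V"
proof -
  obtain e b s \<gamma> where e: "e > 0" and b: "b \<in> B" and s: "s \<in> {-1, 1::real}"
    and \<gamma>: "smooth_on (B - {b}) (span (B - {b})) \<gamma>"
    and G: "G \<inter> ball x0 e = {x \<in> span B \<inter> ball x0 e. s * (x \<bullet> b) > \<gamma> (drop_coord b x)}"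
    using bspec[OF assms(1)[unfolded has_smooth_boundary_def] assms(2)] by (elim exE bexE conjE) (rule that, assumption+)
  have C: "Ck_on 1 (B - {b}) (span (B - {b})) \<gamma>" by (rule spec[OF \<gamma>[unfolded smooth_on_def]])
  have "Ck_on 1 (B - {b}) (span (B - {b})) (\<lambda>u. s * \<gamma> u)"
    using s C Ck_on_1_uminus[OF C] by auto
  moreover have "s * (s * y) = y" for y using s by auto
  then have "G \<inter> ball x0 e = {x \<in> span B \<inter> ball x0 e. s * (s * \<gamma> (drop_coord b x)) < s * (x \<bullet> b)}"
    by (simp only: G)
  ultimately have "side_chart B G s b (\<lambda>u. s * \<gamma> u) (ball x0 e)"
    unfolding side_chart_def using b s by blast
  then show ?thesis using that e by (metis centre_in_ball)
qed

context
  fixes B :: "'a::euclidean_space set" and G :: "'a set" and s :: real and b :: 'a and \<delta> :: "'a \<Rightarrow> real" and V :: "'a set"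
  assumes B: "orthonormal B" and G: "openin (top_of_set (span B)) G" and ch: "side_chart B G s b \<delta> V"
begin

lemma side_chart_facts:
  shows "b \<in> B" "s \<in> {-1, 1}" "s * s = 1" "Ck_on 1 (B - {b}) (span (B - {b})) \<delta>" "open V"
  using ch by (auto simp: side_chart_def)

lemma side_chart_iff:
  assumes "x \<in> V" "x \<in> span B"
  shows "x \<in> G \<longleftrightarrow> s * \<delta> (oproj (B - {b}) x) < s * (x \<bullet> b)"
proof -
  have "x \<in> G \<longleftrightarrow> x \<in> G \<inter> V" using assms by simp
  also have "\<dots> \<longleftrightarrow> x \<in> {x \<in> span B \<inter> V. s * \<delta> (drop_coord b x) < s * (x \<bullet> b)}"
    using ch by (simp add: side_chart_def)
  finally show ?thesis using assms drop_coord_eq_proj[OF B side_chart_facts(1) assms(2)] by simp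
qed

text \<open>The points of the graph are limits of the points of \<open>G\<close> above them in the direction \<open>s b\<close>; a point
  strictly on the other side has a neighbourhood disjoint from \<open>G\<close>.\<close>

lemma side_chart_imp_graph_chart: "graph_chart B (boundary_in B G) b \<delta> V"
proof -
  note f = side_chart_facts
  let ?P = "oproj (B - {b})"
  have GB: "G \<subseteq> span B" using openin_imp_subset[OF G] .
  have cl: "closure G \<subseteq> span B" by (rule closure_minimal[OF GB]) simp
  define \<psi> where "\<psi> x = s * (x \<bullet> b) - s * \<delta> (?P x)" for x
  have cont: "continuous_on UNIV \<psi>" unfolding \<psi>_def
    by (intro continuous_intros graph_function_continuous[OF B f(1,4)])
  have iff: "x \<in> G \<longleftrightarrow> \<psi> x > 0" if "x \<in> V" "x \<in> span B" for x
    using side_chart_iff[OF that] by (simp add: \<psi>_def)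
  have zero: "\<psi> x = 0 \<longleftrightarrow> x \<bullet> b = \<delta> (drop_coord b x)" if "x \<in> span B" for x
    using f(2) drop_coord_eq_proj[OF B f(1) that] by (auto simp: \<psi>_def)
  have "x \<in> boundary_in B G \<inter> V \<longleftrightarrow> x \<in> {x \<in> span B \<inter> V. x \<bullet> b = \<delta> (drop_coord b x)}" for x
  proof (cases "x \<in> span B \<inter> V")
    case False
    then show ?thesis using cl unfolding boundary_in_eq[OF G] by auto
  next
    case True
    have "x \<in> closure G - G \<longleftrightarrow> \<psi> x = 0"
    proof
      assume x: "x \<in> closure G - G"
      then have le: "\<psi> x \<le> 0" using iff True by force
      show "\<psi> x = 0"
      proof (rule ccontr)
        assume "\<psi> x \<noteq> 0"
        then have "x \<in> V \<inter> \<psi> -` {..<0}" using le True by auto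
        moreover have "open (V \<inter> \<psi> -` {..<0})" using cont f(5) by (intro open_Int open_vimage) auto
        ultimately have "(V \<inter> \<psi> -` {..<0}) \<inter> G \<noteq> {}"
          using x by (metis DiffD1 closure_iff_nhds_not_empty order_refl Int_commute)
        then show False using iff GB by force
      qed
    next
      assume x0: "\<psi> x = 0"
      obtain e where e: "e > 0" "ball x e \<subseteq> V" using f(5) True open_contains_ball by (metis IntD2)
      have "x \<in> closure G"
        unfolding closure_approachable
      proof (intro allI impI)
        fix d :: real assume d: "d > 0"
        define t where "t = min d e / 2"
        have t: "t > 0" "t < d" "t < e" using d e by (auto simp: t_def)
        let ?y = "x + (t * s) *\<^sub>R b"
        have dist: "dist ?y x = t" using t f(2) norm_orthonormal[OF B f(1)] by (auto simp: dist_norm abs_mult)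
        have yB: "?y \<in> span B" using True f(1) by (intro span_add span_scale) (auto intro: span_base)
        have "?P b = 0" unfolding oproj_def
          by (rule sum.neutral) (use B f(1) in \<open>auto simp: orthonormal_inner\<close>)
        then have "?P ?y = ?P x" by (simp add: linear_add[OF linear_proj] linear_cmul[OF linear_proj])
        then have "\<psi> ?y = \<psi> x + t * (s * s)" using B f(1)
          by (simp add: \<psi>_def inner_add_left orthonormal_inner algebra_simps)
        then have "?y \<in> G" using iff[of ?y] yB e t dist x0 f(3) by (auto simp: subset_eq dist_commute)
        then show "\<exists>y\<in>G. dist y x < d" using dist t by (intro bexI[of _ ?y]) simp_all
      qed
      then show "x \<in> closure G - G" using iff True x0 by auto
    qed
    then show ?thesis using zero True unfolding boundary_in_eq[OF G] by auto
  qed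
  then have "boundary_in B G \<inter> V = {x \<in> span B \<inter> V. x \<bullet> b = \<delta> (drop_coord b x)}" by blast
  then show ?thesis unfolding graph_chart_def using f by blast
qed

lemma chart_normal_inner:
  assumes "c \<in> B"
  shows "chart_normal B s b \<delta> u \<bullet> c = (if c = b then - s else s * dir_deriv c \<delta> u) / graph_density B b \<delta> u"
proof -
  have "(\<Sum>c\<in>B - {b}. dir_deriv c \<delta> u *\<^sub>R c) \<bullet> c = (if c = b then 0 else dir_deriv c \<delta> u)"
  proof (cases "c = b")
    case True
    have "(\<Sum>c\<in>B - {b}. dir_deriv c \<delta> u *\<^sub>R c) \<in> span (B - {b})"
      by (intro span_sum span_scale span_base)
    then show ?thesis using span_remove_inner[OF B side_chart_facts(1)] True by simp
  next
    case False
    have "orthonormal (B - {b})" by (rule orthonormal_subset[OF B Diff_subset])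
    then show ?thesis using inner_orthonormal_sum[of "B - {b}" c "\<lambda>c. dir_deriv c \<delta> u"] assms False by simp
  qed
  then show ?thesis using B assms side_chart_facts(1)
    by (auto simp: chart_normal_def inner_diff_left orthonormal_inner)
qed

lemma chart_normal_in_span: "chart_normal B s b \<delta> u \<in> span B"
  unfolding chart_normal_def using side_chart_facts(1)
  by (intro span_scale span_diff span_sum span_base) auto

lemma graph_density_sq: "(graph_density B b \<delta> u)\<^sup>2 = 1 + (\<Sum>c\<in>B - {b}. (dir_deriv c \<delta> u)\<^sup>2)"
  unfolding graph_density_def by (simp add: add_nonneg_nonneg sum_nonneg)

lemma sum_split_chart_direction: "(\<Sum>c\<in>B. F c) = F b + (\<Sum>c\<in>B - {b}. F c)" for F :: "'a \<Rightarrow> real"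
  by (rule sum.remove[OF orthonormal_finite[OF B] side_chart_facts(1)])

lemma norm_chart_normal: "norm (chart_normal B s b \<delta> u) = 1"
proof -
  let ?d = "graph_density B b \<delta> u"
  have "(\<Sum>c\<in>B - {b}. (chart_normal B s b \<delta> u \<bullet> c)\<^sup>2) = (\<Sum>c\<in>B - {b}. (dir_deriv c \<delta> u)\<^sup>2 / ?d\<^sup>2)"
    by (rule sum.cong[OF refl]) (use side_chart_facts(2) in \<open>auto simp: chart_normal_inner power_divide power_mult_distrib\<close>)
  then have "(norm (chart_normal B s b \<delta> u))\<^sup>2 = (1 + (\<Sum>c\<in>B - {b}. (dir_deriv c \<delta> u)\<^sup>2)) / ?d\<^sup>2"
    unfolding norm_span_expansion[OF B chart_normal_in_span] sum_split_chart_direction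
    using side_chart_facts(1,2) by (auto simp: chart_normal_inner power_divide add_divide_distrib sum_divide_distrib)
  also have "\<dots> = 1" using graph_density_pos[of B b \<delta> u] unfolding graph_density_sq[symmetric] by simp
  finally show ?thesis by (simp add: power2_eq_1_iff) (metis norm_ge_zero not_one_le_zero neg_0_le_iff_le order_trans zero_le_one)
qed

text \<open>Along the chart normal the function \<open>s (x\<^sub>b - \<delta>)\<close>, positive exactly on \<open>G\<close>, has the negative
  derivative \<open>- graph_density\<close>.\<close>

lemma chart_normal_crosses:
  assumes y: "y \<in> boundary_in B G \<inter> V"
  shows "\<forall>\<^sub>F t in at_right (0::real). y + t *\<^sub>R chart_normal B s b \<delta> (drop_coord b y) \<notin> G \<and>
           y - t *\<^sub>R chart_normal B s b \<delta> (drop_coord b y) \<in> G"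
proof -
  note f = side_chart_facts
  let ?P = "oproj (B - {b})" and ?u = "drop_coord b y"
  let ?n = "chart_normal B s b \<delta> ?u" and ?d = "graph_density B b \<delta> ?u"
  have o: "orthonormal (B - {b})" by (rule orthonormal_subset[OF B Diff_subset])
  have "y \<in> {x \<in> span B \<inter> V. x \<bullet> b = \<delta> (drop_coord b x)}"
    using y side_chart_imp_graph_chart unfolding graph_chart_def by metis
  then have yB: "y \<in> span B" and yV: "y \<in> V" and yb: "y \<bullet> b = \<delta> ?u" by auto
  have Py: "?P y = ?u" using drop_coord_eq_proj[OF B f(1) yB] by simp
  let ?l = "\<lambda>t::real. y + t *\<^sub>R ?n"
  define \<phi> where "\<phi> t = s * (?l t \<bullet> b) - s * (\<delta> \<circ> ?P) (?l t)" for t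
  have l: "(?l has_derivative (\<lambda>h. h *\<^sub>R ?n)) (at 0)" by (auto intro!: derivative_eq_intros)
  have "((\<delta> \<circ> ?P) has_derivative (\<lambda>h. \<Sum>c\<in>B - {b}. (h \<bullet> c) *\<^sub>R (dir_deriv c \<delta> \<circ> ?P) (?l 0))) (at (?l 0))"
    by (rule C1_onD(2)[OF C1_graph_function[OF o f(4)]]) simp
  from has_derivative_compose[OF l this]
  have 1: "((\<lambda>t. (\<delta> \<circ> ?P) (?l t)) has_derivative (\<lambda>h. \<Sum>c\<in>B - {b}. ((h *\<^sub>R ?n) \<bullet> c) *\<^sub>R (dir_deriv c \<delta> \<circ> ?P) (?l 0))) (at 0)" .
  have 2: "((\<lambda>t. ?l t \<bullet> b) has_derivative (\<lambda>h. (h *\<^sub>R ?n) \<bullet> b)) (at 0)" by (rule has_derivative_inner_left[OF l])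
  have "(\<phi> has_derivative (\<lambda>h. s * ((h *\<^sub>R ?n) \<bullet> b) - s * (\<Sum>c\<in>B - {b}. ((h *\<^sub>R ?n) \<bullet> c) *\<^sub>R (dir_deriv c \<delta> \<circ> ?P) (?l 0)))) (at 0)"
    unfolding \<phi>_def by (intro has_derivative_diff has_derivative_mult_right 1 2)
  moreover have "s * ((h *\<^sub>R ?n) \<bullet> b) - s * (\<Sum>c\<in>B - {b}. ((h *\<^sub>R ?n) \<bullet> c) *\<^sub>R (dir_deriv c \<delta> \<circ> ?P) (?l 0)) = (- ?d) * h" for h
  proof -
    have "(\<Sum>c\<in>B - {b}. ((h *\<^sub>R ?n) \<bullet> c) *\<^sub>R (dir_deriv c \<delta> \<circ> ?P) (?l 0)) = (\<Sum>c\<in>B - {b}. (h * s / ?d) * (dir_deriv c \<delta> ?u)\<^sup>2)"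
      by (rule sum.cong) (auto simp: chart_normal_inner Py power2_eq_square)
    also have "\<dots> = (h * s / ?d) * (?d\<^sup>2 - 1)" by (simp add: sum_distrib_left graph_density_sq)
    finally have S: "(\<Sum>c\<in>B - {b}. ((h *\<^sub>R ?n) \<bullet> c) *\<^sub>R (dir_deriv c \<delta> \<circ> ?P) (?l 0)) = (h * s / ?d) * (?d\<^sup>2 - 1)" .
    have nb: "(h *\<^sub>R ?n) \<bullet> b = - (h * s / ?d)" using f(1) by (simp add: chart_normal_inner)
    have "s * ((h *\<^sub>R ?n) \<bullet> b) - s * (\<Sum>c\<in>B - {b}. ((h *\<^sub>R ?n) \<bullet> c) *\<^sub>R (dir_deriv c \<delta> \<circ> ?P) (?l 0))
      = (s * s) * (- h / ?d - h / ?d * (?d\<^sup>2 - 1))"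
      unfolding S nb by (simp add: algebra_simps)
    also have "\<dots> = (- ?d) * h" using f(3) graph_density_pos[of B b \<delta> ?u] by (simp add: field_simps power2_eq_square)
    finally show ?thesis .
  qed
  ultimately have "(\<phi> has_derivative (*) (- ?d)) (at 0)" by (simp only:)
  then have der: "(\<phi> has_real_derivative (- ?d)) (at 0)" by (simp add: has_field_derivative_def)
  have neg: "- ?d < 0" using graph_density_pos[of B b \<delta> ?u] by simp
  have \<phi>0: "\<phi> 0 = 0" by (simp add: \<phi>_def Py yb)
  obtain d1 where d1: "d1 > 0" "\<And>h. 0 < h \<Longrightarrow> h < d1 \<Longrightarrow> \<phi> h < 0"
    using has_real_derivative_neg_dec_right[OF der neg] \<phi>0 by auto
  obtain d2 where d2: "d2 > 0" "\<And>h. 0 < h \<Longrightarrow> h < d2 \<Longrightarrow> 0 < \<phi> (- h)"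
    using has_real_derivative_neg_dec_left[OF der neg] \<phi>0 by auto
  obtain e where e: "e > 0" "ball y e \<subseteq> V" using f(5) yV open_contains_ball by metis
  have lB: "?l t \<in> span B" for t using yB chart_normal_in_span by (intro span_add span_scale)
  have lV: "?l t \<in> V" if "\<bar>t\<bar> < e" for t
    using e that by (auto simp: subset_eq dist_norm norm_chart_normal)
  have iff: "?l t \<in> G \<longleftrightarrow> 0 < \<phi> t" if "\<bar>t\<bar> < e" for t
    using side_chart_iff[OF lV[OF that] lB] by (simp add: \<phi>_def)
  show ?thesis unfolding eventually_at_right_field
  proof (intro exI[of _ "min e (min d1 d2)"] conjI allI impI)
    fix t :: real assume t: "0 < t" "t < min e (min d1 d2)"
    show "y + t *\<^sub>R ?n \<notin> G" using iff[of t] d1(2)[of t] t by auto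
    show "y - t *\<^sub>R ?n \<in> G" using iff[of "- t"] d2(2)[of t] t by auto
  qed (use e d1 d2 in auto)
qed

text \<open>Orthogonality to the coordinate curves forces any candidate to be a multiple of the chart normal, and
  \<open>chart_normal_crosses\<close> rules out the opposite sign.\<close>

lemma exterior_normal_eq_chart_normal:
  assumes y: "y \<in> boundary_in B G \<inter> V"
  shows "exterior_normal B G y = chart_normal B s b \<delta> (drop_coord b y)"
proof -
  note f = side_chart_facts
  let ?u = "drop_coord b y"
  let ?n = "chart_normal B s b \<delta> ?u" and ?d = "graph_density B b \<delta> ?u" and ?M = "boundary_in B G"
  note gch = side_chart_imp_graph_chart
  have "y \<in> {x \<in> span B \<inter> V. x \<bullet> b = \<delta> (drop_coord b x)}"
    using y gch unfolding graph_chart_def by metis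
  then have yB: "y \<in> span B" and yV: "y \<in> V" and yb: "y \<bullet> b = \<delta> ?u" by auto
  have u: "?u \<in> span (B - {b})" by (rule drop_coord_in_span[OF B f(1) yB])
  have yu: "?u + \<delta> ?u *\<^sub>R b = y" using drop_coord_decomp[of b y] yb by simp
  note cross = chart_normal_crosses[OF y]
  show ?thesis unfolding exterior_normal_def
  proof (rule the_equality)
    show "?n \<in> span B \<and> norm ?n = 1 \<and>
      (\<forall>c v. (\<forall>t::real. c t \<in> ?M) \<and> c 0 = y \<and> (c has_vector_derivative v) (at 0) \<longrightarrow> ?n \<bullet> v = 0) \<and>
      (\<forall>\<^sub>F t in at_right 0. y + t *\<^sub>R ?n \<notin> G \<and> y - t *\<^sub>R ?n \<in> G)"
    proof (intro conjI allI impI chart_normal_in_span norm_chart_normal cross)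
      fix c v assume c: "(\<forall>t::real. c t \<in> ?M) \<and> c 0 = y \<and> (c has_vector_derivative v) (at 0)"
      have vb: "v \<bullet> b = (\<Sum>e\<in>B - {b}. (v \<bullet> e) * dir_deriv e \<delta> ?u)"
        using graph_chart_tangent(1)[OF B gch, of c v] c y by auto
      have "?n \<bullet> v = ?n \<bullet> b * (v \<bullet> b) + (\<Sum>e\<in>B - {b}. (?n \<bullet> e) * (v \<bullet> e))"
        using inner_span_expansion[OF B chart_normal_in_span[of ?u], of v]
        by (simp only: sum_split_chart_direction)
      also have "(\<Sum>e\<in>B - {b}. (?n \<bullet> e) * (v \<bullet> e)) = (\<Sum>e\<in>B - {b}. s / ?d * ((v \<bullet> e) * dir_deriv e \<delta> ?u))"
        by (rule sum.cong) (auto simp: chart_normal_inner)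
      also have "\<dots> = s / ?d * (v \<bullet> b)" by (simp add: vb sum_distrib_left)
      finally show "?n \<bullet> v = 0" using f(1) by (simp add: chart_normal_inner)
    qed
  next
    fix \<nu> assume *: "\<nu> \<in> span B \<and> norm \<nu> = 1 \<and>
      (\<forall>c v. (\<forall>t::real. c t \<in> ?M) \<and> c 0 = y \<and> (c has_vector_derivative v) (at 0) \<longrightarrow> \<nu> \<bullet> v = 0) \<and>
      (\<forall>\<^sub>F t in at_right 0. y + t *\<^sub>R \<nu> \<notin> G \<and> y - t *\<^sub>R \<nu> \<in> G)"
    have orth: "\<nu> \<bullet> c + dir_deriv c \<delta> ?u * (\<nu> \<bullet> b) = 0" if c: "c \<in> B - {b}" for c
    proof -
      let ?\<kappa> = "\<lambda>t::real. (?u + t *\<^sub>R c) + \<delta> (?u + t *\<^sub>R c) *\<^sub>R b"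
      \<comment> \<open>The defining property quantifies over curves that stay in the boundary for all times.  Outside
        the chart the coordinate curve is replaced by \<open>y\<close>; only its derivative at \<open>0\<close> matters.\<close>
      define \<kappa>' where "\<kappa>' t = (if ?\<kappa> t \<in> ?M then ?\<kappa> t else y)" for t
      have "?u + \<delta> ?u *\<^sub>R b \<in> V" using yu yV by simp
      note k = graph_coordinate_curve[OF B gch u this c]
      have "\<forall>\<^sub>F t in at 0. ?\<kappa> t = \<kappa>' t" using k(2) by eventually_elim (simp add: \<kappa>'_def)
      moreover have k0: "?\<kappa> 0 = y" "\<kappa>' 0 = y" using yu y by (auto simp: \<kappa>'_def)
      ultimately have "(\<kappa>' has_vector_derivative c + dir_deriv c \<delta> ?u *\<^sub>R b) (at 0)"
        using k(1) unfolding has_vector_derivative_def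
        by (elim has_derivative_transform_eventually) auto
      moreover have "\<forall>t. \<kappa>' t \<in> ?M" using y by (auto simp: \<kappa>'_def)
      ultimately have "\<nu> \<bullet> (c + dir_deriv c \<delta> ?u *\<^sub>R b) = 0" using * k0 by blast
      then show ?thesis by (simp add: inner_add_right)
    qed
    define l where "l = - s * ?d * (\<nu> \<bullet> b)"
    have dp: "?d > 0" by (rule graph_density_pos)
    have \<nu>l: "\<nu> = l *\<^sub>R ?n"
    proof (rule span_eqI[OF B])
      fix c assume c: "c \<in> B"
      have ss: "l * s / ?d = - (s * s) * (\<nu> \<bullet> b)" using dp by (simp add: l_def)
      show "\<nu> \<bullet> c = (l *\<^sub>R ?n) \<bullet> c"
      proof (cases "c = b")
        case True
        then show ?thesis using ss f(3) c by (simp add: chart_normal_inner)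
      next
        case False
        have "(l *\<^sub>R ?n) \<bullet> c = (l * s / ?d) * dir_deriv c \<delta> ?u" using False c by (simp add: chart_normal_inner)
        then show ?thesis using ss f(3) orth[of c] False c by (simp add: algebra_simps)
      qed
    qed (use * chart_normal_in_span span_scale in auto)
    have "\<bar>l\<bar> = 1" using * \<nu>l norm_chart_normal[of ?u] by (metis mult.right_neutral norm_scaleR)
    moreover have "l \<noteq> -1"
    proof
      assume l: "l = -1"
      have "\<forall>\<^sub>F t in at_right (0::real). y + t *\<^sub>R \<nu> \<notin> G \<and> y - t *\<^sub>R \<nu> \<in> G" using * by blast
      then have "\<forall>\<^sub>F t in at_right (0::real). False"
        using cross by eventually_elim (use \<nu>l l in auto)
      then show False by (simp add: trivial_limit_at_right_real)
    qed
    ultimately have "l = 1" by linarith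
    then show "\<nu> = ?n" using \<nu>l by simp
  qed
qed

end

lemma smooth_boundary_locally_graph:
  fixes B :: "'a::euclidean_space set"
  assumes "orthonormal B" "openin (top_of_set (span B)) G" "has_smooth_boundary B G"
  shows "locally_graph B (boundary_in B G)"
  unfolding locally_graph_def
proof
  fix x assume "x \<in> boundary_in B G"
  then obtain s b \<delta> V where "side_chart B G s b \<delta> V" "x \<in> V" by (rule smooth_boundary_side_chart[OF assms(3)])
  then show "\<exists>b \<gamma> V. graph_chart B (boundary_in B G) b \<gamma> V \<and> x \<in> V"
    using side_chart_imp_graph_chart[OF assms(1,2)] by blast
qed

lemma chart_normal_continuous:
  fixes B :: "'a::euclidean_space set"
  assumes B: "orthonormal B" and ch: "side_chart B G s b \<delta> V"
  shows "continuous_on UNIV (\<lambda>y. chart_normal B s b \<delta> (oproj (B - {b}) y))"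
proof -
  have b: "b \<in> B" and \<delta>: "Ck_on 1 (B - {b}) (span (B - {b})) \<delta>" using ch by (auto simp: side_chart_def)
  have o: "orthonormal (B - {b})" by (rule orthonormal_subset[OF B Diff_subset])
  have "continuous_on UNIV (\<lambda>u. dir_deriv c \<delta> (oproj (B - {b}) u))" if "c \<in> B - {b}" for c
    using C1_onD(3)[OF C1_graph_function[OF o \<delta>] that] by (simp add: o_def)
  moreover have "graph_density B b \<delta> u \<noteq> 0" for u using graph_density_pos[of B b \<delta> u] by simp
  ultimately show ?thesis unfolding chart_normal_def
    by (intro continuous_intros graph_density_continuous[OF B b \<delta>]) auto
qed

lemma exterior_normal_properties:
  fixes B :: "'a::euclidean_space set"
  assumes B: "orthonormal B" and G: "openin (top_of_set (span B)) G" and sm: "has_smooth_boundary B G"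
  shows "continuous_on (boundary_in B G) (exterior_normal B G)"
    and "\<And>y. y \<in> boundary_in B G \<Longrightarrow> exterior_normal B G y \<in> span B"
proof -
  have loc: "continuous (at y within boundary_in B G) (exterior_normal B G) \<and> exterior_normal B G y \<in> span B"
    if y: "y \<in> boundary_in B G" for y
  proof -
    obtain s b \<delta> V where ch: "side_chart B G s b \<delta> V" and yV: "y \<in> V"
      using smooth_boundary_side_chart[OF sm y] .
    note f = side_chart_facts[OF B G ch]
    let ?n = "\<lambda>y. chart_normal B s b \<delta> (oproj (B - {b}) y)"
    have eq: "exterior_normal B G z = ?n z" if "z \<in> boundary_in B G \<inter> V" for z
    proof -
      have "z \<in> span B" using that locally_graph_subset_span[OF smooth_boundary_locally_graph[OF B G sm]] by auto
      then show ?thesis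
        using exterior_normal_eq_chart_normal[OF B G ch that] drop_coord_eq_proj[OF B f(1)] by simp
    qed
    have "continuous (at y within boundary_in B G) ?n"
      using chart_normal_continuous[OF B ch] by (simp add: continuous_on_eq_continuous_at continuous_at_imp_continuous_at_within)
    moreover have "\<forall>\<^sub>F z in at y within boundary_in B G. ?n z = exterior_normal B G z"
      unfolding eventually_at_topological by (rule exI[of _ V]) (use f(5) yV eq in auto)
    ultimately have "continuous (at y within boundary_in B G) (exterior_normal B G)"
      unfolding continuous_within using eq[of y] y yV by (auto elim: Lim_transform_eventually)
    then show ?thesis using eq[of y] y yV chart_normal_in_span[OF B G ch] by simp
  qed
  show "continuous_on (boundary_in B G) (exterior_normal B G)"
    unfolding continuous_on_eq_continuous_within using loc by blast
  show "\<And>y. y \<in> boundary_in B G \<Longrightarrow> exterior_normal B G y \<in> span B" using loc by blast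
qed

section \<open>The divergence theorem over one boundary chart\<close>

lemma oproj_add_direction:
  assumes B: "orthonormal B" and a: "a \<in> B"
  shows "oproj (B - {a}) (x + t *\<^sub>R a) = oproj (B - {a}) x"
proof -
  have "oproj (B - {a}) a = 0" unfolding oproj_def
    by (rule sum.neutral) (use B a in \<open>auto simp: orthonormal_inner\<close>)
  then show ?thesis by (simp add: linear_add[OF linear_proj] linear_cmul[OF linear_proj])
qed

lemma oproj_add_direction':
  assumes B: "orthonormal B" and b: "b \<in> B"
  shows "oproj B (x + t *\<^sub>R b) = oproj B x + t *\<^sub>R b"
  using proj_ident[OF B span_base[OF b]] by (simp add: linear_add[OF linear_proj] linear_cmul[OF linear_proj])

lemma oproj_oproj: "orthonormal B \<Longrightarrow> oproj B (oproj B x) = oproj B x"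
  by (rule proj_ident) (auto intro: proj_in_span)

text \<open>Fubini along one coordinate, with the remaining coordinates projected, so that the equations
  used below hold at every point rather than almost everywhere.\<close>

lemma integral_lborel_span_split_proj:
  fixes B :: "'a::euclidean_space set" and F :: "'a \<Rightarrow> 'b::{banach, second_countable_topology}"
  assumes B: "orthonormal B" and b: "b \<in> B" and F: "integrable (lborel_span B) F"
  shows "(\<integral> x. F x \<partial>lborel_span B) = (\<integral> u. (\<integral> t. F (oproj (B - {b}) u + t *\<^sub>R b) \<partial>lborel) \<partial>lborel_span (B - {b}))"
proof -
  let ?M = "lborel_span (B - {b})"
  have o: "orthonormal (B - {b})" by (rule orthonormal_subset[OF B Diff_subset])
  have [measurable]: "F \<in> borel_measurable borel"
    using borel_measurable_integrable[OF F] by (simp cong: measurable_cong_sets)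
  have "(\<integral> u. (\<integral> t. F (u + t *\<^sub>R b) \<partial>lborel) \<partial>?M) = (\<integral> u. (\<integral> t. F (oproj (B - {b}) u + t *\<^sub>R b) \<partial>lborel) \<partial>?M)"
  proof (rule integral_cong_AE)
    show "AE u in ?M. (\<integral> t. F (u + t *\<^sub>R b) \<partial>lborel) = (\<integral> t. F (oproj (B - {b}) u + t *\<^sub>R b) \<partial>lborel)"
      using AE_lborel_span by eventually_elim (simp add: proj_ident[OF o])
  qed measurable
  then show ?thesis using integral_lborel_span_split(1)[OF B b F] by simp
qed

lemma bounded_continuous_on_span:
  fixes f :: "'a::euclidean_space \<Rightarrow> 'b::real_normed_vector"
  assumes f: "continuous_on UNIV f" and K: "bounded K" and supp: "\<And>x. x \<in> span B \<Longrightarrow> x \<notin> K \<Longrightarrow> f x = 0"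
  obtains C where "\<And>x. x \<in> span B \<Longrightarrow> norm (f x) \<le> C"
proof -
  obtain R where R: "K \<subseteq> cball 0 R" using K unfolding bounded_iff by (metis mem_cball_0 subsetI)
  have "compact (f ` cball 0 R)"
    by (intro compact_continuous_image continuous_on_subset[OF f]) auto
  then obtain C where C: "\<And>x. x \<in> cball 0 R \<Longrightarrow> norm (f x) \<le> C"
    by (meson bounded_iff compact_imp_bounded image_eqI)
  have "norm (f x) \<le> max C 0" if "x \<in> span B" for x
  proof (cases "x \<in> K")
    case True
    then have "norm (f x) \<le> C" using C R by blast
    then show ?thesis by simp
  qed (simp add: supp[OF that])
  then show ?thesis using that by blast
qed

lemma integrable_indicator_continuous:
  fixes f :: "'a::euclidean_space \<Rightarrow> 'b::euclidean_space"
  assumes B: "orthonormal B" and S: "S \<in> sets borel" and f: "continuous_on UNIV f" and K: "bounded K"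
    and supp: "\<And>x. x \<in> span B \<Longrightarrow> x \<notin> K \<Longrightarrow> f x = 0"
  shows "integrable (lborel_span B) (\<lambda>x. indicator S x *\<^sub>R f x)"
proof -
  obtain C where C: "\<And>x. x \<in> span B \<Longrightarrow> norm (f x) \<le> C" using bounded_continuous_on_span[OF f K supp] by blast
  have [measurable]: "f \<in> borel_measurable borel" by (rule borel_measurable_continuous_onI[OF f])
  show ?thesis
  proof (rule integrable_lborel_span_bounded_support[OF B _ K])
    show "(\<lambda>x. indicator S x *\<^sub>R f x) \<in> borel_measurable borel" using S by measurable
    show "norm (indicator S x *\<^sub>R f x) \<le> C" if "x \<in> span B" for x
      using C[OF that] order_trans[OF norm_ge_zero C[OF that]] by (cases "x \<in> S") simp_all
  qed (simp add: supp)
qed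

lemma integral_derivative_compact_support:
  fixes f f' :: "real \<Rightarrow> 'b::euclidean_space"
  assumes der: "\<And>t. (f has_vector_derivative f' t) (at t)" and cont: "continuous_on UNIV f'"
    and R: "\<And>t. \<bar>t\<bar> > R \<Longrightarrow> f t = 0" "\<And>t. \<bar>t\<bar> > R \<Longrightarrow> f' t = 0"
  shows "(\<integral> t. indicator {0<..} t *\<^sub>R f' t \<partial>lborel) = - f 0" and "(\<integral> t. f' t \<partial>lborel) = 0"
proof -
  define L where "L = \<bar>R\<bar> + 1"
  have L: "L > 0" "L > R" by (auto simp: L_def)
  have fm: "f' \<in> borel_measurable borel" by (rule borel_measurable_continuous_onI[OF cont])
  have ftc: "(\<integral> t. indicator {a..L} t *\<^sub>R f' t \<partial>lborel) = f L - f a" if "a \<le> L" for a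
    by (rule integral_FTC_Icc[OF that has_vector_derivative_at_within[OF der] continuous_on_subset[OF cont]]) auto
  have fL: "f L = 0" "f (- L) = 0" using R(1)[of L] R(1)[of "- L"] L by auto
  have "(\<integral> t. indicator {0<..} t *\<^sub>R f' t \<partial>lborel) = (\<integral> t. indicator {0..L} t *\<^sub>R f' t \<partial>lborel)"
  proof (rule integral_cong_AE)
    show "AE t in lborel. indicator {0<..} t *\<^sub>R f' t = indicator {0..L} t *\<^sub>R f' t"
      using AE_lborel_singleton[of "0::real"]
    proof eventually_elim
      fix t :: real assume "t \<noteq> 0"
      then show "indicator {0<..} t *\<^sub>R f' t = indicator {0..L} t *\<^sub>R f' t"
        using R(2)[of t] L by (cases "t > L") (auto simp: indicator_def)
    qed
  qed (use fm in measurable)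
  then show "(\<integral> t. indicator {0<..} t *\<^sub>R f' t \<partial>lborel) = - f 0" using ftc[of 0] L fL by simp
  have "f' t = indicator {-L..L} t *\<^sub>R f' t" for t
    using R(2)[of t] L by (cases "\<bar>t\<bar> > L") (auto simp: indicator_def)
  then have "(\<integral> t. f' t \<partial>lborel) = (\<integral> t. indicator {-L..L} t *\<^sub>R f' t \<partial>lborel)" by metis
  then show "(\<integral> t. f' t \<partial>lborel) = 0" using ftc[of "- L"] L fL by simp
qed

lemma C1_on_curve:
  assumes f: "C1_on B X f f'" and \<kappa>: "(\<kappa> has_vector_derivative v) (at t)" "\<kappa> t \<in> X"
  shows "((\<lambda>t. f (\<kappa> t)) has_vector_derivative (\<Sum>c\<in>B. (v \<bullet> c) *\<^sub>R f' c (\<kappa> t))) (at t)"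
proof -
  have "((\<lambda>t. f (\<kappa> t)) has_derivative (\<lambda>h. \<Sum>c\<in>B. ((h *\<^sub>R v) \<bullet> c) *\<^sub>R f' c (\<kappa> t))) (at t)"
    by (rule has_derivative_compose[OF \<kappa>(1)[unfolded has_vector_derivative_def] C1_onD(2)[OF f \<kappa>(2)]])
  then show ?thesis by (simp add: has_vector_derivative_def scaleR_sum_right)
qed

text \<open>Fubini in the direction \<open>b\<close>: on each line the derivative of a function of bounded support integrates
  to \<open>0\<close>, and \<open>S\<close> contains a line or misses it.\<close>

lemma integral_partial_compact_support:
  fixes B :: "'a::euclidean_space set" and \<phi> :: "'a \<Rightarrow> 'b::euclidean_space"
  assumes B: "orthonormal B" and b: "b \<in> B" and \<psi>: "continuous_on UNIV \<psi>" and K: "bounded K"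
    and supp: "\<And>x. x \<in> span B \<Longrightarrow> x \<notin> K \<Longrightarrow> \<phi> x = 0" "\<And>x. x \<in> span B \<Longrightarrow> x \<notin> K \<Longrightarrow> \<psi> x = 0"
    and der: "\<And>x t. x \<in> span B \<Longrightarrow> ((\<lambda>t. \<phi> (x + t *\<^sub>R b)) has_vector_derivative \<psi> (x + t *\<^sub>R b)) (at t)"
    and S: "S \<in> sets borel" "\<And>x t. x + t *\<^sub>R b \<in> S \<longleftrightarrow> x \<in> S"
  shows "(\<integral> x. indicator S x *\<^sub>R \<psi> x \<partial>lborel_span B) = 0"
proof -
  let ?P = "oproj (B - {b})"
  obtain R where R: "K \<subseteq> cball 0 R" using K unfolding bounded_iff by (metis mem_cball_0 subsetI)
  have "(\<integral> x. indicator S x *\<^sub>R \<psi> x \<partial>lborel_span B) =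
     (\<integral> u. (\<integral> t. indicator S (?P u + t *\<^sub>R b) *\<^sub>R \<psi> (?P u + t *\<^sub>R b) \<partial>lborel) \<partial>lborel_span (B - {b}))"
    by (rule integral_lborel_span_split_proj[OF B b integrable_indicator_continuous[OF B S(1) \<psi> K supp(2)]])
  also have "\<dots> = (\<integral> u. 0 \<partial>lborel_span (B - {b}))"
  proof (rule Bochner_Integration.integral_cong[OF refl])
    fix u
    have Pu: "?P u \<in> span (B - {b})" by (rule proj_in_span)
    have out: "?P u + t *\<^sub>R b \<notin> K" if "\<bar>t\<bar> > R" for t
    proof -
      have "\<bar>(?P u + t *\<^sub>R b) \<bullet> b\<bar> \<le> norm (?P u + t *\<^sub>R b)" by (rule abs_inner_orthonormal_le[OF B b])
      then show ?thesis using that R drop_coord_add_span(2)[OF B b Pu, of t] by auto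
    qed
    have PB: "?P u + t *\<^sub>R b \<in> span B" for t by (rule drop_coord_add_span(3)[OF B b Pu])
    have "(\<integral> t. \<psi> (?P u + t *\<^sub>R b) \<partial>lborel) = 0"
    proof (rule integral_derivative_compact_support(2)[where f="\<lambda>t. \<phi> (?P u + t *\<^sub>R b)" and R=R])
      show "((\<lambda>t. \<phi> (?P u + t *\<^sub>R b)) has_vector_derivative \<psi> (?P u + t *\<^sub>R b)) (at t)" for t
        by (rule der) (use PB[of 0] in simp)
      show "continuous_on UNIV (\<lambda>t. \<psi> (?P u + t *\<^sub>R b))"
        by (intro continuous_on_compose2[OF \<psi>] continuous_intros) auto
    qed (use out PB supp in auto)
    moreover have "indicator S (?P u + t *\<^sub>R b) = (indicator S (?P u) :: real)" for t
      by (simp add: indicator_def S(2))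
    ultimately show "(\<integral> t. indicator S (?P u + t *\<^sub>R b) *\<^sub>R \<psi> (?P u + t *\<^sub>R b) \<partial>lborel) = 0"
      by simp
  qed
  finally show ?thesis by simp
qed

text \<open>Under the shear \<open>x\<^sub>a = \<delta>(u) + s \<tau>\<close> the region becomes the half space \<open>\<tau> > 0\<close>.  There the
  \<open>\<tau>\<close>-derivative integrates to a boundary value, derivatives in the directions \<open>b \<noteq> a\<close> integrate to
  \<open>0\<close>, and the chain rule converts one into the other.\<close>

lemma divergence_over_graph:
  fixes B :: "'a::euclidean_space set" and \<phi> :: "'a \<Rightarrow> 'b::euclidean_space"
  assumes B: "orthonormal B" and a: "a \<in> B" and s: "s \<in> {-1, 1::real}"
    and \<delta>: "Ck_on 1 (B - {a}) (span (B - {a})) \<delta>" and \<phi>: "C1_on B UNIV \<phi> \<phi>'" and K: "bounded K"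
    and supp: "\<And>x. x \<in> span B \<Longrightarrow> x \<notin> K \<Longrightarrow> \<phi> x = 0" "\<And>x c. x \<in> span B \<Longrightarrow> x \<notin> K \<Longrightarrow> c \<in> B \<Longrightarrow> \<phi>' c x = 0"
    and b: "b \<in> B"
  defines "P \<equiv> oproj (B - {a})"
  shows "(\<integral> x. indicator {x. s * \<delta> (P x) < s * (x \<bullet> a)} x *\<^sub>R \<phi>' b x \<partial>lborel_span B) =
    (\<integral> u. (if b = a then - s else s * dir_deriv b \<delta> (P u)) *\<^sub>R \<phi> (P u + \<delta> (P u) *\<^sub>R a) \<partial>lborel_span (B - {a}))"
proof -
  have ss: "s * s = 1" "\<bar>s\<bar> = 1" "s \<noteq> 0" using s by auto
  let ?Q = "B - {a}"
  have o: "orthonormal ?Q" by (rule orthonormal_subset[OF B Diff_subset])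
  define d where "d x = \<delta> (P x)" for x
  \<comment> \<open>The shear: it maps the half space \<open>x\<^sub>a > 0\<close> onto the region over the graph.\<close>
  define T where "T x = P x + (d x + s * (x \<bullet> a)) *\<^sub>R a" for x
  let ?H = "{x. s * \<delta> (P x) < s * (x \<bullet> a)}" and ?Half = "{x::'a. 0 < x \<bullet> a}"
  have dC: "C1_on ?Q UNIV (\<delta> \<circ> P) (\<lambda>b. dir_deriv b \<delta> \<circ> P)" unfolding P_def by (rule C1_graph_function[OF o \<delta>])
  have dcont: "continuous_on UNIV d" using C1_on_imp_continuous_on[OF dC] by (simp add: d_def o_def)
  have ddcont: "continuous_on UNIV (\<lambda>x. dir_deriv c \<delta> (P x))" if "c \<in> ?Q" for c
    using C1_onD(3)[OF dC that] by (simp add: o_def)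
  have Pcont: "continuous_on UNIV P" unfolding P_def by (intro continuous_intros)
  have Tcont: "continuous_on UNIV T" unfolding T_def by (intro continuous_intros dcont Pcont)
  have \<phi>cont: "continuous_on UNIV \<phi>" by (rule C1_on_imp_continuous_on[OF \<phi>])
  have \<phi>'cont: "continuous_on UNIV (\<phi>' c)" if "c \<in> B" for c by (rule C1_onD(3)[OF \<phi> that])
  have PQ: "P x \<in> span ?Q" for x unfolding P_def by (rule proj_in_span)
  have Pa: "P (x + t *\<^sub>R a) = P x" for x t unfolding P_def by (rule oproj_add_direction[OF B a])
  have PP: "P (P x) = P x" for x unfolding P_def by (rule oproj_oproj[OF o])
  have PaP: "P (P x + t *\<^sub>R a) = P x" for x t by (simp add: Pa PP)
  have ina: "(P x + t *\<^sub>R a) \<bullet> a = t" for x t by (rule drop_coord_add_span(2)[OF B a PQ])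
  have inB: "P x + t *\<^sub>R a \<in> span B" for x t by (rule drop_coord_add_span(3)[OF B a PQ])
  have TB: "T x \<in> span B" for x unfolding T_def by (rule inB)
  have T_on: "T (P u + t *\<^sub>R a) = P u + (\<delta> (P u) + s * t) *\<^sub>R a" for u t
    unfolding T_def d_def by (simp only: PaP ina)
  have Hm[measurable]: "?H \<in> sets borel"
  proof -
    have "open {x. s * d x < s * (x \<bullet> a)}" by (intro open_Collect_less continuous_intros dcont)
    then show ?thesis by (simp add: d_def borel_open)
  qed
  have H0m[measurable]: "?Half \<in> sets borel" by (intro borel_open open_Collect_less continuous_intros)
  obtain R where R: "K \<subseteq> cball 0 R" using K unfolding bounded_iff by (metis mem_cball_0 subsetI)
  obtain D where D: "\<And>x. x \<in> cball 0 R \<Longrightarrow> \<bar>d x\<bar> \<le> D"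
  proof -
    have "compact (d ` cball 0 R)" by (intro compact_continuous_image continuous_on_subset[OF dcont]) auto
    then have "bounded (d ` cball 0 R)" by (rule compact_imp_bounded)
    then show ?thesis using that unfolding bounded_iff by (metis image_eqI real_norm_def)
  qed
  define K' where "K' = {x \<in> span B. norm (P x) \<le> R \<and> \<bar>x \<bullet> a\<bar> \<le> R + D}"
  have K': "bounded K'" unfolding bounded_iff
  proof (intro exI ballI)
    fix x assume x: "x \<in> K'"
    then have "x = P x + (x \<bullet> a) *\<^sub>R a"
      using drop_coord_decomp[of a x] drop_coord_eq_proj[OF B a, of x] by (simp add: K'_def P_def)
    then have "norm x \<le> norm (P x) + \<bar>x \<bullet> a\<bar>"
      using norm_triangle_ineq[of "P x" "(x \<bullet> a) *\<^sub>R a"] norm_orthonormal[OF B a] by simp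
    then show "norm x \<le> R + (R + D)" using x by (simp add: K'_def)
  qed
  have TK: "T x \<notin> K" if x: "x \<in> span B" "x \<notin> K'" for x
  proof (cases "norm (P x) \<le> R")
    case False
    have "P (T x) = P x" unfolding T_def by (rule PaP)
    then have "norm (P x) \<le> norm (T x)" using norm_proj_le[OF o, of "T x"] by (simp add: P_def)
    then show ?thesis using False R by auto
  next
    case True
    then have "\<bar>d x\<bar> \<le> D" using D[of "P x"] by (simp add: d_def PP)
    moreover have "\<bar>x \<bullet> a\<bar> > R + D" using True x by (auto simp: K'_def)
    moreover have "\<bar>d x + s * (x \<bullet> a)\<bar> \<le> norm (T x)"
      using abs_inner_orthonormal_le[OF B a, of "T x"] ina by (simp add: T_def)
    moreover have "\<bar>s * (x \<bullet> a)\<bar> = \<bar>x \<bullet> a\<bar>" using ss by (simp add: abs_mult)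
    ultimately have "norm (T x) > R" by linarith
    then show ?thesis using R by auto
  qed
  have supp': "\<phi> (T x) = 0" "c \<in> B \<Longrightarrow> \<phi>' c (T x) = 0" if "x \<in> span B" "x \<notin> K'" for x c
    using supp(1)[OF TB TK[OF that]] supp(2)[OF TB TK[OF that]] by auto
  have \<phi>T: "continuous_on UNIV (\<lambda>x. \<phi>' c (T x))" if "c \<in> B" for c
    by (rule continuous_on_compose2[OF \<phi>'cont[OF that] Tcont]) auto
  have "(\<integral> x. indicator ?H x *\<^sub>R \<phi>' b x \<partial>lborel_span B) =
     (\<integral> u. (\<integral> t. indicator ?H (P u + t *\<^sub>R a) *\<^sub>R \<phi>' b (P u + t *\<^sub>R a) \<partial>lborel) \<partial>lborel_span ?Q)"
    unfolding P_def
    by (rule integral_lborel_span_split_proj[OF B a integrable_indicator_continuous[OF B Hm[unfolded P_def] \<phi>'cont[OF b] K supp(2)]])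
       (use b in auto)
  also have "\<dots> = (\<integral> u. (\<integral> t. indicator ?Half (P u + t *\<^sub>R a) *\<^sub>R \<phi>' b (T (P u + t *\<^sub>R a)) \<partial>lborel) \<partial>lborel_span ?Q)"
  proof (rule Bochner_Integration.integral_cong[OF refl])
    fix u
    have "(\<integral> t. indicator ?H (P u + t *\<^sub>R a) *\<^sub>R \<phi>' b (P u + t *\<^sub>R a) \<partial>lborel) =
       \<bar>s\<bar> *\<^sub>R (\<integral> t. indicator ?H (P u + (\<delta> (P u) + s * t) *\<^sub>R a) *\<^sub>R \<phi>' b (P u + (\<delta> (P u) + s * t) *\<^sub>R a) \<partial>lborel)"
      by (rule lborel_integral_real_affine[OF ss(3)])
    moreover have "(P u + (\<delta> (P u) + s * t) *\<^sub>R a \<in> ?H) = (P u + t *\<^sub>R a \<in> ?Half)" for t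
    proof -
      have eq: "s * (\<delta> (P u) + s * t) = s * \<delta> (P u) + t" using ss(1) by (simp add: distrib_left mult.assoc[symmetric])
      show ?thesis unfolding mem_Collect_eq PaP ina eq by simp
    qed
    ultimately show "(\<integral> t. indicator ?H (P u + t *\<^sub>R a) *\<^sub>R \<phi>' b (P u + t *\<^sub>R a) \<partial>lborel) =
       (\<integral> t. indicator ?Half (P u + t *\<^sub>R a) *\<^sub>R \<phi>' b (T (P u + t *\<^sub>R a)) \<partial>lborel)"
      unfolding T_on indicator_def ss(2) by simp
  qed
  also have "\<dots> = (\<integral> x. indicator ?Half x *\<^sub>R \<phi>' b (T x) \<partial>lborel_span B)"
    unfolding P_def
    by (rule integral_lborel_span_split_proj[OF B a integrable_indicator_continuous[OF B H0m \<phi>T[OF b] K' supp'(2)], symmetric])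
       (use b in auto)
  finally have step1: "(\<integral> x. indicator ?H x *\<^sub>R \<phi>' b x \<partial>lborel_span B) = (\<integral> x. indicator ?Half x *\<^sub>R \<phi>' b (T x) \<partial>lborel_span B)" .
  have step2: "(\<integral> x. indicator ?Half x *\<^sub>R (w (P x) *\<^sub>R \<phi>' a (T x)) \<partial>lborel_span B) =
     (\<integral> u. (- s * w (P u)) *\<^sub>R \<phi> (P u + \<delta> (P u) *\<^sub>R a) \<partial>lborel_span ?Q)"
    if w: "continuous_on UNIV (\<lambda>x. w (P x))" for w :: "'a \<Rightarrow> real"
  proof -
    have c: "continuous_on UNIV (\<lambda>x. w (P x) *\<^sub>R \<phi>' a (T x))" by (intro continuous_intros w \<phi>T[OF a])
    have "(\<integral> x. indicator ?Half x *\<^sub>R (w (P x) *\<^sub>R \<phi>' a (T x)) \<partial>lborel_span B) =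
       (\<integral> u. (\<integral> t. indicator ?Half (P u + t *\<^sub>R a) *\<^sub>R (w (P (P u + t *\<^sub>R a)) *\<^sub>R \<phi>' a (T (P u + t *\<^sub>R a))) \<partial>lborel) \<partial>lborel_span ?Q)"
      unfolding P_def
      by (rule integral_lborel_span_split_proj[OF B a integrable_indicator_continuous[OF B H0m c[unfolded P_def] K']])
         (use supp'(2) a in auto)
    also have "\<dots> = (\<integral> u. (- s * w (P u)) *\<^sub>R \<phi> (P u + \<delta> (P u) *\<^sub>R a) \<partial>lborel_span ?Q)"
    proof (rule Bochner_Integration.integral_cong[OF refl])
      fix u
      let ?l = "\<lambda>t. P u + (\<delta> (P u) + s * t) *\<^sub>R a"
      define g where "g t = (s * w (P u)) *\<^sub>R \<phi> (?l t)" for t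
      define g' where "g' t = w (P u) *\<^sub>R \<phi>' a (?l t)" for t
      have l: "(?l has_vector_derivative s *\<^sub>R a) (at t)" for t
        by (auto intro!: derivative_eq_intros simp: has_vector_derivative_def)
      have sa: "(\<Sum>c\<in>B. ((s *\<^sub>R a) \<bullet> c) *\<^sub>R \<phi>' c y) = s *\<^sub>R \<phi>' a y" for y
      proof -
        have "(\<Sum>c\<in>B. ((s *\<^sub>R a) \<bullet> c) *\<^sub>R \<phi>' c y) = (\<Sum>c\<in>B. if c = a then s *\<^sub>R \<phi>' c y else 0)"
          by (rule sum.cong) (use B a in \<open>auto simp: orthonormal_inner\<close>)
        then show ?thesis using a by (simp add: orthonormal_finite[OF B])
      qed
      have gder: "(g has_vector_derivative g' t) (at t)" for t
      proof -
        have "((\<lambda>t. \<phi> (?l t)) has_vector_derivative s *\<^sub>R \<phi>' a (?l t)) (at t)"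
          using C1_on_curve[OF \<phi> l] unfolding sa by simp
        then have "(g has_vector_derivative (s * w (P u)) *\<^sub>R (s *\<^sub>R \<phi>' a (?l t))) (at t)"
          unfolding g_def by (rule bounded_linear.has_vector_derivative[OF bounded_linear_scaleR_right])
        moreover have "(s * w (P u)) *\<^sub>R (s *\<^sub>R \<phi>' a (?l t)) = g' t"
          using ss(1) by (simp add: g'_def mult.commute mult.left_commute)
        ultimately show ?thesis by simp
      qed
      have out: "?l t \<notin> K" if t: "\<bar>t\<bar> > R + \<bar>\<delta> (P u)\<bar>" for t
      proof -
        have "\<bar>\<delta> (P u) + s * t\<bar> \<le> norm (?l t)"
          using abs_inner_orthonormal_le[OF B a, of "?l t"] by (simp only: ina)
        moreover have "\<bar>s * t\<bar> = \<bar>t\<bar>" using ss by (simp add: abs_mult)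
        ultimately have "norm (?l t) > R" using t by linarith
        then show ?thesis using R by auto
      qed
      have "(\<integral> t. indicator {0<..} t *\<^sub>R g' t \<partial>lborel) = - g 0"
      proof (rule integral_derivative_compact_support(1)[OF gder])
        show "continuous_on UNIV g'" unfolding g'_def
          by (intro continuous_intros continuous_on_compose2[OF \<phi>'cont[OF a]]) auto
        show "g t = 0" "g' t = 0" if "\<bar>t\<bar> > R + \<bar>\<delta> (P u)\<bar>" for t
          using supp(1)[OF inB out[OF that]] supp(2)[OF inB out[OF that] a] by (simp_all add: g_def g'_def)
      qed
      then show "(\<integral> t. indicator ?Half (P u + t *\<^sub>R a) *\<^sub>R (w (P (P u + t *\<^sub>R a)) *\<^sub>R \<phi>' a (T (P u + t *\<^sub>R a))) \<partial>lborel) =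
        (- s * w (P u)) *\<^sub>R \<phi> (P u + \<delta> (P u) *\<^sub>R a)"
        unfolding T_on PaP g'_def g_def by (simp add: indicator_def ina)
    qed
    finally show ?thesis .
  qed
  show ?thesis
  proof (cases "b = a")
    case True
    show ?thesis using step1 step2[of "\<lambda>_. 1"] True by simp
  next
    case False
    then have bQ: "b \<in> ?Q" using b by simp
    let ?w = "\<lambda>x. dir_deriv b \<delta> x"
    \<comment> \<open>The derivative of \<open>\<phi> \<circ> T\<close> in the direction \<open>b\<close>.\<close>
    define \<Psi> where "\<Psi> x = \<phi>' b (T x) + ?w (P x) *\<^sub>R \<phi>' a (T x)" for x
    have \<Psi>cont: "continuous_on UNIV \<Psi>" unfolding \<Psi>_def by (intro continuous_intros \<phi>T a b ddcont[OF bQ])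
    have wcont: "continuous_on UNIV (\<lambda>x. ?w (P x) *\<^sub>R \<phi>' a (T x))" by (intro continuous_intros \<phi>T a ddcont[OF bQ])
    have "b \<bullet> a = 0" using B a b False by (auto simp: orthonormal_inner)
    have e0: "(\<integral> x. indicator ?Half x *\<^sub>R \<Psi> x \<partial>lborel_span B) = 0"
    proof (rule integral_partial_compact_support[OF B b \<Psi>cont K', where \<phi>="\<lambda>x. \<phi> (T x)"])
      show "\<phi> (T x) = 0" "\<Psi> x = 0" if "x \<in> span B" "x \<notin> K'" for x
        using supp'[OF that] a b by (auto simp: \<Psi>_def)
      show "((\<lambda>t. \<phi> (T (x + t *\<^sub>R b))) has_vector_derivative \<Psi> (x + t *\<^sub>R b)) (at t)" for x t
      proof -
        have Pb: "P (x + t *\<^sub>R b) = P x + t *\<^sub>R b" for t unfolding P_def by (rule oproj_add_direction'[OF o bQ])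
        have Tx: "T (x + t *\<^sub>R b) = (P x + t *\<^sub>R b) + ((\<delta> \<circ> P) (x + t *\<^sub>R b) + s * (x \<bullet> a)) *\<^sub>R a" for t
          by (simp add: T_def d_def Pb inner_add_left \<open>b \<bullet> a = 0\<close>)
        have 1: "((\<lambda>t. (\<delta> \<circ> P) (x + t *\<^sub>R b)) has_vector_derivative (dir_deriv b \<delta> \<circ> P) (x + t *\<^sub>R b)) (at t)"
          by (rule C1_on_partial[OF o dC _ bQ]) simp
        have "((\<lambda>t. T (x + t *\<^sub>R b)) has_vector_derivative b + ?w (P (x + t *\<^sub>R b)) *\<^sub>R a) (at t)"
          unfolding Tx using 1
          by (auto intro!: derivative_eq_intros simp: has_real_derivative_iff_has_vector_derivative)
        from C1_on_curve[OF \<phi> this] have "((\<lambda>t. \<phi> (T (x + t *\<^sub>R b))) has_vector_derivative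
            (\<Sum>c\<in>B. ((b + ?w (P (x + t *\<^sub>R b)) *\<^sub>R a) \<bullet> c) *\<^sub>R \<phi>' c (T (x + t *\<^sub>R b)))) (at t)" by simp
        moreover have "(\<Sum>c\<in>B. ((b + k *\<^sub>R a) \<bullet> c) *\<^sub>R \<phi>' c y) = \<phi>' b y + k *\<^sub>R \<phi>' a y" for k y
        proof -
          have "(\<Sum>c\<in>B. ((b + k *\<^sub>R a) \<bullet> c) *\<^sub>R \<phi>' c y) = (\<Sum>c\<in>B. (if c = b then \<phi>' c y else 0) + (if c = a then k *\<^sub>R \<phi>' c y else 0))"
            by (rule sum.cong) (use B a b False in \<open>auto simp: inner_add_left orthonormal_inner\<close>)
          then show ?thesis using a b by (simp add: sum.distrib orthonormal_finite[OF B])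
        qed
        ultimately show ?thesis by (simp add: \<Psi>_def)
      qed
      show "x + t *\<^sub>R b \<in> ?Half \<longleftrightarrow> x \<in> ?Half" for x t by (simp add: inner_add_left \<open>b \<bullet> a = 0\<close>)
    qed (rule H0m)
    have e1: "(\<integral> x. indicator ?Half x *\<^sub>R \<Psi> x \<partial>lborel_span B) =
      (\<integral> x. indicator ?Half x *\<^sub>R \<phi>' b (T x) \<partial>lborel_span B) + (\<integral> x. indicator ?Half x *\<^sub>R (?w (P x) *\<^sub>R \<phi>' a (T x)) \<partial>lborel_span B)"
      unfolding \<Psi>_def scaleR_add_right
      by (intro Bochner_Integration.integral_add integrable_indicator_continuous[OF B H0m _ K'] \<phi>T[OF b] wcont)
         (use supp'(2) a b in auto)
    have "(\<integral> x. indicator ?Half x *\<^sub>R \<phi>' b (T x) \<partial>lborel_span B) =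
       - (\<integral> u. (- s * ?w (P u)) *\<^sub>R \<phi> (P u + \<delta> (P u) *\<^sub>R a) \<partial>lborel_span ?Q)"
      by (rule iffD2[OF eq_neg_iff_add_eq_0], rule trans[OF _ e0])
         (simp only: e1 step2[OF ddcont[OF bQ]])
    also have "\<dots> = (\<integral> u. (s * ?w (P u)) *\<^sub>R \<phi> (P u + \<delta> (P u) *\<^sub>R a) \<partial>lborel_span ?Q)"
      by (simp add: integral_minus[symmetric] del: integral_minus)
    finally show ?thesis using step1 False by simp
  qed
qed

lemma openin_span_borel:
  fixes B :: "'a::euclidean_space set"
  assumes "openin (top_of_set (span B)) G" shows "G \<in> sets borel"
proof -
  obtain T where "open T" "G = span B \<inter> T" using assms by (metis openin_open)
  then show ?thesis by (auto intro: sets.Int borel_open)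
qed

text \<open>The density of the surface measure cancels the denominator of the unit normal, which leaves the
  boundary term of \<open>divergence_over_graph\<close>.\<close>

lemma side_chart_divergence:
  fixes B :: "'a::euclidean_space set" and \<phi> :: "'a \<Rightarrow> 'b::euclidean_space"
  assumes B: "orthonormal B" and G: "openin (top_of_set (span B)) G" "bounded G" and sm: "has_smooth_boundary B G"
    and ch: "side_chart B G s a \<delta> V" and \<phi>: "C1_on B UNIV \<phi> \<phi>'" and K: "bounded K" "K \<inter> span B \<subseteq> V"
    and supp: "\<And>x. x \<in> span B \<Longrightarrow> x \<notin> K \<Longrightarrow> \<phi> x = 0" "\<And>x c. x \<in> span B \<Longrightarrow> x \<notin> K \<Longrightarrow> c \<in> B \<Longrightarrow> \<phi>' c x = 0"
    and b: "b \<in> B"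
  defines "M \<equiv> boundary_in B G"
  shows "(\<integral> x. indicator G x *\<^sub>R \<phi>' b x \<partial>lborel_span B) =
    (\<integral> y. indicator M y *\<^sub>R ((exterior_normal B G y \<bullet> b) *\<^sub>R \<phi> y) \<partial>surface_measure B M)"
proof -
  note f = side_chart_facts[OF B G(1) ch]
  let ?P = "oproj (B - {a})"
  let ?H = "{x. s * \<delta> (?P x) < s * (x \<bullet> a)}"
  have o: "orthonormal (B - {a})" by (rule orthonormal_subset[OF B Diff_subset])
  have M: "compact M" "locally_graph B M"
    unfolding M_def using compact_boundary_in[OF G] smooth_boundary_locally_graph[OF B G(1) sm] by auto
  have gch: "graph_chart B M a \<delta> V" unfolding M_def by (rule side_chart_imp_graph_chart[OF B G(1) ch])
  have \<phi>cont: "continuous_on UNIV \<phi>" by (rule C1_on_imp_continuous_on[OF \<phi>])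
  have \<phi>'cont: "continuous_on UNIV (\<phi>' b)" by (rule C1_onD(3)[OF \<phi> b])
  have [measurable]: "\<phi>' b \<in> borel_measurable borel" by (rule borel_measurable_continuous_onI[OF \<phi>'cont])
  have [measurable]: "G \<in> sets borel" by (rule openin_span_borel[OF G(1)])
  have [measurable]: "?H \<in> sets borel"
    by (intro borel_open open_Collect_less continuous_intros graph_function_continuous[OF B f(1,4)])
  have "(\<integral> x. indicator G x *\<^sub>R \<phi>' b x \<partial>lborel_span B) = (\<integral> x. indicator ?H x *\<^sub>R \<phi>' b x \<partial>lborel_span B)"
  proof (rule integral_cong_AE)
    show "AE x in lborel_span B. indicator G x *\<^sub>R \<phi>' b x = indicator ?H x *\<^sub>R \<phi>' b x"
      using AE_lborel_span
    proof eventually_elim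
      fix x assume x: "x \<in> span B"
      show "indicator G x *\<^sub>R \<phi>' b x = indicator ?H x *\<^sub>R \<phi>' b x"
      proof (cases "x \<in> V")
        case True
        then show ?thesis using side_chart_iff[OF B G(1) ch True x] by (simp add: indicator_def)
      next
        case False
        then have "\<phi>' b x = 0" using K x b by (intro supp(2)) auto
        then show ?thesis by simp
      qed
    qed
  qed measurable
  also have "\<dots> = (\<integral> u. (if b = a then - s else s * dir_deriv b \<delta> (?P u)) *\<^sub>R \<phi> (?P u + \<delta> (?P u) *\<^sub>R a) \<partial>lborel_span (B - {a}))"
    by (rule divergence_over_graph[OF B f(1,2,4) \<phi> K(1) supp b])
  also have "\<dots> = (\<integral> u. graph_density B a \<delta> (?P u) *\<^sub>R ((chart_normal B s a \<delta> (?P (?P u + \<delta> (?P u) *\<^sub>R a)) \<bullet> b) *\<^sub>R \<phi> (?P u + \<delta> (?P u) *\<^sub>R a)) \<partial>lborel_span (B - {a}))"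
  proof (rule Bochner_Integration.integral_cong[OF refl])
    fix u
    have "?P (?P u + \<delta> (?P u) *\<^sub>R a) = ?P u" by (simp add: oproj_add_direction[OF B f(1)] oproj_oproj[OF o])
    moreover have "graph_density B a \<delta> (?P u) \<noteq> 0" using graph_density_pos[of B a \<delta> "?P u"] by simp
    ultimately show "(if b = a then - s else s * dir_deriv b \<delta> (?P u)) *\<^sub>R \<phi> (?P u + \<delta> (?P u) *\<^sub>R a) =
      graph_density B a \<delta> (?P u) *\<^sub>R ((chart_normal B s a \<delta> (?P (?P u + \<delta> (?P u) *\<^sub>R a)) \<bullet> b) *\<^sub>R \<phi> (?P u + \<delta> (?P u) *\<^sub>R a))"
      using chart_normal_inner[OF B G(1) ch b, of "?P u"] by simp
  qed
  also have "\<dots> = (\<integral> y. indicator M y *\<^sub>R ((chart_normal B s a \<delta> (?P y) \<bullet> b) *\<^sub>R \<phi> y) \<partial>surface_measure B M)"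
  proof (rule surface_integral_chart[OF B M gch, symmetric])
    show "(\<lambda>y. (chart_normal B s a \<delta> (?P y) \<bullet> b) *\<^sub>R \<phi> y) \<in> borel_measurable borel"
      by (intro borel_measurable_continuous_onI continuous_intros chart_normal_continuous[OF B ch] \<phi>cont)
    show "(chart_normal B s a \<delta> (?P y) \<bullet> b) *\<^sub>R \<phi> y = 0" if "y \<in> span B" "y \<notin> V" for y
      using supp(1)[of y] K that by auto
  qed
  also have "\<dots> = (\<integral> y. indicator M y *\<^sub>R ((exterior_normal B G y \<bullet> b) *\<^sub>R \<phi> y) \<partial>surface_measure B M)"
  proof (rule Bochner_Integration.integral_cong[OF refl])
    fix y
    show "indicator M y *\<^sub>R ((chart_normal B s a \<delta> (?P y) \<bullet> b) *\<^sub>R \<phi> y) = indicator M y *\<^sub>R ((exterior_normal B G y \<bullet> b) *\<^sub>R \<phi> y)"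
    proof (cases "y \<in> M")
      case True
      have yB: "y \<in> span B" using locally_graph_subset_span[OF M(2)] True by auto
      show ?thesis
      proof (cases "y \<in> V")
        case yV: True
        then have "exterior_normal B G y = chart_normal B s a \<delta> (drop_coord a y)"
          using True unfolding M_def by (intro exterior_normal_eq_chart_normal[OF B G(1) ch]) auto
        then show ?thesis using drop_coord_eq_proj[OF B f(1) yB] by simp
      next
        case False
        then have "\<phi> y = 0" using supp(1)[OF yB] K yB by auto
        then show ?thesis by simp
      qed
    qed simp
  qed
  finally show ?thesis .
qed

section \<open>Partition of unity and the divergence theorem\<close>

lemma C1_on_bilinear:
  assumes pr: "bounded_bilinear pr" and f: "C1_on B X f f'" and g: "C1_on B X g g'"
  shows "C1_on B X (\<lambda>x. pr (f x) (g x)) (\<lambda>b x. pr (f x) (g' b x) + pr (f' b x) (g x))"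
  unfolding C1_on_def
proof (intro conjI ballI)
  interpret bounded_bilinear pr by (rule pr)
  show "open X" by (rule C1_onD(1)[OF f])
  show "continuous_on X (\<lambda>x. pr (f x) (g' b x) + pr (f' b x) (g x))" if "b \<in> B" for b
    using that by (intro continuous_intros continuous_on C1_on_imp_continuous_on[OF f] C1_on_imp_continuous_on[OF g] C1_onD(3)[OF f] C1_onD(3)[OF g])
  fix x assume x: "x \<in> X"
  show "((\<lambda>x. pr (f x) (g x)) has_derivative (\<lambda>h. \<Sum>b\<in>B. (h \<bullet> b) *\<^sub>R (pr (f x) (g' b x) + pr (f' b x) (g x)))) (at x)"
    using FDERIV[OF C1_onD(2)[OF f x] C1_onD(2)[OF g x]]
    by (simp add: sum_left sum_right scaleR_left scaleR_right sum.distrib scaleR_add_right)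
qed

lemmas C1_on_scaleR = C1_on_bilinear[OF bounded_bilinear_scaleR]

lemma C1_on_real_compose:
  fixes \<rho> :: "'a::real_inner \<Rightarrow> real" and g :: "real \<Rightarrow> real"
  assumes \<rho>: "C1_on B X \<rho> \<rho>'" and g: "\<And>t. t \<in> \<rho> ` X \<Longrightarrow> (g has_real_derivative g' t) (at t)"
    and g': "continuous_on (\<rho> ` X) g'"
  shows "C1_on B X (\<lambda>x. g (\<rho> x)) (\<lambda>b x. g' (\<rho> x) * \<rho>' b x)"
  unfolding C1_on_def
proof (intro conjI ballI)
  show "open X" by (rule C1_onD(1)[OF \<rho>])
  show "continuous_on X (\<lambda>x. g' (\<rho> x) * \<rho>' b x)" if "b \<in> B" for b
    using that by (intro continuous_intros C1_onD(3)[OF \<rho>] continuous_on_compose2[OF g' C1_on_imp_continuous_on[OF \<rho>]]) auto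
  fix x assume x: "x \<in> X"
  have "((\<lambda>x. g (\<rho> x)) has_derivative (\<lambda>h. g' (\<rho> x) * (\<Sum>b\<in>B. (h \<bullet> b) *\<^sub>R \<rho>' b x))) (at x)"
    using has_derivative_compose[OF C1_onD(2)[OF \<rho> x], of g "(*) (g' (\<rho> x))"] g[of "\<rho> x"] x
    by (simp add: has_field_derivative_def)
  then show "((\<lambda>x. g (\<rho> x)) has_derivative (\<lambda>h. \<Sum>b\<in>B. (h \<bullet> b) *\<^sub>R (g' (\<rho> x) * \<rho>' b x))) (at x)"
    by (simp add: sum_distrib_left mult.left_commute)
qed

lemma C1_on_add:
  assumes f: "C1_on B X f f'" and g: "C1_on B X g g'"
  shows "C1_on B X (\<lambda>x. f x + g x) (\<lambda>b x. f' b x + g' b x)"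
  unfolding C1_on_def
proof (intro conjI ballI)
  show "open X" by (rule C1_onD(1)[OF f])
  show "continuous_on X (\<lambda>x. f' b x + g' b x)" if "b \<in> B" for b
    using that by (intro continuous_intros C1_onD(3)[OF f] C1_onD(3)[OF g])
  show "((\<lambda>x. f x + g x) has_derivative (\<lambda>h. \<Sum>b\<in>B. (h \<bullet> b) *\<^sub>R (f' b x + g' b x))) (at x)" if "x \<in> X" for x
    using has_derivative_add[OF C1_onD(2)[OF f that] C1_onD(2)[OF g that]] by (simp add: scaleR_add_right sum.distrib)
qed

lemma C1_on_const: "open X \<Longrightarrow> C1_on B X (\<lambda>x. c) (\<lambda>b x. 0)"
  by (simp add: C1_on_def)

lemma C1_on_sum:
  assumes "finite I" "\<And>i. i \<in> I \<Longrightarrow> C1_on B X (f i) (f' i)" "open X"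
  shows "C1_on B X (\<lambda>x. \<Sum>i\<in>I. f i x) (\<lambda>b x. \<Sum>i\<in>I. f' i b x)"
  using assms
proof (induction I)
  case empty
  then show ?case by (simp add: C1_on_const)
next
  case (insert i I)
  then show ?case using C1_on_add[of B X "f i" "f' i" "\<lambda>x. \<Sum>i\<in>I. f i x" "\<lambda>b x. \<Sum>i\<in>I. f' i b x"] by simp
qed

lemma DERIV_max_0_power2: "((\<lambda>t::real. (max 0 t)\<^sup>2) has_real_derivative 2 * max 0 t) (at t)"
proof -
  consider "t > 0" | "t < 0" | "t = 0" by linarith
  then show ?thesis
  proof cases
    case 1
    have "((\<lambda>t. t\<^sup>2) has_real_derivative 2 * t) (at t)" by (auto intro!: derivative_eq_intros)
    then have "((\<lambda>t. (max 0 t)\<^sup>2) has_real_derivative 2 * t) (at t)"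
      by (rule has_field_derivative_transform_within_open[of _ _ _ "{0<..}"]) (use 1 in auto)
    then show ?thesis using 1 by simp
  next
    case 2
    have "((\<lambda>t. 0) has_real_derivative 0) (at t)" by simp
    then have "((\<lambda>t. (max 0 t)\<^sup>2) has_real_derivative 0) (at t)"
      by (rule has_field_derivative_transform_within_open[of _ _ _ "{..<0}"]) (use 2 in auto)
    then show ?thesis using 2 by simp
  next
    case 3
    have "((\<lambda>h. (max 0 h)\<^sup>2 / h) \<longlongrightarrow> 0) (at (0::real))"
    proof (rule Lim_null_comparison)
      show "\<forall>\<^sub>F h in at (0::real). norm ((max 0 h)\<^sup>2 / h) \<le> \<bar>h\<bar>"
        by (rule always_eventually) (auto simp: max_def power2_eq_square)
      show "((\<lambda>h. \<bar>h\<bar>) \<longlongrightarrow> 0) (at (0::real))" using tendsto_rabs[OF tendsto_ident_at, of 0 UNIV] by simp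
    qed
    then show ?thesis using 3 by (simp add: DERIV_def)
  qed
qed

lemma C1_on_dist_squared:
  fixes B :: "'a::euclidean_space set"
  shows "C1_on B UNIV (\<lambda>y. (norm (oproj B y - x))\<^sup>2) (\<lambda>b y. 2 * ((oproj B y - x) \<bullet> b))"
  unfolding C1_on_def
proof (intro conjI ballI)
  fix y
  have p: "((\<lambda>y. oproj B y - x) has_derivative oproj B) (at y)"
    using has_derivative_diff[OF bounded_linear_imp_has_derivative[OF bounded_linear_proj] has_derivative_const] by simp
  have "((\<lambda>y. (norm (oproj B y - x))\<^sup>2) has_derivative (\<lambda>h. (oproj B y - x) \<bullet> oproj B h + oproj B h \<bullet> (oproj B y - x))) (at y)"
    unfolding power2_norm_eq_inner by (rule has_derivative_inner[OF p p])
  moreover have "(oproj B y - x) \<bullet> oproj B h + oproj B h \<bullet> (oproj B y - x) = (\<Sum>b\<in>B. (h \<bullet> b) *\<^sub>R (2 * ((oproj B y - x) \<bullet> b)))" for h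
  proof -
    have "oproj B h \<bullet> (oproj B y - x) = (\<Sum>b\<in>B. (h \<bullet> b) * ((oproj B y - x) \<bullet> b))"
      unfolding oproj_def[of B h] inner_sum_left inner_scaleR_left by (rule sum.cong) (simp_all add: inner_commute)
    then show ?thesis by (simp add: inner_commute[of "oproj B y - x" "oproj B h"] sum_distrib_left mult_ac)
  qed
  ultimately show "((\<lambda>y. (norm (oproj B y - x))\<^sup>2) has_derivative (\<lambda>h. \<Sum>b\<in>B. (h \<bullet> b) *\<^sub>R (2 * ((oproj B y - x) \<bullet> b)))) (at y)" by simp
qed (auto intro!: continuous_intros)

definition bump :: "'a::real_inner set \<Rightarrow> real \<Rightarrow> 'a \<Rightarrow> 'a \<Rightarrow> real" where
  "bump B r x y = (max 0 (r\<^sup>2 - (norm (oproj B y - x))\<^sup>2))\<^sup>2"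

definition bump' :: "'a::real_inner set \<Rightarrow> real \<Rightarrow> 'a \<Rightarrow> 'a \<Rightarrow> 'a \<Rightarrow> real" where
  "bump' B r x b y = 2 * max 0 (r\<^sup>2 - (norm (oproj B y - x))\<^sup>2) * (- 2 * ((oproj B y - x) \<bullet> b))"

lemma C1_on_bump:
  fixes B :: "'a::euclidean_space set"
  shows "C1_on B UNIV (bump B r x) (bump' B r x)"
proof -
  have "C1_on B UNIV (\<lambda>y. (max 0 (r\<^sup>2 - (norm (oproj B y - x))\<^sup>2))\<^sup>2)
     (\<lambda>b y. (- (2 * max 0 (r\<^sup>2 - (norm (oproj B y - x))\<^sup>2))) * (2 * ((oproj B y - x) \<bullet> b)))"
  proof (rule C1_on_real_compose[OF C1_on_dist_squared, of _ _ "\<lambda>t. (max 0 (r\<^sup>2 - t))\<^sup>2" "\<lambda>t. - (2 * max 0 (r\<^sup>2 - t))"])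
    show "((\<lambda>t. (max 0 (r\<^sup>2 - t))\<^sup>2) has_real_derivative - (2 * max 0 (r\<^sup>2 - t))) (at t)" for t
    proof -
      have "((\<lambda>t. r\<^sup>2 - t) has_real_derivative - 1) (at t)" by (auto intro!: derivative_eq_intros)
      from DERIV_chain2[OF DERIV_max_0_power2 this] show ?thesis by simp
    qed
  qed (intro continuous_intros)
  then show ?thesis unfolding bump_def[abs_def] bump'_def[abs_def] by simp
qed

lemma bump_outside: "norm (oproj B y - x) \<ge> r \<Longrightarrow> r \<ge> 0 \<Longrightarrow> bump B r x y = 0 \<and> bump' B r x b y = 0"
  using power_mono[of r "norm (oproj B y - x)" 2] by (simp add: bump_def bump'_def max_def)

lemma bump_pos: "norm (oproj B y - x) < r \<Longrightarrow> bump B r x y > 0"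
  using power_strict_mono[of "norm (oproj B y - x)" r 2] by (simp add: bump_def max_def)

text \<open>Dividing bump functions by their sum \<open>\<theta>\<close> would leave the quotients undefined where \<open>\<theta> = 0\<close>.
  With \<open>c\<close> a positive lower bound of \<open>\<theta>\<close> on \<open>C\<close>, the function \<open>\<theta> + (max 0 (c - \<theta>))\<^sup>2\<close> is positive
  everywhere and agrees with \<open>\<theta>\<close> to first order on \<open>C\<close>.\<close>

lemma C1_partition_of_unity:
  fixes B :: "'a::euclidean_space set"
  assumes B: "orthonormal B" and C: "compact C" "C \<subseteq> span B" and r: "\<And>x. x \<in> C \<Longrightarrow> r x > (0::real)"
  obtains I \<rho> \<rho>' where "finite I" "I \<subseteq> C" "\<And>i. i \<in> I \<Longrightarrow> C1_on B UNIV (\<rho> i) (\<rho>' i)"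
    "\<And>i y b. i \<in> I \<Longrightarrow> norm (oproj B y - i) \<ge> r i \<Longrightarrow> \<rho> i y = (0::real) \<and> \<rho>' i b y = 0"
    "\<And>y. y \<in> C \<Longrightarrow> (\<Sum>i\<in>I. \<rho> i y) = 1" "\<And>y b. y \<in> C \<Longrightarrow> b \<in> B \<Longrightarrow> (\<Sum>i\<in>I. \<rho>' i b y) = 0"
proof (cases "C = {}")
  case True
  then show ?thesis by (intro that[of "{}" "\<lambda>_ _. 0" "\<lambda>_ _ _. 0"]) auto
next
  case False
  obtain I where I: "I \<subseteq> C" "finite I" "C \<subseteq> (\<Union>x\<in>I. ball x (r x))"
  proof (rule compactE_image[OF C(1), of C "\<lambda>x. ball x (r x)"])
    show "C \<subseteq> (\<Union>x\<in>C. ball x (r x))" using r by force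
  qed auto
  define \<beta> where "\<beta> i = bump B (r i) i" for i
  define \<beta>' where "\<beta>' i = bump' B (r i) i" for i
  define \<theta> where "\<theta> y = (\<Sum>i\<in>I. \<beta> i y)" for y
  define \<theta>' where "\<theta>' b y = (\<Sum>i\<in>I. \<beta>' i b y)" for b y
  have \<beta>C: "C1_on B UNIV (\<beta> i) (\<beta>' i)" for i unfolding \<beta>_def \<beta>'_def by (rule C1_on_bump)
  have \<theta>C: "C1_on B UNIV \<theta> \<theta>'" unfolding \<theta>_def[abs_def] \<theta>'_def[abs_def] by (rule C1_on_sum) (use I \<beta>C in auto)
  have \<theta>cont: "continuous_on UNIV \<theta>" by (rule C1_on_imp_continuous_on[OF \<theta>C])
  have \<beta>0: "\<beta> i y \<ge> 0" for i y by (simp add: \<beta>_def bump_def)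
  have \<theta>0: "\<theta> y \<ge> 0" for y unfolding \<theta>_def by (intro sum_nonneg \<beta>0)
  have \<theta>pos: "\<theta> y > 0" if y: "y \<in> C" for y
  proof -
    obtain i where i: "i \<in> I" "y \<in> ball i (r i)" using I(3) y by auto
    have "oproj B y = y" using C(2) y by (intro proj_ident[OF B]) auto
    then have "\<beta> i y > 0" using i unfolding \<beta>_def by (intro bump_pos) (auto simp: dist_norm norm_minus_commute)
    then show ?thesis unfolding \<theta>_def using i \<beta>0 I(2) by (intro sum_pos2[of I i]) auto
  qed
  obtain c where c: "c > 0" "\<And>y. y \<in> C \<Longrightarrow> c \<le> \<theta> y"
  proof -
    obtain y0 where "y0 \<in> C" "\<And>y. y \<in> C \<Longrightarrow> \<theta> y0 \<le> \<theta> y"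
      using continuous_attains_inf[OF C(1) False continuous_on_subset[OF \<theta>cont]] by auto
    then show ?thesis using that[of "\<theta> y0"] \<theta>pos by auto
  qed
  define g where "g t = inverse (t + (max 0 (c - t))\<^sup>2)" for t :: real
  define g' where "g' t = - (1 - 2 * max 0 (c - t)) * (g t)\<^sup>2" for t :: real
  have den: "t + (max 0 (c - t))\<^sup>2 > 0" if "t \<ge> 0" for t
    using that c(1) by (cases "t = 0") (auto simp: max_def add_pos_nonneg)
  have gder: "(g has_real_derivative g' t) (at t)" if t: "t \<ge> 0" for t
  proof -
    have "((\<lambda>t. t + (max 0 (c - t))\<^sup>2) has_real_derivative 1 + (2 * max 0 (c - t)) * (- 1)) (at t)"
      by (intro derivative_intros DERIV_chain2[OF DERIV_max_0_power2]) (auto intro!: derivative_eq_intros)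
    from DERIV_inverse'[OF this] den[OF t] show ?thesis
      by (simp add: g_def[abs_def] g'_def power2_eq_square algebra_simps)
  qed
  have gcont: "continuous_on {0..} g" unfolding g_def by (intro continuous_intros) (use den in fastforce)
  have g'cont: "continuous_on {0..} g'" unfolding g'_def by (intro continuous_intros gcont)
  have G: "C1_on B UNIV (\<lambda>x. g (\<theta> x)) (\<lambda>b x. g' (\<theta> x) * \<theta>' b x)"
    by (rule C1_on_real_compose[OF \<theta>C]) (use \<theta>0 gder in \<open>auto intro: continuous_on_subset[OF g'cont]\<close>)
  define \<rho> where "\<rho> i y = g (\<theta> y) *\<^sub>R \<beta> i y" for i y
  define \<rho>' where "\<rho>' i b y = g (\<theta> y) *\<^sub>R \<beta>' i b y + (g' (\<theta> y) * \<theta>' b y) *\<^sub>R \<beta> i y" for i b y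
  show ?thesis
  proof (rule that[of I \<rho> \<rho>', OF I(2,1)])
    show "C1_on B UNIV (\<rho> i) (\<rho>' i)" for i
      unfolding \<rho>_def[abs_def] \<rho>'_def[abs_def] by (rule C1_on_scaleR[OF G \<beta>C])
    show "\<rho> i y = 0 \<and> \<rho>' i b y = 0" if "i \<in> I" "norm (oproj B y - i) \<ge> r i" for i y b
      using bump_outside[of "r i" B y i b] that r[of i] I(1) by (auto simp: \<rho>_def \<rho>'_def \<beta>_def \<beta>'_def)
    fix y assume y: "y \<in> C"
    have gy: "g (\<theta> y) = inverse (\<theta> y)" "g' (\<theta> y) = - (inverse (\<theta> y))\<^sup>2"
      using c(2)[OF y] by (auto simp: g_def g'_def)
    show "(\<Sum>i\<in>I. \<rho> i y) = 1" using \<theta>pos[OF y] gy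
      by (simp add: \<rho>_def sum_distrib_left[symmetric] \<theta>_def[symmetric])
    show "(\<Sum>i\<in>I. \<rho>' i b y) = 0" if "b \<in> B" for b
    proof -
      have "(\<Sum>i\<in>I. \<rho>' i b y) = g (\<theta> y) * \<theta>' b y + (g' (\<theta> y) * \<theta>' b y) * \<theta> y"
        by (simp add: \<rho>'_def sum.distrib sum_distrib_left[symmetric] \<theta>_def[symmetric] \<theta>'_def[symmetric])
      then show ?thesis using \<theta>pos[OF y] gy by (simp add: power2_eq_square)
    qed
  qed
qed

lemma integrable_on_surface:
  fixes M :: "'a::euclidean_space set" and f :: "'a \<Rightarrow> 'b::euclidean_space"
  assumes B: "orthonormal B" and M: "compact M" "locally_graph B M" and f: "continuous_on M f"
  shows "integrable (surface_measure B M) (\<lambda>y. indicator M y *\<^sub>R f y)"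
proof -
  let ?S = "surface_measure B M"
  have sS: "sets ?S = sets borel"
    using is_surface_measure_surface_measure[OF B M] by (simp add: is_surface_measure_def)
  interpret finite_measure ?S
    using emeasure_surface_measure_finite[OF B M] sets_eq_imp_space_eq[OF sS]
    by (intro finite_measureI) auto
  have "bounded (f ` M)" using compact_continuous_image[OF f M(1)] by (rule compact_imp_bounded)
  then obtain C where C: "\<And>y. y \<in> M \<Longrightarrow> norm (f y) \<le> C" unfolding bounded_iff by blast
  show ?thesis
  proof (rule integrable_const_bound[of _ "max C 0"])
    show "AE y in ?S. norm (indicator M y *\<^sub>R f y) \<le> max C 0"
      using C by (intro AE_I2) (auto simp: indicator_def le_max_iff_disj)
    have "(\<lambda>y. indicator M y *\<^sub>R f y) \<in> borel_measurable borel"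
      using f M(1) by (intro borel_measurable_continuous_on_indicator) (auto intro: borel_closed compact_imp_closed)
    then show "(\<lambda>y. indicator M y *\<^sub>R f y) \<in> borel_measurable ?S" by (simp cong: measurable_cong_sets add: sS)
  qed
qed

lemma C1_on_extend_by_zero:
  fixes B :: "'a::euclidean_space set" and \<phi> :: "'a \<Rightarrow> 'b::euclidean_space"
  assumes \<phi>: "C1_on B W \<phi> \<phi>'" and O: "open O'" and cov: "W \<union> O' = UNIV"
    and z: "\<And>y. y \<in> O' \<Longrightarrow> y \<in> W \<Longrightarrow> \<phi> y = 0" "\<And>y b. y \<in> O' \<Longrightarrow> y \<in> W \<Longrightarrow> b \<in> B \<Longrightarrow> \<phi>' b y = 0"
  shows "C1_on B UNIV (\<lambda>y. if y \<in> W then \<phi> y else 0) (\<lambda>b y. if y \<in> W then \<phi>' b y else 0)"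
  unfolding C1_on_def
proof (intro conjI ballI)
  have W: "open W" by (rule C1_onD(1)[OF \<phi>])
  let ?\<psi> = "\<lambda>y. if y \<in> W then \<phi> y else 0"
  fix y
  show "(?\<psi> has_derivative (\<lambda>h. \<Sum>b\<in>B. (h \<bullet> b) *\<^sub>R (if y \<in> W then \<phi>' b y else 0))) (at y)"
  proof (cases "y \<in> W")
    case True
    have "(?\<psi> has_derivative (\<lambda>h. \<Sum>b\<in>B. (h \<bullet> b) *\<^sub>R \<phi>' b y)) (at y)"
      by (rule has_derivative_transform_within_open[OF C1_onD(2)[OF \<phi> True] W True]) simp
    then show ?thesis using True by simp
  next
    case False
    then have y: "y \<in> O'" using cov by auto
    have "((\<lambda>_. 0) has_derivative (\<lambda>_. 0)) (at y)" by simp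
    then have "(?\<psi> has_derivative (\<lambda>_. 0)) (at y)"
      by (rule has_derivative_transform_within_open[OF _ O y]) (use z in auto)
    then show ?thesis using False by simp
  qed
next
  fix b assume b: "b \<in> B"
  have W: "open W" by (rule C1_onD(1)[OF \<phi>])
  have "continuous_on W (\<lambda>y. if y \<in> W then \<phi>' b y else 0)"
    using C1_onD(3)[OF \<phi> b] by (simp cong: continuous_on_cong)
  moreover have "continuous_on O' (\<lambda>y. if y \<in> W then \<phi>' b y else 0)"
  proof -
    have "(if y \<in> W then \<phi>' b y else 0) = 0" if "y \<in> O'" for y using z(2)[OF that _ b] by simp
    then show ?thesis by (simp cong: continuous_on_cong)
  qed
  ultimately have "continuous_on (W \<union> O') (\<lambda>y. if y \<in> W then \<phi>' b y else 0)"
    by (intro continuous_on_open_Un W O)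
  then show "continuous_on UNIV (\<lambda>y. if y \<in> W then \<phi>' b y else 0)" using cov by simp
qed simp

text \<open>The Gauss--Green formula for one partial derivative.  A partition of unity cuts \<open>\<phi>\<close> into pieces
  supported either inside \<open>G\<close>, where both sides vanish, or inside one boundary chart.\<close>

theorem divergence_theorem:
  fixes B :: "'a::euclidean_space set" and \<phi> :: "'a \<Rightarrow> 'b::euclidean_space"
  assumes B: "orthonormal B" and G: "openin (top_of_set (span B)) G" "bounded G" and sm: "has_smooth_boundary B G"
    and X: "openin (top_of_set (span B)) X" "closure G \<subseteq> X" and \<phi>: "C1_on B (oproj B -` X) \<phi> \<phi>'" and b: "b \<in> B"
  defines "M \<equiv> boundary_in B G"
  shows "(\<integral> x. indicator G x *\<^sub>R \<phi>' b x \<partial>lborel_span B) =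
    (\<integral> y. indicator M y *\<^sub>R ((exterior_normal B G y \<bullet> b) *\<^sub>R \<phi> y) \<partial>surface_measure B M)"
proof -
  let ?W = "oproj B -` X" and ?S = "surface_measure B M" and ?n = "exterior_normal B G"
  have W: "open ?W" by (rule C1_onD(1)[OF \<phi>])
  have GB: "G \<subseteq> span B" using openin_imp_subset[OF G(1)] .
  have XB: "X \<subseteq> span B" using openin_imp_subset[OF X(1)] .
  have Gm: "G \<in> sets borel" by (rule openin_span_borel[OF G(1)])
  have M: "compact M" "locally_graph B M"
    unfolding M_def using compact_boundary_in[OF G] smooth_boundary_locally_graph[OF B G(1) sm] by auto
  have Meq: "M = closure G - G" unfolding M_def by (rule boundary_in_eq[OF G(1)])
  have cC: "compact (closure G)" using G(2) by simp
  have cB: "closure G \<subseteq> span B" using X(2) XB by auto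
  let ?good = "\<lambda>x r. r > 0 \<and> cball x r \<inter> span B \<subseteq> X \<and>
     (cball x r \<inter> span B \<subseteq> G \<or> (\<exists>s a \<delta> V. side_chart B G s a \<delta> V \<and> cball x r \<subseteq> V))"
  have "\<exists>r. ?good x r" if x: "x \<in> closure G" for x
  proof -
    have shrink: "\<exists>r>0. cball x r \<inter> span B \<subseteq> Y" if "openin (top_of_set (span B)) Y" "x \<in> Y" for Y
    proof -
      obtain T where "open T" "Y = span B \<inter> T" using \<open>openin _ Y\<close> by (metis openin_open)
      moreover then obtain r where "r > 0" "cball x r \<subseteq> T" using \<open>x \<in> Y\<close> open_contains_cball[of T] by auto
      ultimately show ?thesis by (intro exI[of _ r]) auto
    qed
    obtain r1 where r1: "r1 > 0" "cball x r1 \<inter> span B \<subseteq> X" using shrink[OF X(1)] x X(2) by auto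
    show ?thesis
    proof (cases "x \<in> G")
      case True
      then obtain r2 where r2: "r2 > 0" "cball x r2 \<inter> span B \<subseteq> G" using shrink[OF G(1)] by auto
      have sub: "cball x (min r1 r2) \<subseteq> cball x r1" "cball x (min r1 r2) \<subseteq> cball x r2" by (auto simp: subset_eq)
      have "?good x (min r1 r2)" using r1 r2 sub by (intro conjI disjI1) (auto simp: min_def)
      then show ?thesis by blast
    next
      case False
      then have "x \<in> boundary_in B G" using x Meq M_def by auto
      then obtain s a \<delta> V where ch: "side_chart B G s a \<delta> V" "x \<in> V" by (rule smooth_boundary_side_chart[OF sm])
      then obtain r2 where r2: "r2 > 0" "cball x r2 \<subseteq> V"
        using side_chart_facts(5)[OF B G(1) ch(1)] open_contains_cball by metis
      have sub: "cball x (min r1 r2) \<subseteq> cball x r1" "cball x (min r1 r2) \<subseteq> cball x r2" by (auto simp: subset_eq)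
      have "?good x (min r1 r2)"
      proof (intro conjI disjI2 exI)
        show "side_chart B G s a \<delta> V" by (rule ch)
      qed (use r1 r2 sub in auto)
      then show ?thesis by blast
    qed
  qed
  then obtain r where r: "\<And>x. x \<in> closure G \<Longrightarrow> ?good x (r x)" by metis
  have r0: "\<And>x. x \<in> closure G \<Longrightarrow> r x > 0" using r by blast
  show ?thesis
  proof (rule C1_partition_of_unity[where r=r, OF B cC cB r0])
    fix I and \<rho> :: "'a \<Rightarrow> 'a \<Rightarrow> real" and \<rho>' :: "'a \<Rightarrow> 'a \<Rightarrow> 'a \<Rightarrow> real"
    assume I: "finite I" "I \<subseteq> closure G" and \<rho>C: "\<And>i. i \<in> I \<Longrightarrow> C1_on B UNIV (\<rho> i) (\<rho>' i)"
    and \<rho>0: "\<And>i y b. i \<in> I \<Longrightarrow> r i \<le> norm (oproj B y - i) \<Longrightarrow> \<rho> i y = 0 \<and> \<rho>' i b y = 0"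
    and \<rho>1: "\<And>y. y \<in> closure G \<Longrightarrow> (\<Sum>i\<in>I. \<rho> i y) = 1"
    and \<rho>'1: "\<And>y b. y \<in> closure G \<Longrightarrow> b \<in> B \<Longrightarrow> (\<Sum>i\<in>I. \<rho>' i b y) = 0"
    define \<psi> where "\<psi> i y = (if y \<in> ?W then \<rho> i y *\<^sub>R \<phi> y else 0)" for i y
    define \<psi>' where "\<psi>' i c y = (if y \<in> ?W then \<rho> i y *\<^sub>R \<phi>' c y + \<rho>' i c y *\<^sub>R \<phi> y else 0)" for i c y
    have \<psi>C: "C1_on B UNIV (\<psi> i) (\<psi>' i)" if i: "i \<in> I" for i
      unfolding \<psi>_def[abs_def] \<psi>'_def[abs_def]
    proof (rule C1_on_extend_by_zero[where O' = "{y. r i < norm (oproj B y - i)}"])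
      show "C1_on B ?W (\<lambda>y. \<rho> i y *\<^sub>R \<phi> y) (\<lambda>c y. \<rho> i y *\<^sub>R \<phi>' c y + \<rho>' i c y *\<^sub>R \<phi> y)"
        by (rule C1_on_scaleR[OF C1_on_subset[OF \<rho>C[OF i] W] \<phi>]) simp
      show "open {y. r i < norm (oproj B y - i)}" by (intro open_Collect_less continuous_intros)
      show "?W \<union> {y. r i < norm (oproj B y - i)} = UNIV"
      proof -
        have "y \<in> ?W" if "\<not> r i < norm (oproj B y - i)" for y
          proof -
            have "oproj B y \<in> cball i (r i) \<inter> span B"
              using that proj_in_span[of B y] by (simp add: dist_norm norm_minus_commute)
            then show ?thesis using r[of i] I(2) i by blast
          qed
        then show ?thesis by blast
      qed
    qed (use \<rho>0[OF i] in auto)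
    have out: "\<psi> i y = 0" "\<psi>' i c y = 0" if "i \<in> I" "y \<in> span B" "y \<notin> cball i (r i)" for i c y
    proof -
      have "norm (oproj B y - i) \<ge> r i" using that by (simp add: proj_ident[OF B] dist_norm norm_minus_commute)
      then show "\<psi> i y = 0" "\<psi>' i c y = 0" using \<rho>0[OF that(1)] by (auto simp: \<psi>_def \<psi>'_def)
    qed
    have piece: "(\<integral> x. indicator G x *\<^sub>R \<psi>' i b x \<partial>lborel_span B) = (\<integral> y. indicator M y *\<^sub>R ((?n y \<bullet> b) *\<^sub>R \<psi> i y) \<partial>?S)"
      if i: "i \<in> I" for i
    proof (cases "\<exists>s a \<delta> V. side_chart B G s a \<delta> V \<and> cball i (r i) \<subseteq> V")
      case True
      then obtain s a \<delta> V where ch: "side_chart B G s a \<delta> V" and V: "cball i (r i) \<subseteq> V" by blast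
      show ?thesis unfolding M_def
        by (rule side_chart_divergence[OF B G sm ch \<psi>C[OF i] bounded_cball[of i "r i"] _ _ _ b]) (use V out[OF i] in auto)
    next
      case False
      then have sub: "cball i (r i) \<inter> span B \<subseteq> G" using r[of i] subsetD[OF I(2) i] by blast
      have "(\<integral> x. indicator UNIV x *\<^sub>R \<psi>' i b x \<partial>lborel_span B) = 0"
        by (rule integral_partial_compact_support[OF B b C1_onD(3)[OF \<psi>C[OF i] b] bounded_cball[of i "r i"] out[OF i]])
           (use C1_on_partial[OF B \<psi>C[OF i] _ b] in auto)
      moreover have "(\<integral> x. indicator G x *\<^sub>R \<psi>' i b x \<partial>lborel_span B) = (\<integral> x. indicator UNIV x *\<^sub>R \<psi>' i b x \<partial>lborel_span B)"
      proof (rule integral_cong_AE)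
        have [measurable]: "\<psi>' i b \<in> borel_measurable borel"
          by (rule borel_measurable_continuous_onI[OF C1_onD(3)[OF \<psi>C[OF i] b]])
        note [measurable] = Gm
        show "(\<lambda>x. indicator G x *\<^sub>R \<psi>' i b x) \<in> borel_measurable (lborel_span B)"
          "(\<lambda>x. indicator UNIV x *\<^sub>R \<psi>' i b x) \<in> borel_measurable (lborel_span B)" by measurable
        show "AE x in lborel_span B. indicator G x *\<^sub>R \<psi>' i b x = indicator UNIV x *\<^sub>R \<psi>' i b x"
          using AE_lborel_span
        proof eventually_elim
          fix x assume "x \<in> span B"
          then show "indicator G x *\<^sub>R \<psi>' i b x = indicator UNIV x *\<^sub>R \<psi>' i b x"
            using out(2)[OF i, of x b] subsetD[OF sub, of x] by (cases "x \<in> G") auto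
        qed
      qed
      moreover have zero: "indicator M y *\<^sub>R ((?n y \<bullet> b) *\<^sub>R \<psi> i y) = 0" for y
      proof (cases "y \<in> M")
        case True
        then have "y \<in> span B" "y \<notin> cball i (r i)" using Meq cB sub by auto
        then show ?thesis using out(1)[OF i] by simp
      qed simp
      moreover have "(\<integral> y. indicator M y *\<^sub>R ((?n y \<bullet> b) *\<^sub>R \<psi> i y) \<partial>?S) = 0"
        unfolding zero by simp
      ultimately show ?thesis by (simp only: indicator_UNIV scaleR_one)
    qed
    have cl: "y \<in> ?W" if "y \<in> closure G" for y
      using subsetD[OF X(2) that] proj_ident[OF B subsetD[OF cB that]] by simp
    have "(\<integral> x. indicator G x *\<^sub>R \<phi>' b x \<partial>lborel_span B) = (\<integral> x. (\<Sum>i\<in>I. indicator G x *\<^sub>R \<psi>' i b x) \<partial>lborel_span B)"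
    proof (rule Bochner_Integration.integral_cong[OF refl])
      fix x
      show "indicator G x *\<^sub>R \<phi>' b x = (\<Sum>i\<in>I. indicator G x *\<^sub>R \<psi>' i b x)"
      proof (cases "x \<in> G")
        case True
        then have x: "x \<in> closure G" using closure_subset by auto
        have "(\<Sum>i\<in>I. \<psi>' i b x) = (\<Sum>i\<in>I. \<rho> i x) *\<^sub>R \<phi>' b x + (\<Sum>i\<in>I. \<rho>' i b x) *\<^sub>R \<phi> x"
          using cl[OF x] by (simp add: \<psi>'_def sum.distrib scaleR_sum_left)
        then show ?thesis using True \<rho>1[OF x] \<rho>'1[OF x b] by simp
      qed simp
    qed
    also have "\<dots> = (\<Sum>i\<in>I. \<integral> x. indicator G x *\<^sub>R \<psi>' i b x \<partial>lborel_span B)"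
    proof (rule Bochner_Integration.integral_sum)
      fix i assume i: "i \<in> I"
      show "integrable (lborel_span B) (\<lambda>x. indicator G x *\<^sub>R \<psi>' i b x)"
        by (rule integrable_indicator_continuous[OF B Gm C1_onD(3)[OF \<psi>C[OF i] b] bounded_cball[of i "r i"] out(2)[OF i]])
    qed
    also have "\<dots> = (\<Sum>i\<in>I. \<integral> y. indicator M y *\<^sub>R ((?n y \<bullet> b) *\<^sub>R \<psi> i y) \<partial>?S)"
      by (rule sum.cong[OF refl piece])
    also have "\<dots> = (\<integral> y. (\<Sum>i\<in>I. indicator M y *\<^sub>R ((?n y \<bullet> b) *\<^sub>R \<psi> i y)) \<partial>?S)"
    proof (rule Bochner_Integration.integral_sum[symmetric])
      fix i assume i: "i \<in> I"
      have "continuous_on M ?n" unfolding M_def by (rule exterior_normal_properties(1)[OF B G(1) sm])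
      then show "integrable ?S (\<lambda>y. indicator M y *\<^sub>R ((?n y \<bullet> b) *\<^sub>R \<psi> i y))"
        by (intro integrable_on_surface[OF B M] continuous_intros continuous_on_subset[OF C1_on_imp_continuous_on[OF \<psi>C[OF i]]]) auto
    qed
    also have "\<dots> = (\<integral> y. indicator M y *\<^sub>R ((?n y \<bullet> b) *\<^sub>R \<phi> y) \<partial>?S)"
    proof (rule Bochner_Integration.integral_cong[OF refl])
      fix y
      show "(\<Sum>i\<in>I. indicator M y *\<^sub>R ((?n y \<bullet> b) *\<^sub>R \<psi> i y)) = indicator M y *\<^sub>R ((?n y \<bullet> b) *\<^sub>R \<phi> y)"
      proof (cases "y \<in> M")
        case True
        then have y: "y \<in> closure G" using Meq by auto
        have "(\<Sum>i\<in>I. (?n y \<bullet> b) *\<^sub>R \<psi> i y) = (?n y \<bullet> b) *\<^sub>R ((\<Sum>i\<in>I. \<rho> i y) *\<^sub>R \<phi> y)"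
          using cl[OF y] by (simp add: \<psi>_def scaleR_sum_right scaleR_sum_left)
        then show ?thesis using True \<rho>1[OF y] by simp
      qed simp
    qed
  finally show ?thesis .
  qed
qed

section \<open>Octonion multiplication\<close>

lemma sum_0_7: "(\<Sum>i=0..7. f i) = f 0 + f 1 + f 2 + f 3 + f 4 + f 5 + f 6 + f (7::nat)" for f :: "nat \<Rightarrow> 'a::comm_monoid_add"
  by (simp add: eval_nat_numeral add.assoc)

lemma sum_1_7: "(\<Sum>i=1..7. f i) = f 1 + f 2 + f 3 + f 4 + f 5 + f 6 + f (7::nat)" for f :: "nat \<Rightarrow> 'a::comm_monoid_add"
  by (simp add: eval_nat_numeral add.assoc)

lemma inj_of_nat_8: "inj_on (of_nat :: nat \<Rightarrow> 8) {0..7}"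
  by (auto simp: inj_on_def eval_nat_numeral le_Suc_eq)

lemma UNIV_8: "(UNIV :: 8 set) = {0, 1, 2, 3, 4, 5, 6, 7}"
  by (rule card_subset_eq[symmetric]) simp_all

lemma octonion_eq_iff: "x = y \<longleftrightarrow> x$0 = y$0 \<and> x$1 = y$1 \<and> x$2 = y$2 \<and> x$3 = y$3 \<and> x$4 = y$4 \<and> x$5 = y$5 \<and> x$6 = y$6 \<and> x$7 = y$7"
  for x y :: octonion
proof -
  have "x = y \<longleftrightarrow> (\<forall>i\<in>{0, 1, 2, 3, 4, 5, 6, 7}. x $ i = y $ i)"
    unfolding vec_eq_iff UNIV_8[symmetric] by simp
  then show ?thesis by simp
qed

lemma oe_mult_table:
  shows "oe_mult 0 0 = oe 0"
    "oe_mult 0 1 = oe 1"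
    "oe_mult 0 2 = oe 2"
    "oe_mult 0 3 = oe 3"
    "oe_mult 0 4 = oe 4"
    "oe_mult 0 5 = oe 5"
    "oe_mult 0 6 = oe 6"
    "oe_mult 0 7 = oe 7"
    "oe_mult 1 0 = oe 1"
    "oe_mult 1 1 = - oe 0"
    "oe_mult 1 2 = oe 3"
    "oe_mult 1 3 = - oe 2"
    "oe_mult 1 4 = oe 5"
    "oe_mult 1 5 = - oe 4"
    "oe_mult 1 6 = - oe 7"
    "oe_mult 1 7 = oe 6"
    "oe_mult 2 0 = oe 2"
    "oe_mult 2 1 = - oe 3"
    "oe_mult 2 2 = - oe 0"
    "oe_mult 2 3 = oe 1"
    "oe_mult 2 4 = oe 6"
    "oe_mult 2 5 = oe 7"
    "oe_mult 2 6 = - oe 4"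
    "oe_mult 2 7 = - oe 5"
    "oe_mult 3 0 = oe 3"
    "oe_mult 3 1 = oe 2"
    "oe_mult 3 2 = - oe 1"
    "oe_mult 3 3 = - oe 0"
    "oe_mult 3 4 = oe 7"
    "oe_mult 3 5 = - oe 6"
    "oe_mult 3 6 = oe 5"
    "oe_mult 3 7 = - oe 4"
    "oe_mult 4 0 = oe 4"
    "oe_mult 4 1 = - oe 5"
    "oe_mult 4 2 = - oe 6"
    "oe_mult 4 3 = - oe 7"
    "oe_mult 4 4 = - oe 0"
    "oe_mult 4 5 = oe 1"
    "oe_mult 4 6 = oe 2"
    "oe_mult 4 7 = oe 3"
    "oe_mult 5 0 = oe 5"
    "oe_mult 5 1 = oe 4"
    "oe_mult 5 2 = - oe 7"
    "oe_mult 5 3 = oe 6"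
    "oe_mult 5 4 = - oe 1"
    "oe_mult 5 5 = - oe 0"
    "oe_mult 5 6 = - oe 3"
    "oe_mult 5 7 = oe 2"
    "oe_mult 6 0 = oe 6"
    "oe_mult 6 1 = oe 7"
    "oe_mult 6 2 = oe 4"
    "oe_mult 6 3 = - oe 5"
    "oe_mult 6 4 = - oe 2"
    "oe_mult 6 5 = oe 3"
    "oe_mult 6 6 = - oe 0"
    "oe_mult 6 7 = - oe 1"
    "oe_mult 7 0 = oe 7"
    "oe_mult 7 1 = - oe 6"
    "oe_mult 7 2 = oe 5"
    "oe_mult 7 3 = oe 4"
    "oe_mult 7 4 = - oe 3"
    "oe_mult 7 5 = - oe 2"
    "oe_mult 7 6 = oe 1"
    "oe_mult 7 7 = - oe 0"
  by (simp_all add: oe_mult_def sum_1_7 oct_eps_def cyclic_oct_triple_def oct_triples_def del: One_nat_def)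

text \<open>In components, identities between octonions become identities between real polynomials.\<close>

lemma oct_mult_components:
  shows "(x \<odot> y) $ 0 = x$0 * y$0 - x$1 * y$1 - x$2 * y$2 - x$3 * y$3 - x$4 * y$4 - x$5 * y$5 - x$6 * y$6 - x$7 * y$7"
    "(x \<odot> y) $ 1 = x$0 * y$1 + x$1 * y$0 + x$2 * y$3 + x$4 * y$5 + x$7 * y$6 - x$3 * y$2 - x$5 * y$4 - x$6 * y$7"
    "(x \<odot> y) $ 2 = x$0 * y$2 + x$2 * y$0 + x$3 * y$1 + x$4 * y$6 + x$5 * y$7 - x$1 * y$3 - x$6 * y$4 - x$7 * y$5"
    "(x \<odot> y) $ 3 = x$0 * y$3 + x$1 * y$2 + x$3 * y$0 + x$4 * y$7 + x$6 * y$5 - x$2 * y$1 - x$5 * y$6 - x$7 * y$4"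
    "(x \<odot> y) $ 4 = x$0 * y$4 + x$4 * y$0 + x$5 * y$1 + x$6 * y$2 + x$7 * y$3 - x$1 * y$5 - x$2 * y$6 - x$3 * y$7"
    "(x \<odot> y) $ 5 = x$0 * y$5 + x$1 * y$4 + x$3 * y$6 + x$5 * y$0 + x$7 * y$2 - x$2 * y$7 - x$4 * y$1 - x$6 * y$3"
    "(x \<odot> y) $ 6 = x$0 * y$6 + x$1 * y$7 + x$2 * y$4 + x$5 * y$3 + x$6 * y$0 - x$3 * y$5 - x$4 * y$2 - x$7 * y$1"
    "(x \<odot> y) $ 7 = x$0 * y$7 + x$2 * y$5 + x$3 * y$4 + x$6 * y$1 + x$7 * y$0 - x$1 * y$6 - x$4 * y$3 - x$5 * y$2"
  by (simp_all add: oct_mult_def sum_0_7 oe_mult_table oe_def axis_def del: One_nat_def)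

lemma oct_conj_components:
  "oct_conj x $ 0 = x $ 0" "oct_conj x $ 1 = - x $ 1" "oct_conj x $ 2 = - x $ 2" "oct_conj x $ 3 = - x $ 3"
  "oct_conj x $ 4 = - x $ 4" "oct_conj x $ 5 = - x $ 5" "oct_conj x $ 6 = - x $ 6" "oct_conj x $ 7 = - x $ 7"
  by (simp_all add: oct_conj_def sum_1_7 oe_def axis_def del: One_nat_def)

lemma inner_octonion: "x \<bullet> y = x$0 * y$0 + x$1 * y$1 + x$2 * y$2 + x$3 * y$3 + x$4 * y$4 + x$5 * y$5 + x$6 * y$6 + x$7 * y$7"
  for x y :: octonion
proof -
  have "x \<bullet> y = (\<Sum>i\<in>{0, 1, 2, 3, 4, 5, 6, 7}. x $ i * y $ i)"
    unfolding UNIV_8[symmetric] by (simp add: inner_vec_def)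
  then show ?thesis by simp
qed

text \<open>The form of alternativity on which the kernel computations rest.\<close>

lemma conj_mult_mult: "oct_conj a \<odot> (a \<odot> f) = (a \<bullet> a) *\<^sub>R f"
  unfolding octonion_eq_iff oct_mult_components oct_conj_components inner_octonion vector_scaleR_component real_scaleR_def
  by (intro conjI) (simp_all add: algebra_simps)

lemma bounded_bilinear_oct_mult: "bounded_bilinear (\<odot>)"
  unfolding bilinear_conv_bounded_bilinear[symmetric] bilinear_def
  by (intro conjI allI linearI)
     (simp_all add: octonion_eq_iff oct_mult_components vector_add_component vector_scaleR_component algebra_simps)

interpretation oct: bounded_bilinear "(\<odot>)"
  by (rule bounded_bilinear_oct_mult)

lemma bounded_linear_oct_conj: "bounded_linear oct_conj"
  unfolding linear_conv_bounded_linear[symmetric]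
  by (intro linearI) (simp_all add: octonion_eq_iff oct_conj_components algebra_simps)

lemma norm_oct_conj: "norm (oct_conj x) = norm x"
  by (simp add: norm_eq_sqrt_inner inner_octonion oct_conj_components)

section \<open>The Cauchy--Pompeiu formula on a span of octonions\<close>

lemma measurable_oct_mult [measurable (raw)]:
  assumes "f \<in> borel_measurable M" "g \<in> borel_measurable M"
  shows "(\<lambda>x. f x \<odot> g x) \<in> borel_measurable M"
  by (rule borel_measurable_continuous_Pair[OF assms]) (intro oct.continuous_on continuous_intros)

lemma C1_on_bounded_linear_proj:
  fixes B :: "'a::euclidean_space set"
  assumes "bounded_linear L"
  shows "C1_on B UNIV (\<lambda>y. L (oproj B y - x)) (\<lambda>b y. L b)"
  unfolding C1_on_def
proof (intro conjI ballI)
  interpret bounded_linear L by fact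
  fix y
  have "((\<lambda>y. oproj B y - x) has_derivative oproj B) (at y)"
    using has_derivative_diff[OF bounded_linear_imp_has_derivative[OF bounded_linear_proj] has_derivative_const] by simp
  then have "((\<lambda>y. L (oproj B y - x)) has_derivative (\<lambda>h. L (oproj B h))) (at y)"
    by (rule bounded_linear.has_derivative[OF assms])
  then show "((\<lambda>y. L (oproj B y - x)) has_derivative (\<lambda>h. \<Sum>b\<in>B. (h \<bullet> b) *\<^sub>R L b)) (at y)"
    by (simp add: oproj_def[of B] sum scale)
qed auto

text \<open>The regularised kernel is smooth also at \<open>0\<close> and tends to \<open>cauchy_kernel\<close> as \<open>\<epsilon>\<close> tends to \<open>0\<close>.
  In dimension \<open>n\<close> the constant factor is the reciprocal of the area of the unit sphere.\<close>

definition reg_kernel :: "nat \<Rightarrow> real \<Rightarrow> octonion \<Rightarrow> octonion" where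
  "reg_kernel n \<epsilon> z =
     (Gamma (real n / 2) / (2 * pi powr (real n / 2)) * ((norm z)\<^sup>2 + \<epsilon>\<^sup>2) powr (- (real n / 2))) *\<^sub>R oct_conj z"

definition cauchy_kernel :: "nat \<Rightarrow> octonion \<Rightarrow> octonion" where
  "cauchy_kernel n z = (Gamma (real n / 2) / (2 * pi powr (real n / 2)) * (1 / norm z ^ n)) *\<^sub>R oct_conj z"

definition span_dirac :: "octonion set \<Rightarrow> (octonion \<Rightarrow> octonion \<Rightarrow> octonion) \<Rightarrow> octonion \<Rightarrow> octonion" where
  "span_dirac B f' y = (\<Sum>b\<in>B. b \<odot> f' b y)"

lemma norm_power2_powr:
  fixes z :: "'a::real_normed_vector"
  assumes "z \<noteq> 0" shows "((norm z)\<^sup>2) powr (- (real n / 2)) = 1 / norm z ^ n"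
proof -
  have "((norm z)\<^sup>2) powr (- (real n / 2)) = (norm z powr 2) powr (- (real n / 2))"
    using assms by (simp add: powr_numeral)
  also have "\<dots> = norm z powr (- real n)" unfolding powr_powr by simp
  also have "\<dots> = 1 / norm z ^ n" using assms by (simp add: powr_minus_divide powr_realpow)
  finally show ?thesis .
qed

lemma integrable_indicator_bounded:
  fixes h :: "'a::euclidean_space \<Rightarrow> 'b::euclidean_space"
  assumes B: "orthonormal B" and G: "G \<in> sets borel" "bounded G" and h: "continuous_on (closure G) h"
  shows "(\<lambda>y. indicator G y *\<^sub>R h y) \<in> borel_measurable borel" "\<exists>C. \<forall>y. norm (indicator G y *\<^sub>R h y) \<le> C"
    "integrable (lborel_span B) (\<lambda>y. indicator G y *\<^sub>R h y)"
proof -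
  have "(\<lambda>y. indicator (closure G) y *\<^sub>R h y) \<in> borel_measurable borel"
    using h by (intro borel_measurable_continuous_on_indicator) auto
  then have "(\<lambda>y. indicator G y *\<^sub>R (indicator (closure G) y *\<^sub>R h y)) \<in> borel_measurable borel"
    using G(1) by measurable
  moreover have "indicator G y *\<^sub>R (indicator (closure G) y *\<^sub>R h y) = indicator G y *\<^sub>R h y" for y
    using closure_subset[of G] by (auto simp: indicator_def)
  ultimately show m: "(\<lambda>y. indicator G y *\<^sub>R h y) \<in> borel_measurable borel" by (simp only:)
  have "compact (h ` closure G)" using h G(2) by (intro compact_continuous_image) auto
  then obtain C where C: "\<And>y. y \<in> closure G \<Longrightarrow> norm (h y) \<le> C"
    by (meson bounded_iff compact_imp_bounded image_eqI)
  have C': "norm (indicator G y *\<^sub>R h y) \<le> max C 0" for y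
    using C[of y] closure_subset[of G] by (auto simp: indicator_def le_max_iff_disj)
  then show "\<exists>C. \<forall>y. norm (indicator G y *\<^sub>R h y) \<le> C" by blast
  show "integrable (lborel_span B) (\<lambda>y. indicator G y *\<^sub>R h y)"
    by (rule integrable_lborel_span_bounded_support[OF B m G(2) _ C']) simp
qed

lemma (in bounded_bilinear) continuous_on_right:
  "continuous_on X g \<Longrightarrow> continuous_on X (\<lambda>x. prod a (g x))"
  by (rule continuous_on[OF continuous_on_const])

context
  fixes B :: "octonion set" and G X :: "octonion set" and f :: "octonion \<Rightarrow> octonion" and f' :: "octonion \<Rightarrow> octonion \<Rightarrow> octonion"
    and n :: nat and x :: octonion
  assumes B: "orthonormal B" and G: "openin (top_of_set (span B)) G" "bounded G" and sm: "has_smooth_boundary B G"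
    and X: "openin (top_of_set (span B)) X" "closure G \<subseteq> X" and f: "C1_on B (oproj B -` X) f f'"
    and n: "n = card B" "n \<ge> 2" and x: "x \<in> G"
begin

lemma closure_subset_domain: "closure G \<subseteq> oproj B -` X" "closure G \<subseteq> span B" "G \<subseteq> closure G" "x \<in> span B"
proof -
  show 1: "closure G \<subseteq> span B" using X(2) openin_imp_subset[OF X(1)] by auto
  show "closure G \<subseteq> oproj B -` X"
  proof
    fix y assume "y \<in> closure G"
    then show "y \<in> oproj B -` X" using subsetD[OF X(2), of y] proj_ident[OF B subsetD[OF 1, of y]] by simp
  qed
  show "G \<subseteq> closure G" by (rule closure_subset)
  then show "x \<in> span B" using 1 x by auto
qed

lemma boundary_facts:
  shows "compact (boundary_in B G)" "locally_graph B (boundary_in B G)" "boundary_in B G \<subseteq> closure G" "x \<notin> boundary_in B G"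
    "G \<in> sets borel"
  using compact_boundary_in[OF G] smooth_boundary_locally_graph[OF B G(1) sm] boundary_in_eq[OF G(1)] x openin_span_borel[OF G(1)]
  by auto

lemma f_continuous: "continuous_on (closure G) f"
  by (rule continuous_on_subset[OF C1_on_imp_continuous_on[OF f] closure_subset_domain(1)])

lemma dirac_continuous: "continuous_on (closure G) (span_dirac B f')"
  unfolding span_dirac_def
  by (intro continuous_intros oct.continuous_on_right continuous_on_subset[OF C1_onD(3)[OF f] closure_subset_domain(1)])

lemma normal_continuous: "continuous_on (boundary_in B G) (\<lambda>y. exterior_normal B G y \<odot> f y)"
  by (intro oct.continuous_on exterior_normal_properties(1)[OF B G(1) sm] continuous_on_subset[OF f_continuous boundary_facts(3)])

lemma reg_kernel_continuous:
  assumes "\<epsilon> \<noteq> 0" shows "continuous_on Y (\<lambda>y. reg_kernel n \<epsilon> (y - x))"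
proof -
  have "(norm (y - x))\<^sup>2 + \<epsilon>\<^sup>2 \<noteq> 0" for y using assms by (simp add: add_nonneg_eq_0_iff)
  then show ?thesis unfolding reg_kernel_def
    by (intro continuous_intros bounded_linear.continuous_on[OF bounded_linear_oct_conj]) auto
qed

text \<open>Summing the divergence theorem over \<open>b\<close> with \<open>\<phi>\<^sub>b y = K (y - x) \<odot> (b \<odot> f y)\<close>, \<open>K\<close> the
  regularised kernel.  As the product is not associative, the sum over \<open>b\<close> of
  \<open>\<partial>\<^sub>b K (z) \<odot> (b \<odot> f)\<close> is collapsed by \<open>oct_conj a \<odot> (a \<odot> f) = (a \<bullet> a) f\<close>, once with \<open>a = b\<close> and once
  with \<open>a = z\<close>.\<close>

lemma regularised_cauchy_pompeiu:
  assumes e: "\<epsilon> \<noteq> 0"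
  defines "M \<equiv> boundary_in B G"
  shows "(\<integral> y. approx_unit n \<epsilon> (y - x) *\<^sub>R (indicator G y *\<^sub>R f y) \<partial>lborel_span B)
       + (\<integral> y. reg_kernel n \<epsilon> (y - x) \<odot> (indicator G y *\<^sub>R span_dirac B f' y) \<partial>lborel_span B)
       = (\<integral> y. reg_kernel n \<epsilon> (y - x) \<odot> (indicator M y *\<^sub>R (exterior_normal B G y \<odot> f y)) \<partial>surface_measure B M)"
proof -
  define h where "h = real n / 2"
  define c where "c = Gamma h / (2 * pi powr h)"
  define N where "N y = (norm (oproj B y - x))\<^sup>2 + \<epsilon>\<^sup>2" for y
  have Npos: "N y > 0" for y using e by (simp add: N_def add_nonneg_pos)
  define k where "k y = c * N y powr (- h)" for y
  define k' where "k' b y = (c * (- h) * N y powr (- h - 1)) * (2 * ((oproj B y - x) \<bullet> b))" for b y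
  have NC: "C1_on B UNIV N (\<lambda>b y. 2 * ((oproj B y - x) \<bullet> b))"
    using C1_on_add[OF C1_on_dist_squared C1_on_const[OF open_UNIV, of B "\<epsilon>\<^sup>2"]] by (simp add: N_def[abs_def])
  have kC: "C1_on B UNIV k k'"
    unfolding k_def[abs_def] k'_def[abs_def]
  proof (rule C1_on_real_compose[OF NC, of "\<lambda>t. c * t powr (- h)" "\<lambda>t. c * (- h) * t powr (- h - 1)"])
    show "((\<lambda>t. c * t powr (- h)) has_real_derivative c * (- h) * t powr (- h - 1)) (at t)" if t: "t \<in> range N" for t
    proof -
      have "t > 0" using t Npos by auto
      then show ?thesis using DERIV_cmult[OF has_real_derivative_powr[of t "- h"], of c] by (simp add: mult.assoc)
    qed
    show "continuous_on (range N) (\<lambda>t. c * (- h) * t powr (- h - 1))"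
      using Npos by (intro continuous_intros) (auto simp: less_imp_neq[symmetric])
  qed
  have zC: "C1_on B UNIV (\<lambda>y. oct_conj (oproj B y - x)) (\<lambda>b y. oct_conj b)"
    by (rule C1_on_bounded_linear_proj[OF bounded_linear_oct_conj])
  let ?W = "oproj B -` X"
  have W: "open ?W" by (rule C1_onD(1)[OF f])
  define K where "K y = k y *\<^sub>R oct_conj (oproj B y - x)" for y
  define K' where "K' b y = k y *\<^sub>R oct_conj b + k' b y *\<^sub>R oct_conj (oproj B y - x)" for b y
  have KC: "C1_on B ?W K K'" unfolding K_def[abs_def] K'_def[abs_def]
    by (rule C1_on_subset[OF C1_on_scaleR[OF kC zC] W]) simp
  have Keq: "K y = reg_kernel n \<epsilon> (y - x)" if "y \<in> span B" for y
    using that by (simp add: K_def k_def N_def reg_kernel_def c_def h_def proj_ident[OF B])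
  define \<phi> where "\<phi> b y = K y \<odot> (b \<odot> f y)" for b y
  define \<phi>' where "\<phi>' b c y = K y \<odot> (b \<odot> f' c y + 0 \<odot> f y) + K' c y \<odot> (b \<odot> f y)" for b c y
  have \<phi>C: "C1_on B ?W (\<phi> b) (\<phi>' b)" for b
    unfolding \<phi>_def[abs_def] \<phi>'_def[abs_def]
    by (rule C1_on_bilinear[OF bounded_bilinear_oct_mult KC C1_on_bilinear[OF bounded_bilinear_oct_mult C1_on_const[OF W] f]])
  let ?n = "exterior_normal B G" and ?S = "surface_measure B M"
  note bf = boundary_facts[folded M_def]
  have parts: "(\<integral> y. indicator G y *\<^sub>R \<phi>' b b y \<partial>lborel_span B) = (\<integral> y. indicator M y *\<^sub>R ((?n y \<bullet> b) *\<^sub>R \<phi> b y) \<partial>?S)"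
    if "b \<in> B" for b
    unfolding M_def by (rule divergence_theorem[OF B G sm X \<phi>C that])
  have \<phi>'sum: "(\<Sum>b\<in>B. \<phi>' b b y) = approx_unit n \<epsilon> (y - x) *\<^sub>R f y + reg_kernel n \<epsilon> (y - x) \<odot> span_dirac B f' y"
    if y: "y \<in> span B" for y
  proof -
    let ?z = "y - x"
    have Py: "oproj B y = y" by (rule proj_ident[OF B y])
    have z: "?z \<in> span B" using y closure_subset_domain(4) by (rule span_diff)
    have s1: "(\<Sum>b\<in>B. oct_conj b \<odot> (b \<odot> f y)) = real n *\<^sub>R f y"
    proof -
      have "(\<Sum>b\<in>B. oct_conj b \<odot> (b \<odot> f y)) = (\<Sum>b\<in>B. f y)"
        by (rule sum.cong) (use B in \<open>auto simp: conj_mult_mult orthonormal_inner\<close>)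
      then show ?thesis by (simp add: n(1) scaleR_conv_of_real sum_constant_scaleR)
    qed
    have s2: "(\<Sum>b\<in>B. (?z \<bullet> b) *\<^sub>R (oct_conj ?z \<odot> (b \<odot> f y))) = (norm ?z)\<^sup>2 *\<^sub>R f y"
    proof -
      have "(\<Sum>b\<in>B. (?z \<bullet> b) *\<^sub>R (oct_conj ?z \<odot> (b \<odot> f y))) = oct_conj ?z \<odot> ((\<Sum>b\<in>B. (?z \<bullet> b) *\<^sub>R b) \<odot> f y)"
        by (simp add: oct.sum_left oct.sum_right oct.scaleR_left oct.scaleR_right)
      then show ?thesis using span_expansion[OF B z] by (simp add: conj_mult_mult power2_norm_eq_inner)
    qed
    have "(\<Sum>b\<in>B. \<phi>' b b y) = K y \<odot> span_dirac B f' y + (\<Sum>b\<in>B. K' b y \<odot> (b \<odot> f y))"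
      by (simp add: \<phi>'_def sum.distrib oct.zero_left oct.sum_right span_dirac_def)
    also have "(\<Sum>b\<in>B. K' b y \<odot> (b \<odot> f y)) =
       k y *\<^sub>R (\<Sum>b\<in>B. oct_conj b \<odot> (b \<odot> f y)) + (- 2 * c * h * N y powr (- h - 1)) *\<^sub>R (\<Sum>b\<in>B. (?z \<bullet> b) *\<^sub>R (oct_conj ?z \<odot> (b \<odot> f y)))"
      by (simp add: K'_def k'_def Py oct.add_left oct.diff_left oct.scaleR_left sum.distrib sum_subtractf sum_negf scaleR_sum_right mult_ac)
    also have "\<dots> = approx_unit n \<epsilon> ?z *\<^sub>R f y"
    proof -
      have pw: "N y powr (- h) = N y powr (- h - 1) * N y" using Npos[of y] by (simp add: powr_diff)
      have hn: "real n = 2 * h" by (simp add: h_def)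
      have Gm: "Gamma (h + 1) = h * Gamma h"
        by (rule Gamma_plus1) (use n(2) in \<open>auto simp: h_def nonpos_Ints_def\<close>)
      have "k y * real n + (- 2 * c * h * N y powr (- h - 1)) * (norm ?z)\<^sup>2 = 2 * c * h * N y powr (- h - 1) * (N y - (norm ?z)\<^sup>2)"
        unfolding k_def pw hn by (simp add: algebra_simps)
      also have "N y - (norm ?z)\<^sup>2 = \<epsilon>\<^sup>2" by (simp add: N_def Py)
      also have "2 * c * h * N y powr (- h - 1) * \<epsilon>\<^sup>2 = approx_unit n \<epsilon> ?z"
        unfolding approx_unit_def h_def[symmetric] Gm by (simp add: c_def N_def Py)
      finally show ?thesis unfolding s1 s2 scaleR_scaleR scaleR_add_left[symmetric] by (rule arg_cong)
    qed
    finally show ?thesis using Keq[OF y] by simp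
  qed
  have i1: "integrable (lborel_span B) (\<lambda>y. indicator G y *\<^sub>R \<phi>' b b y)" if "b \<in> B" for b
    by (rule integrable_indicator_bounded(3)[OF B boundary_facts(5) G(2)
        continuous_on_subset[OF C1_onD(3)[OF \<phi>C that] closure_subset_domain(1)]])
  have i2: "integrable ?S (\<lambda>y. indicator M y *\<^sub>R ((?n y \<bullet> b) *\<^sub>R \<phi> b y))" if "b \<in> B" for b
  proof (rule integrable_on_surface[OF B bf(1,2)])
    show "continuous_on M (\<lambda>y. (?n y \<bullet> b) *\<^sub>R \<phi> b y)"
      unfolding M_def
      by (intro continuous_intros exterior_normal_properties(1)[OF B G(1) sm]
          continuous_on_subset[OF C1_on_imp_continuous_on[OF \<phi>C]] order_trans[OF boundary_facts(3) closure_subset_domain(1)])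
  qed
  have "(\<Sum>b\<in>B. \<integral> y. indicator G y *\<^sub>R \<phi>' b b y \<partial>lborel_span B)
      = (\<integral> y. (\<Sum>b\<in>B. indicator G y *\<^sub>R \<phi>' b b y) \<partial>lborel_span B)"
    by (rule Bochner_Integration.integral_sum[symmetric, OF i1])
  also have "\<dots> = (\<integral> y. approx_unit n \<epsilon> (y - x) *\<^sub>R (indicator G y *\<^sub>R f y) + reg_kernel n \<epsilon> (y - x) \<odot> (indicator G y *\<^sub>R span_dirac B f' y) \<partial>lborel_span B)"
  proof (rule Bochner_Integration.integral_cong[OF refl])
    fix y
    show "(\<Sum>b\<in>B. indicator G y *\<^sub>R \<phi>' b b y) = approx_unit n \<epsilon> (y - x) *\<^sub>R (indicator G y *\<^sub>R f y) + reg_kernel n \<epsilon> (y - x) \<odot> (indicator G y *\<^sub>R span_dirac B f' y)"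
      using \<phi>'sum[of y] closure_subset_domain(2,3) by (cases "y \<in> G") (auto simp: oct.zero_right)
  qed
  also have "\<dots> = (\<integral> y. approx_unit n \<epsilon> (y - x) *\<^sub>R (indicator G y *\<^sub>R f y) \<partial>lborel_span B)
       + (\<integral> y. reg_kernel n \<epsilon> (y - x) \<odot> (indicator G y *\<^sub>R span_dirac B f' y) \<partial>lborel_span B)"
  proof (rule Bochner_Integration.integral_add)
    have nz: "(norm (y - x))\<^sup>2 + \<epsilon>\<^sup>2 \<noteq> 0" for y using e by (simp add: add_nonneg_eq_0_iff)
    have "continuous_on (closure G) (\<lambda>y. approx_unit n \<epsilon> (y - x) *\<^sub>R f y)"
      unfolding approx_unit_def by (intro continuous_intros f_continuous) (use nz in auto)
    from integrable_indicator_bounded(3)[OF B boundary_facts(5) G(2) this]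
    show "integrable (lborel_span B) (\<lambda>y. approx_unit n \<epsilon> (y - x) *\<^sub>R (indicator G y *\<^sub>R f y))"
      by (simp add: mult.commute)
    have "continuous_on (closure G) (\<lambda>y. reg_kernel n \<epsilon> (y - x) \<odot> span_dirac B f' y)"
      by (intro oct.continuous_on reg_kernel_continuous e dirac_continuous)
    from integrable_indicator_bounded(3)[OF B boundary_facts(5) G(2) this]
    show "integrable (lborel_span B) (\<lambda>y. reg_kernel n \<epsilon> (y - x) \<odot> (indicator G y *\<^sub>R span_dirac B f' y))"
      by (simp add: oct.scaleR_right)
  qed
  finally have L: "(\<Sum>b\<in>B. \<integral> y. indicator G y *\<^sub>R \<phi>' b b y \<partial>lborel_span B) = \<dots>" .
  have "(\<Sum>b\<in>B. \<integral> y. indicator M y *\<^sub>R ((?n y \<bullet> b) *\<^sub>R \<phi> b y) \<partial>?S) = (\<integral> y. (\<Sum>b\<in>B. indicator M y *\<^sub>R ((?n y \<bullet> b) *\<^sub>R \<phi> b y)) \<partial>?S)"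
    by (rule Bochner_Integration.integral_sum[symmetric, OF i2])
  also have "\<dots> = (\<integral> y. reg_kernel n \<epsilon> (y - x) \<odot> (indicator M y *\<^sub>R (?n y \<odot> f y)) \<partial>?S)"
  proof (rule Bochner_Integration.integral_cong[OF refl])
    fix y
    show "(\<Sum>b\<in>B. indicator M y *\<^sub>R ((?n y \<bullet> b) *\<^sub>R \<phi> b y)) = reg_kernel n \<epsilon> (y - x) \<odot> (indicator M y *\<^sub>R (?n y \<odot> f y))"
    proof (cases "y \<in> M")
      case True
      then have yB: "y \<in> span B" and nB: "?n y \<in> span B"
        using bf(3) closure_subset_domain(2) exterior_normal_properties(2)[OF B G(1) sm] by (auto simp: M_def)
      have "(\<Sum>b\<in>B. (?n y \<bullet> b) *\<^sub>R \<phi> b y) = K y \<odot> ((\<Sum>b\<in>B. (?n y \<bullet> b) *\<^sub>R b) \<odot> f y)"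
        by (simp add: \<phi>_def oct.sum_left oct.sum_right oct.scaleR_left oct.scaleR_right)
      then show ?thesis using True Keq[OF yB] span_expansion[OF B nB] by simp
    qed (simp add: oct.zero_right)
  qed
  finally show ?thesis using L parts by (simp cong: sum.cong)
qed

lemma reg_kernel_norm_le: "norm (reg_kernel n \<epsilon> z) \<le> Gamma (real n / 2) / (2 * pi powr (real n / 2)) * (1 / norm z ^ (n - 1))"
proof (cases "z = 0")
  case True
  then show ?thesis using n(2) bounded_linear.linear[OF bounded_linear_oct_conj]
    by (simp add: reg_kernel_def linear_0 Gamma_real_pos less_imp_le)
next
  case False
  have c: "Gamma (real n / 2) / (2 * pi powr (real n / 2)) \<ge> 0"
    using n(2) by (intro divide_nonneg_nonneg less_imp_le[OF Gamma_real_pos]) auto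
  have "((norm z)\<^sup>2 + \<epsilon>\<^sup>2) powr (- (real n / 2)) \<le> ((norm z)\<^sup>2) powr (- (real n / 2))"
    using False by (intro powr_mono2') auto
  also have "\<dots> = 1 / norm z ^ n" by (rule norm_power2_powr[OF False])
  finally have "((norm z)\<^sup>2 + \<epsilon>\<^sup>2) powr (- (real n / 2)) * norm z \<le> 1 / norm z ^ n * norm z"
    by (rule mult_right_mono) simp
  also have "\<dots> = 1 / norm z ^ (n - 1)"
    using False n(2) by (cases n) auto
  finally have "Gamma (real n / 2) / (2 * pi powr (real n / 2)) * (((norm z)\<^sup>2 + \<epsilon>\<^sup>2) powr (- (real n / 2)) * norm z)
      \<le> Gamma (real n / 2) / (2 * pi powr (real n / 2)) * (1 / norm z ^ (n - 1))"
    by (rule mult_left_mono[OF _ c])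
  then show ?thesis
    by (simp only: reg_kernel_def norm_scaleR norm_oct_conj abs_mult abs_of_nonneg[OF c] abs_of_nonneg[OF powr_ge_zero] mult.assoc)
qed

lemma reg_kernel_tendsto: "(\<lambda>k. reg_kernel n (1 / real (Suc k)) z) \<longlonglongrightarrow> cauchy_kernel n z"
proof (cases "z = 0")
  case True
  then have "reg_kernel n e z = 0" "cauchy_kernel n z = 0" for e
    using bounded_linear.linear[OF bounded_linear_oct_conj] by (auto simp: reg_kernel_def cauchy_kernel_def linear_0)
  then show ?thesis by simp
next
  case False
  have "(\<lambda>k. ((norm z)\<^sup>2 + (1 / real (Suc k))\<^sup>2) powr (- (real n / 2))) \<longlonglongrightarrow> ((norm z)\<^sup>2 + 0\<^sup>2) powr (- (real n / 2))"
    using False by (intro tendsto_intros LIMSEQ_Suc[OF lim_1_over_n]) auto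
  moreover have "((norm z)\<^sup>2 + 0\<^sup>2) powr (- (real n / 2)) = 1 / norm z ^ n"
    using norm_power2_powr[OF False] by simp
  ultimately have "(\<lambda>k. ((norm z)\<^sup>2 + (1 / real (Suc k))\<^sup>2) powr (- (real n / 2))) \<longlonglongrightarrow> 1 / norm z ^ n" by simp
  then show ?thesis unfolding reg_kernel_def cauchy_kernel_def by (intro tendsto_intros)
qed

text \<open>The limit of \<open>regularised_cauchy_pompeiu\<close> along \<open>\<epsilon> = 1 / (k + 1)\<close>.\<close>

theorem cauchy_pompeiu_span:
  defines "M \<equiv> boundary_in B G"
  shows "integrable (surface_measure B M) (\<lambda>y. cauchy_kernel n (y - x) \<odot> (indicator M y *\<^sub>R (exterior_normal B G y \<odot> f y)))"
    and "integrable (lborel_span B) (\<lambda>y. cauchy_kernel n (y - x) \<odot> (indicator G y *\<^sub>R span_dirac B f' y))"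
    and "f x = (\<integral> y. cauchy_kernel n (y - x) \<odot> (indicator M y *\<^sub>R (exterior_normal B G y \<odot> f y)) \<partial>surface_measure B M)
       - (\<integral> y. cauchy_kernel n (y - x) \<odot> (indicator G y *\<^sub>R span_dirac B f' y) \<partial>lborel_span B)"
proof -
  note bf = boundary_facts[folded M_def]
  let ?S = "surface_measure B M" and ?\<epsilon> = "\<lambda>k. 1 / real (Suc k)"
  define c where "c = Gamma (real n / 2) / (2 * pi powr (real n / 2))"
  obtain Cm where Cm: "\<And>a b. norm (a \<odot> b) \<le> norm a * norm b * Cm" "Cm > 0" using oct.pos_bounded by blast
  have c0: "c \<ge> 0" unfolding c_def using n(2) by (intro divide_nonneg_nonneg less_imp_le[OF Gamma_real_pos]) auto
  let ?q = "\<lambda>y. 1 / norm (y - x) ^ (n - 1)"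
  have dom: "norm (reg_kernel n (?\<epsilon> k) (y - x) \<odot> a) \<le> c * Cm * (?q y * norm a)" for k y a
  proof -
    have "norm (reg_kernel n (?\<epsilon> k) (y - x) \<odot> a) \<le> norm (reg_kernel n (?\<epsilon> k) (y - x)) * norm a * Cm" by (rule Cm)
    also have "\<dots> \<le> (c * ?q y) * norm a * Cm"
      using reg_kernel_norm_le[of "?\<epsilon> k" "y - x"] Cm(2) unfolding c_def
      by (intro mult_right_mono) auto
    finally show ?thesis by (simp add: mult_ac)
  qed
  have conv: "(\<lambda>k. reg_kernel n (?\<epsilon> k) (y - x) \<odot> a) \<longlonglongrightarrow> cauchy_kernel n (y - x) \<odot> a" for y a
    by (intro oct.tendsto reg_kernel_tendsto tendsto_const)
  have rm: "(\<lambda>y. reg_kernel n (?\<epsilon> k) (y - x)) \<in> borel_measurable borel" for k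
    by (intro borel_measurable_continuous_onI reg_kernel_continuous) simp
  have cm: "(\<lambda>y. cauchy_kernel n (y - x)) \<in> borel_measurable borel"
    by (rule borel_measurable_LIMSEQ_metric[OF rm]) (rule reg_kernel_tendsto)
  \<comment> \<open>Dominated convergence on the boundary, where \<open>x\<close> is at a positive distance.\<close>
  define gM where "gM y = indicator M y *\<^sub>R (exterior_normal B G y \<odot> f y)" for y
  have gMm: "gM \<in> borel_measurable borel" unfolding gM_def using normal_continuous bf(1)
    by (intro borel_measurable_continuous_on_indicator) (auto simp: M_def intro: borel_closed compact_imp_closed)
  have sS: "sets ?S = sets borel"
    using is_surface_measure_surface_measure[OF B bf(1,2)] by (simp add: is_surface_measure_def)
  have wM: "integrable ?S (\<lambda>y. c * Cm * (?q y * norm (gM y)))"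
  proof -
    have "continuous_on M (\<lambda>y. c * Cm * (?q y * norm (exterior_normal B G y \<odot> f y)))"
      using bf(4) normal_continuous by (intro continuous_intros) (auto simp: M_def)
    from integrable_on_surface[OF B bf(1,2) this] show ?thesis
      by (rule Bochner_Integration.integrable_cong[THEN iffD1, rotated -1]) (auto simp: gM_def indicator_def)
  qed
  have M1: "(\<lambda>y. cauchy_kernel n (y - x) \<odot> gM y) \<in> borel_measurable ?S"
    and M2: "(\<lambda>y. reg_kernel n (?\<epsilon> k) (y - x) \<odot> gM y) \<in> borel_measurable ?S" for k
    using measurable_oct_mult[OF cm gMm] measurable_oct_mult[OF rm gMm] by (simp_all cong: measurable_cong_sets add: sS)
  have limM: "(\<lambda>k. \<integral> y. reg_kernel n (?\<epsilon> k) (y - x) \<odot> gM y \<partial>?S) \<longlonglongrightarrow> (\<integral> y. cauchy_kernel n (y - x) \<odot> gM y \<partial>?S)"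
    by (rule integral_dominated_convergence[OF M1 M2 wM], rule AE_I2, rule conv, rule AE_I2, rule dom)
  have intM: "integrable ?S (\<lambda>y. cauchy_kernel n (y - x) \<odot> gM y)"
    by (rule integrable_dominated_convergence[OF M1 M2 wM], rule AE_I2, rule conv, rule AE_I2, rule dom)
  \<comment> \<open>Dominated convergence on \<open>G\<close>, where the kernel is locally integrable.\<close>
  define gG where "gG y = indicator G y *\<^sub>R span_dirac B f' y" for y
  note ib = integrable_indicator_bounded[OF B bf(5) G(2) dirac_continuous, folded gG_def]
  obtain CG where CG: "\<And>y. norm (gG y) \<le> CG" using ib(2) by blast
  have gGm: "gG \<in> borel_measurable borel" using ib(1) by (simp add: gG_def[abs_def])
  have wG: "integrable (lborel_span B) (\<lambda>y. c * Cm * (?q y * norm (gG y)))"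
  proof -
    have m: "(\<lambda>y. ?q y * norm (gG y)) \<in> borel_measurable (lborel_span B)"
      using gGm by (simp cong: measurable_cong_sets)
    have "(\<integral>\<^sup>+ y. ennreal (?q y * norm (gG y)) \<partial>lborel_span B) \<le> (\<integral>\<^sup>+ y. ennreal CG * (indicator G y * ennreal (?q y)) \<partial>lborel_span B)"
    proof (rule nn_integral_mono)
      fix y
      show "ennreal (?q y * norm (gG y)) \<le> ennreal CG * (indicator G y * ennreal (?q y))"
      proof (cases "y \<in> G")
        case True
        have "?q y * norm (gG y) \<le> CG * ?q y" using mult_left_mono[OF CG[of y], of "?q y"] by (simp add: mult.commute)
        then show ?thesis using True order_trans[OF norm_ge_zero CG] by (simp add: ennreal_mult[symmetric] ennreal_leI)
      qed (simp add: gG_def)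
    qed
    also have "\<dots> = ennreal CG * (\<integral>\<^sup>+ y. indicator G y * ennreal (?q y) \<partial>lborel_span B)"
      by (rule nn_integral_cmult) (use bf(5) in \<open>simp cong: measurable_cong_sets\<close>)
    also have "\<dots> < \<infinity>"
    proof -
      have "(\<integral>\<^sup>+ y. indicator G y * ennreal (?q y) \<partial>lborel_span B) < \<infinity>"
        by (rule norm_power_locally_integrable[OF B _ _ closure_subset_domain(4) G(2)]) (use n in auto)
      then show ?thesis by (simp add: ennreal_mult_less_top)
    qed
    finally have "integrable (lborel_span B) (\<lambda>y. ?q y * norm (gG y))"
      using m by (intro integrableI_nonneg) auto
    then show ?thesis by (rule integrable_mult_right)
  qed
  have G1: "(\<lambda>y. cauchy_kernel n (y - x) \<odot> gG y) \<in> borel_measurable (lborel_span B)"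
    and G2: "(\<lambda>y. reg_kernel n (?\<epsilon> k) (y - x) \<odot> gG y) \<in> borel_measurable (lborel_span B)" for k
    using measurable_oct_mult[OF cm gGm] measurable_oct_mult[OF rm gGm] by (simp_all cong: measurable_cong_sets)
  have limG: "(\<lambda>k. \<integral> y. reg_kernel n (?\<epsilon> k) (y - x) \<odot> gG y \<partial>lborel_span B) \<longlonglongrightarrow> (\<integral> y. cauchy_kernel n (y - x) \<odot> gG y \<partial>lborel_span B)"
    by (rule integral_dominated_convergence[OF G1 G2 wG], rule AE_I2, rule conv, rule AE_I2, rule dom)
  have intG: "integrable (lborel_span B) (\<lambda>y. cauchy_kernel n (y - x) \<odot> gG y)"
    by (rule integrable_dominated_convergence[OF G1 G2 wG], rule AE_I2, rule conv, rule AE_I2, rule dom)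
  \<comment> \<open>The remaining term is an approximate identity applied to \<open>f\<close> on \<open>G\<close>.\<close>
  define g where "g y = indicator G y *\<^sub>R f y" for y
  note ig = integrable_indicator_bounded[OF B bf(5) G(2) f_continuous, folded g_def]
  have limf: "(\<lambda>k. \<integral> y. approx_unit n (?\<epsilon> k) (y - x) *\<^sub>R g y \<partial>lborel_span B) \<longlonglongrightarrow> f x"
  proof -
    obtain C where C: "\<And>y. norm (g y) \<le> C" using ig(2) by blast
    obtain T where T: "open T" "G = span B \<inter> T" using G(1) by (metis openin_open)
    have xW: "x \<in> oproj B -` X" by (rule subsetD[OF closure_subset_domain(1) subsetD[OF closure_subset_domain(3) x]])
    have gx: "g x = f x" using x by (simp add: g_def)
    have "continuous (at x within span B) f"
      by (rule continuous_at_imp_continuous_at_within[OF has_derivative_continuous[OF C1_onD(2)[OF f xW]]])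
    then have "(f \<longlongrightarrow> f x) (at x within span B)" by (simp add: continuous_within)
    moreover have "\<forall>\<^sub>F y in at x within span B. f y = g y"
      unfolding eventually_at_topological by (rule exI[of _ T]) (use T x in \<open>auto simp: g_def\<close>)
    ultimately have "continuous (at x within span B) g"
      unfolding continuous_within gx by (rule Lim_transform_eventually)
    from approx_unit_tendsto[OF B closure_subset_domain(4) _ C this] ig(1)
    show ?thesis using x by (simp add: n(1) g_def[abs_def])
  qed
  have eq: "(\<integral> y. approx_unit n (?\<epsilon> k) (y - x) *\<^sub>R g y \<partial>lborel_span B) + (\<integral> y. reg_kernel n (?\<epsilon> k) (y - x) \<odot> gG y \<partial>lborel_span B)
     = (\<integral> y. reg_kernel n (?\<epsilon> k) (y - x) \<odot> gM y \<partial>?S)" for k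
    using regularised_cauchy_pompeiu[of "?\<epsilon> k"] by (simp add: g_def gG_def gM_def M_def)
  have "f x + (\<integral> y. cauchy_kernel n (y - x) \<odot> gG y \<partial>lborel_span B) = (\<integral> y. cauchy_kernel n (y - x) \<odot> gM y \<partial>?S)"
    by (rule LIMSEQ_unique[OF tendsto_add[OF limf limG]]) (use limM eq in simp)
  then show "f x = (\<integral> y. cauchy_kernel n (y - x) \<odot> (indicator M y *\<^sub>R (exterior_normal B G y \<odot> f y)) \<partial>?S)
       - (\<integral> y. cauchy_kernel n (y - x) \<odot> (indicator G y *\<^sub>R span_dirac B f' y) \<partial>lborel_span B)"
    by (simp add: gM_def gG_def eq_diff_eq)
  show "integrable ?S (\<lambda>y. cauchy_kernel n (y - x) \<odot> (indicator M y *\<^sub>R (exterior_normal B G y \<odot> f y)))"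
    using intM by (simp add: gM_def)
  show "integrable (lborel_span B) (\<lambda>y. cauchy_kernel n (y - x) \<odot> (indicator G y *\<^sub>R span_dirac B f' y))"
    using intG by (simp add: gG_def)
qed

end

section \<open>Slices and generalized partial-slice functions\<close>

lemma inner_oe: "i \<le> 7 \<Longrightarrow> j \<le> 7 \<Longrightarrow> oe i \<bullet> oe j = (if i = j then 1 else 0)"
  using inj_onD[OF inj_of_nat_8, of i j] by (auto simp: oe_def inner_axis_axis)

lemma inj_oe: "inj_on oe {0..7}"
proof (rule inj_onI)
  fix i j assume "i \<in> {0..7}" "j \<in> {0..7}" "oe i = oe j"
  then show "i = j" using inner_oe[of i j] inner_oe[of i i] by (simp split: if_splits)
qed

lemma orthonormal_oe: "p \<le> 6 \<Longrightarrow> orthonormal (oe ` {0..p})"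
  unfolding orthonormal_def using inner_oe by (auto dest: inj_onD[OF inj_oe])

context
  fixes p :: nat
  assumes p: "p \<le> 6"
begin

lemma SS_inner_oe: "\<omega> \<in> SS p \<Longrightarrow> i \<le> p \<Longrightarrow> \<omega> \<bullet> oe i = 0"
  unfolding SS_def by (auto simp: inner_sum_left inner_oe p le_trans[OF _ p] intro!: sum.neutral)

lemma SS_inner_self: "\<omega> \<in> SS p \<Longrightarrow> \<omega> \<bullet> \<omega> = 1"
proof -
  assume "\<omega> \<in> SS p"
  then obtain c where c: "\<omega> = (\<Sum>i=p+1..7. c i *\<^sub>R oe i)" "(\<Sum>i=p+1..7. (c i)\<^sup>2) = 1" unfolding SS_def by blast
  have "\<omega> \<bullet> \<omega> = (\<Sum>i=p+1..7. \<Sum>j=p+1..7. c i * c j * (oe j \<bullet> oe i))"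
    unfolding c(1) inner_sum_left inner_sum_right by (simp add: mult.assoc)
  also have "\<dots> = (\<Sum>i=p+1..7. \<Sum>j=p+1..7. if j = i then (c i)\<^sup>2 else 0)"
    by (intro sum.cong refl) (auto simp: inner_oe power2_eq_square)
  finally show ?thesis using c(2) by simp
qed

lemma SS_uminus: "\<omega> \<in> SS p \<Longrightarrow> - \<omega> \<in> SS p"
proof -
  assume "\<omega> \<in> SS p"
  then obtain c where "\<omega> = (\<Sum>i=p+1..7. c i *\<^sub>R oe i)" "(\<Sum>i=p+1..7. (c i)\<^sup>2) = 1" unfolding SS_def by blast
  then show ?thesis unfolding SS_def by (intro CollectI exI[of _ "\<lambda>i. - c i"]) (simp add: sum_negf)
qed

lemma SS_mult_mult:
  assumes "\<omega> \<in> SS p" shows "\<omega> \<odot> (\<omega> \<odot> a) = - a"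
proof -
  have z: "\<omega> $ 0 = 0" using SS_inner_oe[OF assms, of 0] by (simp add: oe_def inner_axis)
  have "oct_conj \<omega> = - \<omega>" unfolding octonion_eq_iff oct_conj_components by (simp add: z)
  then have "- (\<omega> \<odot> (\<omega> \<odot> a)) = a"
    using conj_mult_mult[of \<omega> a] SS_inner_self[OF assms] by (simp add: oct.minus_left)
  then show ?thesis by (metis minus_minus)
qed

lemma SS_inner_Rp: "\<omega> \<in> SS p \<Longrightarrow> x \<in> Rp p \<Longrightarrow> \<omega> \<bullet> x = 0"
  using inner_span_expansion[OF orthonormal_oe[OF p], of x \<omega>] SS_inner_oe
  unfolding Rp_def by (auto simp: inner_commute intro!: sum.neutral)

lemma SS_notin: "\<eta> \<in> SS p \<Longrightarrow> \<eta> \<notin> oe ` {0..p}"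
  using SS_inner_oe SS_inner_self by fastforce

lemma orthonormal_slice_basis:
  assumes "\<eta> \<in> SS p" shows "orthonormal (slice_basis p \<eta>)"
  unfolding orthonormal_def
proof (intro conjI ballI)
  show "finite (slice_basis p \<eta>)" by (simp add: slice_basis_def)
  fix b c assume "b \<in> slice_basis p \<eta>" "c \<in> slice_basis p \<eta>"
  then consider "b = \<eta>" "c = \<eta>" | i where "b = \<eta>" "c = oe i" "i \<le> p" | i where "c = \<eta>" "b = oe i" "i \<le> p"
    | "b \<in> oe ` {0..p}" "c \<in> oe ` {0..p}" unfolding slice_basis_def by auto
  then show "b \<bullet> c = (if b = c then 1 else 0)"
  proof cases
    case 4
    then show ?thesis by (rule orthonormal_inner[OF orthonormal_oe[OF p]])
  qed (use SS_inner_oe[OF assms] SS_inner_self[OF assms] SS_notin[OF assms] in \<open>auto simp: inner_commute\<close>)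
qed

lemma card_slice_basis: "\<eta> \<in> SS p \<Longrightarrow> card (slice_basis p \<eta>) = p + 2"
  unfolding slice_basis_def using SS_notin p by (subst card_insert_disjoint) (auto simp: card_image inj_on_subset[OF inj_oe])

lemma sum_slice_basis:
  fixes F :: "octonion \<Rightarrow> 'b::comm_monoid_add"
  assumes "\<eta> \<in> SS p" shows "(\<Sum>b\<in>slice_basis p \<eta>. F b) = (\<Sum>i=0..p. F (oe i)) + F \<eta>"
proof -
  have "inj_on oe {0..p}" using p by (intro inj_on_subset[OF inj_oe]) auto
  then show ?thesis unfolding slice_basis_def using SS_notin[OF assms] by (simp add: sum.reindex add.commute)
qed

text \<open>An isometry from the slice of \<open>\<eta>\<close> to the space in which the stem functions are defined.\<close>

definition slice_coords :: "octonion \<Rightarrow> octonion \<Rightarrow> octonion \<times> real" where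
  "slice_coords \<eta> y = (oproj (oe ` {0..p}) y, y \<bullet> \<eta>)"

lemma bounded_linear_slice_coords: "bounded_linear (slice_coords \<eta>)"
  unfolding slice_coords_def[abs_def] by (intro bounded_linear_Pair bounded_linear_proj bounded_linear_inner_left)

lemma orthonormal_stem_dirs: "orthonormal (stem_dirs p)"
  unfolding orthonormal_def stem_dirs_def using inner_oe p by (auto dest: inj_onD[OF inj_oe])

lemma stem_span: "span (stem_dirs p) = Rp p \<times> UNIV"
proof
  have "stem_dirs p \<subseteq> Rp p \<times> UNIV"
    unfolding stem_dirs_def Rp_def by (auto intro: span_base span_zero)
  moreover have "subspace (Rp p \<times> (UNIV :: real set))" unfolding Rp_def by (intro subspace_Times) auto
  ultimately show "span (stem_dirs p) \<subseteq> Rp p \<times> UNIV" by (rule span_minimal)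
  show "Rp p \<times> UNIV \<subseteq> span (stem_dirs p)"
  proof (clarify)
    fix x r assume x: "x \<in> Rp p"
    have "(\<Sum>b\<in>oe ` {0..p}. (x \<bullet> b) *\<^sub>R (b, 0::real)) \<in> span (stem_dirs p)"
      by (intro span_sum span_scale span_base) (auto simp: stem_dirs_def)
    moreover have "(\<Sum>b\<in>oe ` {0..p}. (x \<bullet> b) *\<^sub>R (b, 0::real)) = (x, 0)"
    proof -
      have "(\<Sum>b\<in>oe ` {0..p}. (x \<bullet> b) *\<^sub>R (b, 0::real)) = (\<Sum>b\<in>oe ` {0..p}. ((x \<bullet> b) *\<^sub>R b, 0))" by simp
      also have "\<dots> = (x, 0)"
        using span_expansion[OF orthonormal_oe[OF p] x[unfolded Rp_def]] by (simp add: sum_prod)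
      finally show ?thesis .
    qed
    ultimately have "(x, 0::real) \<in> span (stem_dirs p)" by simp
    moreover have "r *\<^sub>R (0::octonion, 1::real) \<in> span (stem_dirs p)"
      by (intro span_scale span_base) (simp add: stem_dirs_def)
    ultimately have "(x, 0) + r *\<^sub>R (0, 1) \<in> span (stem_dirs p)" by (rule span_add)
    then show "(x, r) \<in> span (stem_dirs p)" by simp
  qed
qed

context
  fixes \<eta> :: octonion
  assumes \<eta>: "\<eta> \<in> SS p"
begin

lemma slice_coords_basis: "slice_coords \<eta> ` slice_basis p \<eta> = stem_dirs p"
  and slice_coords_inner: "b \<in> slice_basis p \<eta> \<Longrightarrow> slice_coords \<eta> h \<bullet> slice_coords \<eta> b = h \<bullet> b"
  and inj_slice_coords: "inj_on (slice_coords \<eta>) (slice_basis p \<eta>)"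
proof -
  note o = orthonormal_oe[OF p]
  have 1: "slice_coords \<eta> (oe i) = (oe i, 0)" if "i \<le> p" for i
    using that proj_ident[OF o span_base, of "oe i"] SS_inner_oe[OF \<eta> that]
    by (simp add: slice_coords_def inner_commute)
  have "oproj (oe ` {0..p}) \<eta> = 0"
    unfolding oproj_def by (rule sum.neutral) (use SS_inner_oe[OF \<eta>] in auto)
  then have 2: "slice_coords \<eta> \<eta> = (0, 1)" using SS_inner_self[OF \<eta>] by (simp add: slice_coords_def)
  show "slice_coords \<eta> ` slice_basis p \<eta> = stem_dirs p"
    unfolding slice_basis_def stem_dirs_def image_insert 2 image_image by (intro arg_cong2[of _ _ _ _ insert] refl image_cong) (use 1 in auto)
  show in1: "slice_coords \<eta> h \<bullet> slice_coords \<eta> b = h \<bullet> b" if b: "b \<in> slice_basis p \<eta>" for h b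
  proof -
    consider "b = \<eta>" | i where "b = oe i" "i \<le> p" using b unfolding slice_basis_def by auto
    then show ?thesis
    proof cases
      case 1
      then show ?thesis using 2 by (simp add: slice_coords_def[of _ h] inner_commute)
    next
      case (2 i)
      then show ?thesis using 1[of i] proj_inner[OF o, of "oe i" h] by (simp add: slice_coords_def[of _ h])
    qed
  qed
  show "inj_on (slice_coords \<eta>) (slice_basis p \<eta>)"
  proof (rule inj_onI)
    fix b c assume b: "b \<in> slice_basis p \<eta>" "c \<in> slice_basis p \<eta>" "slice_coords \<eta> b = slice_coords \<eta> c"
    then have "b \<bullet> c = c \<bullet> c" using in1[of c b] in1[of c c] by simp
    then show "b = c" using orthonormal_inner[OF orthonormal_slice_basis[OF \<eta>]] b by (auto split: if_splits)
  qed
qed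

lemma slice_coords_in_Rp: "slice_coords \<eta> y \<in> Rp p \<times> UNIV"
  by (simp add: slice_coords_def Rp_def proj_in_span)

lemma slice_coords_point:
  assumes "xp \<in> Rp p" shows "slice_coords \<eta> (xp + t *\<^sub>R \<eta>) = (xp, t)"
proof -
  note o = orthonormal_oe[OF p]
  have "oproj (oe ` {0..p}) \<eta> = 0"
    unfolding oproj_def by (rule sum.neutral) (use SS_inner_oe[OF \<eta>] in auto)
  then show ?thesis using assms SS_inner_self[OF \<eta>] SS_inner_Rp[OF \<eta> assms] proj_ident[OF o assms[unfolded Rp_def]]
    by (simp add: slice_coords_def linear_add[OF linear_proj] linear_cmul[OF linear_proj] inner_add_left inner_add_right inner_commute)
qed

lemma Rp_subset_slice_span: "Rp p \<subseteq> span (slice_basis p \<eta>)"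
  unfolding Rp_def slice_basis_def by (rule span_mono) auto

lemma slice_point_in_span: "xp \<in> Rp p \<Longrightarrow> xp + t *\<^sub>R \<eta> \<in> span (slice_basis p \<eta>)"
  using Rp_subset_slice_span by (intro span_add span_scale) (auto intro: span_base simp: slice_basis_def)

lemma slice_decomposition:
  assumes "y \<in> span (slice_basis p \<eta>)"
  shows "y = fst (slice_coords \<eta> y) + snd (slice_coords \<eta> y) *\<^sub>R \<eta>"
proof -
  have inj: "inj_on oe {0..p}" using p by (intro inj_on_subset[OF inj_oe]) auto
  have "y = (\<Sum>b\<in>slice_basis p \<eta>. (y \<bullet> b) *\<^sub>R b)" by (rule span_expansion[OF orthonormal_slice_basis[OF \<eta>] assms])
  then show ?thesis unfolding sum_slice_basis[OF \<eta>] by (simp add: slice_coords_def oproj_def sum.reindex[OF inj])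
qed

text \<open>The slice is the orthogonal sum of \<open>Rp p\<close> and the line spanned by \<open>\<eta>\<close>, so the part \<open>r \<omega>\<close> of the point,
  which is orthogonal to \<open>Rp p\<close>, lies on that line.\<close>

lemma slice_direction:
  assumes "\<omega> \<in> SS p" "xp \<in> Rp p" "xp + r *\<^sub>R \<omega> \<in> span (slice_basis p \<eta>)"
  shows "r *\<^sub>R \<omega> = r *\<^sub>R \<eta> \<or> r *\<^sub>R \<omega> = (- r) *\<^sub>R \<eta>"
proof -
  let ?v = "r *\<^sub>R \<omega>"
  have v: "?v \<in> span (slice_basis p \<eta>)"
    using span_diff[OF assms(3) subsetD[OF Rp_subset_slice_span assms(2)]] by simp
  have v0: "oproj (oe ` {0..p}) ?v = 0"
    unfolding oproj_def by (rule sum.neutral) (use SS_inner_oe[OF assms(1)] in auto)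
  have eq: "?v = (?v \<bullet> \<eta>) *\<^sub>R \<eta>"
    using slice_decomposition[OF v] unfolding slice_coords_def fst_conv snd_conv v0 add_0_left .
  have nn: "norm \<omega> = 1" "norm \<eta> = 1"
    using SS_inner_self[OF assms(1)] SS_inner_self[OF \<eta>] by (simp_all add: norm_eq_sqrt_inner)
  then have "\<bar>r\<bar> = \<bar>?v \<bullet> \<eta>\<bar>" using arg_cong[OF eq, of norm] by simp
  then have "?v \<bullet> \<eta> = r \<or> ?v \<bullet> \<eta> = - r" by linarith
  then show ?thesis using eq by metis
qed

text \<open>Being an isometry that maps \<open>slice_basis p \<eta>\<close> onto \<open>stem_dirs p\<close>, \<open>slice_coords\<close> carries the partial
  derivatives of the stem functions over to the slice.\<close>

lemma C1_on_slice_coords: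
  assumes F: "C1_on (stem_dirs p) Y F F'"
  shows "C1_on (slice_basis p \<eta>) (slice_coords \<eta> -` Y) (\<lambda>y. F (slice_coords \<eta> y)) (\<lambda>b y. F' (slice_coords \<eta> b) (slice_coords \<eta> y))"
  unfolding C1_on_def
proof (intro conjI ballI)
  let ?L = "slice_coords \<eta>"
  have Lc: "continuous_on UNIV ?L" by (rule bounded_linear.continuous_on[OF bounded_linear_slice_coords continuous_on_id])
  show "open (?L -` Y)" using C1_onD(1)[OF F] Lc by (rule open_vimage)
  show "continuous_on (?L -` Y) (\<lambda>y. F' (?L b) (?L y))" if "b \<in> slice_basis p \<eta>" for b
    using that slice_coords_basis
    by (intro continuous_on_compose2[OF C1_onD(3)[OF F] continuous_on_subset[OF Lc]]) auto
  fix y assume y: "y \<in> ?L -` Y"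
  have "((\<lambda>y. F (?L y)) has_derivative (\<lambda>h. \<Sum>c\<in>stem_dirs p. (?L h \<bullet> c) *\<^sub>R F' c (?L y))) (at y)"
    using y by (intro has_derivative_compose[OF bounded_linear_imp_has_derivative[OF bounded_linear_slice_coords] C1_onD(2)[OF F]]) auto
  then show "((\<lambda>y. F (?L y)) has_derivative (\<lambda>h. \<Sum>b\<in>slice_basis p \<eta>. (h \<bullet> b) *\<^sub>R F' (?L b) (?L y))) (at y)"
    unfolding slice_coords_basis[symmetric] sum.reindex[OF inj_slice_coords] by (simp add: slice_coords_inner)
qed

text \<open>A point \<open>x\<^sub>p + t \<eta>\<close> with \<open>t < 0\<close> enters the completion as \<open>x\<^sub>p + (- t) (- \<eta>)\<close>; the reflection
  invariance of \<open>D\<close> makes the two descriptions agree.\<close>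

lemma slice_completion_iff:
  assumes D: "stem_domain p D"
  shows "y \<in> slice p \<eta> (p_completion p D) \<longleftrightarrow> y \<in> span (slice_basis p \<eta>) \<and> slice_coords \<eta> y \<in> D"
proof
  assume "y \<in> slice p \<eta> (p_completion p D)"
  then obtain xp r \<omega> where y: "y = xp + r *\<^sub>R \<omega>" "\<omega> \<in> SS p" "xp \<in> Rp p" "r \<ge> 0" "(xp, r) \<in> D"
    and yB: "y \<in> span (slice_basis p \<eta>)" unfolding slice_def p_completion_def by blast
  have m: "(xp, - r) \<in> D" using D y(5) unfolding stem_domain_def by blast
  have "y = xp + r *\<^sub>R \<eta> \<or> y = xp + (- r) *\<^sub>R \<eta>"
    using slice_direction[OF y(2,3) yB[unfolded y(1)]] unfolding y(1) by (elim disjE) simp_all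
  then have "slice_coords \<eta> y = (xp, r) \<or> slice_coords \<eta> y = (xp, - r)"
    using slice_coords_point[OF y(3)] by (elim disjE) (simp_all only: simp_thms)
  then show "y \<in> span (slice_basis p \<eta>) \<and> slice_coords \<eta> y \<in> D" using yB m y(5) by auto
next
  assume y: "y \<in> span (slice_basis p \<eta>) \<and> slice_coords \<eta> y \<in> D"
  define xp where "xp = fst (slice_coords \<eta> y)"
  define t where "t = snd (slice_coords \<eta> y)"
  have yd: "y = xp + t *\<^sub>R \<eta>" using slice_decomposition y by (simp add: xp_def t_def)
  have xp: "xp \<in> Rp p" using slice_coords_in_Rp[of y] by (simp add: xp_def mem_Times_iff)
  have tD: "(xp, t) \<in> D" "(xp, - t) \<in> D" using y D unfolding stem_domain_def by (auto simp: xp_def t_def)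
  have "y \<in> p_completion p D"
  proof (cases "t \<ge> 0")
    case True
    then show ?thesis unfolding p_completion_def using yd xp tD \<eta> by blast
  next
    case False
    then have "y = xp + (- t) *\<^sub>R (- \<eta>)" "- t \<ge> 0" using yd by auto
    then show ?thesis unfolding p_completion_def using xp tD SS_uminus[OF \<eta>] by blast
  qed
  then show "y \<in> slice p \<eta> (p_completion p D)" using y by (simp add: slice_def)
qed

lemma openin_slice_completion:
  assumes D: "stem_domain p D"
  shows "openin (top_of_set (span (slice_basis p \<eta>))) (slice p \<eta> (p_completion p D))"
proof -
  obtain T where T: "open T" "D = (Rp p \<times> UNIV) \<inter> T" using D unfolding stem_domain_def by (metis openin_open)
  have "slice p \<eta> (p_completion p D) = span (slice_basis p \<eta>) \<inter> slice_coords \<eta> -` T"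
    using slice_completion_iff[OF D] T(2) slice_coords_in_Rp by auto
  moreover have "open (slice_coords \<eta> -` T)"
    by (rule open_vimage[OF T(1) bounded_linear.continuous_on[OF bounded_linear_slice_coords continuous_on_id]])
  ultimately show ?thesis by (simp add: openin_open_Int)
qed

text \<open>The induced function in the coordinates of the slice of \<open>\<eta>\<close>; negative \<open>t\<close> are covered by the
  parity of the stem function.\<close>

lemma induced_function_on_slice:
  assumes stem: "stem_function D F1 F2" and D: "stem_domain p D"
    and f: "\<forall>xp\<in>Rp p. \<forall>r\<ge>0. \<forall>\<omega>\<in>SS p. (xp, r) \<in> D \<longrightarrow> f (xp + r *\<^sub>R \<omega>) = F1 (xp, r) + \<omega> \<odot> F2 (xp, r)"
    and xp: "xp \<in> Rp p" and tD: "(xp, t) \<in> D"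
  shows "f (xp + t *\<^sub>R \<eta>) = F1 (xp, t) + \<eta> \<odot> F2 (xp, t)"
proof (cases "t \<ge> 0")
  case True
  then show ?thesis using f xp \<eta> tD by blast
next
  case False
  have m: "(xp, - t) \<in> D" using D tD unfolding stem_domain_def by blast
  have "f (xp + (- t) *\<^sub>R (- \<eta>)) = F1 (xp, - t) + (- \<eta>) \<odot> F2 (xp, - t)"
    using f xp SS_uminus[OF \<eta>] m False by (simp del: scaleR_minus_left scaleR_minus_right)
  moreover have "F1 (xp, - t) = F1 (xp, t)" "F2 (xp, - t) = - F2 (xp, t)"
    using stem tD unfolding stem_function_def by blast+
  ultimately show ?thesis by (simp add: oct.minus_left oct.minus_right)
qed

text \<open>On the slice \<open>f\<close> is the composition of \<open>slice_coords\<close> with the continuously differentiable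
  \<open>F\<^sub>1 + \<eta> \<odot> F\<^sub>2\<close>.\<close>

lemma slice_function_C1:
  assumes D: "stem_domain p D" and f: "f \<in> GS1 p D"
  defines "B \<equiv> slice_basis p \<eta>" and "X \<equiv> slice p \<eta> (p_completion p D)"
  obtains f' where "C1_on B (oproj B -` X) (\<lambda>y. f (oproj B y)) f'" "\<And>b y. b \<in> B \<Longrightarrow> y \<in> X \<Longrightarrow> f' b y = dir_deriv b f y"
proof -
  have o: "orthonormal B" unfolding B_def by (rule orthonormal_slice_basis[OF \<eta>])
  obtain F1 F2 where stem: "stem_function D F1 F2" and C: "Ck_on 1 (stem_dirs p) D F1" "Ck_on 1 (stem_dirs p) D F2"
    and fF: "\<forall>xp\<in>Rp p. \<forall>r\<ge>0. \<forall>\<omega>\<in>SS p. (xp, r) \<in> D \<longrightarrow> f (xp + r *\<^sub>R \<omega>) = F1 (xp, r) + \<omega> \<odot> F2 (xp, r)"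
    using f unfolding GS1_def by blast
  let ?L = "slice_coords \<eta>" and ?Q = "oproj (stem_dirs p)"
  have oD: "openin (top_of_set (span (stem_dirs p))) D" using D unfolding stem_domain_def stem_span by simp
  note c = C1_on_slice_coords[OF Ck_on_imp_C1_on_proj[OF orthonormal_stem_dirs oD]]
  have QL: "?Q (?L y) = ?L y" for y
    using slice_coords_in_Rp[of y] by (intro proj_ident[OF orthonormal_stem_dirs]) (simp add: stem_span)
  have LP: "?L (oproj B y) = ?L y" for y
  proof -
    have inB: "b \<in> B" if "b \<in> insert \<eta> (oe ` {0..p})" for b using that by (simp add: B_def slice_basis_def)
    have "oproj (oe ` {0..p}) (oproj B y) = oproj (oe ` {0..p}) y"
      unfolding oproj_def[of "oe ` {0..p}"] by (rule sum.cong[OF refl]) (simp add: proj_inner[OF o inB])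
    then show ?thesis by (simp add: slice_coords_def proj_inner[OF o inB])
  qed
  have WX: "oproj B -` X = ?L -` (?Q -` D)"
    by (rule set_eqI) (simp add: X_def slice_completion_iff[OF D] LP QL proj_in_span B_def[symmetric])
  note h = C1_on_add[OF c[OF C(1)] C1_on_bilinear[OF bounded_bilinear_oct_mult C1_on_const[OF C1_onD(1)[OF c[OF C(2)]]] c[OF C(2)]]]
  obtain f' where f': "C1_on B (oproj B -` X) (\<lambda>y. (F1 \<circ> ?Q) (?L y) + \<eta> \<odot> (F2 \<circ> ?Q) (?L y)) f'"
    by (rule that[OF h[folded B_def, folded WX]])
  have eq: "f (oproj B y) = (F1 \<circ> ?Q) (?L y) + \<eta> \<odot> (F2 \<circ> ?Q) (?L y)" if y: "y \<in> oproj B -` X" for y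
  proof -
    have yD: "(fst (?L y), snd (?L y)) \<in> D" using y unfolding WX by (simp add: QL)
    have "oproj B y = fst (?L y) + snd (?L y) *\<^sub>R \<eta>"
      using slice_decomposition[of "oproj B y"] proj_in_span[of B y] unfolding B_def by (simp add: LP[unfolded B_def])
    moreover have "fst (?L y) \<in> Rp p" using slice_coords_in_Rp[of y] by (simp add: mem_Times_iff)
    ultimately show ?thesis using induced_function_on_slice[OF stem D fF _ yD] by (simp add: QL)
  qed
  have W: "open (oproj B -` X)" by (rule C1_onD(1)[OF f'])
  have C1: "C1_on B (oproj B -` X) (\<lambda>y. f (oproj B y)) f'"
    unfolding C1_on_def
  proof (intro conjI ballI W)
    fix y assume y: "y \<in> oproj B -` X"
    show "((\<lambda>y. f (oproj B y)) has_derivative (\<lambda>h. \<Sum>b\<in>B. (h \<bullet> b) *\<^sub>R f' b y)) (at y)"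
      by (rule has_derivative_transform_within_open[OF C1_onD(2)[OF f' y] W y]) (simp add: eq)
  qed (rule C1_onD(3)[OF f'])
  have "f' b y = dir_deriv b f y" if b: "b \<in> B" and y: "y \<in> X" for b y
  proof -
    have yB: "y \<in> span B" using y unfolding X_def B_def slice_def by auto
    then have yW: "y \<in> oproj B -` X" using y by (simp add: proj_ident[OF o])
    have "oproj B (y + t *\<^sub>R b) = y + t *\<^sub>R b" for t
      by (rule proj_ident[OF o]) (use yB b in \<open>auto intro: span_add span_scale span_base\<close>)
    then have "dir_deriv b (\<lambda>y. f (oproj B y)) y = dir_deriv b f y" by (simp add: dir_deriv_def)
    then show ?thesis using C1_on_dir_deriv[OF o C1 yW b] by simp
  qed
  then show ?thesis using that C1 by blast
qed

end

end

lemma cauchy_E_eq_kernel: "cauchy_E p z = cauchy_kernel (p + 2) z"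
proof -
  have "Gamma (1 / 2) ^ (p + 2) = pi powr (real (p + 2) / 2)"
    by (simp add: Gamma_one_half_real powr_half_sqrt[symmetric] powr_realpow[symmetric] powr_powr del: of_nat_add power_add power_Suc)
  then show ?thesis unfolding cauchy_E_def cauchy_kernel_def sigma_p_def by simp
qed

section \<open>The Cauchy--Pompeiu formula for generalized partial-slice functions\<close>

lemma cauchy_pompeiu_slice:
  fixes p :: nat and D :: "(octonion \<times> real) set" and f :: "octonion \<Rightarrow> octonion" and U :: "octonion set" and \<eta> z :: octonion
  assumes p: "p \<le> 6" and D: "stem_domain p D" and f: "f \<in> GS1 p D" and U: "open U" and \<eta>: "\<eta> \<in> SS p"
    and sub: "slice p \<eta> U \<subseteq> slice p \<eta> (p_completion p D)" and bd: "bounded (slice p \<eta> U)"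
    and sm: "has_smooth_boundary (slice_basis p \<eta>) (slice p \<eta> U)"
    and bsub: "boundary_in (slice_basis p \<eta>) (slice p \<eta> U) \<subseteq> slice p \<eta> (p_completion p D)"
    and z: "z \<in> slice p \<eta> U"
  defines "M \<equiv> boundary_in (slice_basis p \<eta>) (slice p \<eta> U)"
  defines "S \<equiv> surface_measure (slice_basis p \<eta>) M"
  defines "u \<equiv> \<lambda>y. indicator M y *\<^sub>R (cauchy_E p (y - z) \<odot> (exterior_normal (slice_basis p \<eta>) (slice p \<eta> U) y \<odot> f y))"
    and "v \<equiv> \<lambda>y. indicator (slice p \<eta> U) y *\<^sub>R (cauchy_E p (y - z) \<odot> slice_dirac p \<eta> f y)"
  shows "integrable S u" "integrable (lborel_span (slice_basis p \<eta>)) v"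
    "f z = (\<integral> y. u y \<partial>S) - (\<integral> y. v y \<partial>lborel_span (slice_basis p \<eta>))"
proof -
  let ?B = "slice_basis p \<eta>" and ?G = "slice p \<eta> U" and ?X = "slice p \<eta> (p_completion p D)"
  have B: "orthonormal ?B" by (rule orthonormal_slice_basis[OF p \<eta>])
  have G: "openin (top_of_set (span ?B)) ?G" using openin_open_Int[OF U, of "span ?B"] by (simp add: slice_def Int_commute)
  have X: "openin (top_of_set (span ?B)) ?X" by (rule openin_slice_completion[OF p \<eta> D])
  have clX: "closure ?G \<subseteq> ?X" using bsub sub unfolding boundary_in_eq[OF G] by blast
  obtain f' where f': "C1_on ?B (oproj ?B -` ?X) (\<lambda>y. f (oproj ?B y)) f'"
    and f'd: "\<And>b y. b \<in> ?B \<Longrightarrow> y \<in> ?X \<Longrightarrow> f' b y = dir_deriv b f y"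
    using slice_function_C1[OF p \<eta> D f] by blast
  have n: "p + 2 = card ?B" "p + 2 \<ge> 2" using card_slice_basis[OF p \<eta>] by auto
  note CP = cauchy_pompeiu_span[OF B G bd sm X clX f' n z]
  have XB: "y \<in> span ?B" if "y \<in> ?X" for y using that by (simp add: slice_def)
  have fy: "f (oproj ?B y) = f y" if "y \<in> ?X" for y using proj_ident[OF B XB[OF that]] by simp
  have Dy: "span_dirac ?B f' y = slice_dirac p \<eta> f y" if y: "y \<in> ?X" for y
  proof -
    have "span_dirac ?B f' y = (\<Sum>b\<in>?B. b \<odot> dir_deriv b f y)"
      unfolding span_dirac_def by (rule sum.cong) (simp_all add: f'd y)
    then show ?thesis unfolding sum_slice_basis[OF p \<eta>] slice_dirac_def .
  qed
  have u: "cauchy_kernel (p + 2) (y - z) \<odot> (indicator M y *\<^sub>R (exterior_normal ?B ?G y \<odot> f (oproj ?B y))) = u y" for y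
    using bsub fy[of y] by (cases "y \<in> M") (auto simp: u_def M_def cauchy_E_eq_kernel oct.zero_right)
  have v: "cauchy_kernel (p + 2) (y - z) \<odot> (indicator ?G y *\<^sub>R span_dirac ?B f' y) = v y" for y
    using sub Dy[of y] by (cases "y \<in> ?G") (auto simp: v_def cauchy_E_eq_kernel oct.zero_right)
  show "integrable S u" "integrable (lborel_span ?B) v" "f z = (\<integral> y. u y \<partial>S) - (\<integral> y. v y \<partial>lborel_span ?B)"
    using CP(1)[folded M_def, folded S_def, unfolded u] CP(2)[unfolded v]
      CP(3)[folded M_def, folded S_def, unfolded u v] fy[OF subsetD[OF sub z]] by simp_all
qed

text \<open>If \<open>\<omega> = \<eta>\<close> or \<open>\<omega> = - \<eta>\<close>, then \<open>\<omega> \<odot> (\<eta> \<odot> a)\<close> is \<open>- a\<close> or \<open>a\<close>, and one of the two kernels cancels;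
  if \<open>r = 0\<close>, the two kernels are equal.\<close>

lemma cauchy_op_same_point:
  assumes p: "p \<le> 6" and \<eta>: "\<eta> \<in> SS p" and \<omega>: "r *\<^sub>R \<omega> = r *\<^sub>R \<eta> \<or> r *\<^sub>R \<omega> = (- r) *\<^sub>R \<eta>"
  shows "cauchy_op p \<eta> xp r \<omega> y a = cauchy_E p (y - (xp + r *\<^sub>R \<omega>)) \<odot> a"
proof (cases "r = 0")
  case True
  then show ?thesis
    by (simp add: cauchy_op_def Let_def oct.add_left oct.zero_left oct.zero_right scaleR_add_right[symmetric] scaleR_2[symmetric])
next
  case False
  then consider "\<omega> = \<eta>" | "\<omega> = - \<eta>" using \<omega> by (metis scaleR_left_imp_eq scaleR_minus_left scaleR_minus_right)
  then show ?thesis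
  proof cases
    case 1
    have "(1/2) *\<^sub>R (s + t) + (1/2) *\<^sub>R (- (t - s)) = s" for s t :: octonion
      by (simp add: algebra_simps scaleR_2[symmetric] flip: scaleR_add_left)
    then show ?thesis using 1 SS_mult_mult[OF p \<eta>]
      by (simp add: cauchy_op_def Let_def oct.add_left oct.diff_left)
  next
    case 2
    have "(1/2) *\<^sub>R (s + t) + (1/2) *\<^sub>R (t - s) = t" for s t :: octonion
      by (simp add: algebra_simps flip: scaleR_add_left)
    then show ?thesis using 2 SS_mult_mult[OF p \<eta>]
      by (simp add: cauchy_op_def Let_def oct.add_left oct.diff_left oct.minus_left)
  qed
qed

text \<open>For \<open>x\<close> in the slice this is the Cauchy--Pompeiu formula at \<open>x\<close>.  Otherwise \<open>x\<^sub>p + r \<eta>\<close> and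
  \<open>x\<^sub>p - r \<eta>\<close> lie in \<open>U\<close>, and the formulas at these points are combined by the maps \<open>\<Lambda>1\<close> and \<open>\<Lambda>2\<close> of the
  representation formula, which also express \<open>cauchy_op\<close> through the kernels at the two points.\<close>

theorem theorem5p5:
  fixes p :: nat and D :: "(octonion \<times> real) set" and f :: "octonion \<Rightarrow> octonion"
    and U :: "octonion set" and \<eta> x xp \<omega> :: octonion and r :: real
  assumes "p \<le> 6"
    and "stem_domain p D"
    and "f \<in> GS1 p D"
    and "open U" and "connected U"
    and "\<eta> \<in> SS p"
    and "slice p \<eta> U \<subseteq> slice p \<eta> (p_completion p D)"
    and "bounded (slice p \<eta> U)" and "connected (slice p \<eta> U)"
    and "has_smooth_boundary (slice_basis p \<eta>) (slice p \<eta> U)"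
    and "boundary_in (slice_basis p \<eta>) (slice p \<eta> U) \<subseteq> slice p \<eta> (p_completion p D)"
    and "x \<in> U"
    and "x = xp + r *\<^sub>R \<omega>" and "xp \<in> Rp p" and "r \<ge> 0" and "\<omega> \<in> SS p"
    and "x \<in> slice p \<eta> U \<or> (xp + r *\<^sub>R \<eta> \<in> U \<and> xp - r *\<^sub>R \<eta> \<in> U)"
  shows "let bd = boundary_in (slice_basis p \<eta>) (slice p \<eta> U);
             dS = surface_measure (slice_basis p \<eta>) bd;
             dV = lborel_span (slice_basis p \<eta>);
             n = exterior_normal (slice_basis p \<eta>) (slice p \<eta> U)
         in set_integrable dS bd (\<lambda>y. cauchy_op p \<eta> xp r \<omega> y (n y \<odot> f y)) \<and>
            set_integrable dV (slice p \<eta> U) (\<lambda>y. cauchy_op p \<eta> xp r \<omega> y (slice_dirac p \<eta> f y)) \<and>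
            f x = (LINT y:bd|dS. cauchy_op p \<eta> xp r \<omega> y (n y \<odot> f y))
                  - (LINT y:slice p \<eta> U|dV. cauchy_op p \<eta> xp r \<omega> y (slice_dirac p \<eta> f y))"
proof -
  let ?B = "slice_basis p \<eta>" and ?G = "slice p \<eta> U"
  let ?M = "boundary_in ?B ?G"
  let ?S = "surface_measure ?B ?M" and ?V = "lborel_span ?B" and ?n = "exterior_normal ?B ?G"
  note p = assms(1) and \<eta> = assms(6) and xp = assms(14) and \<omega> = assms(16)
  note CP = cauchy_pompeiu_slice[OF p assms(2,3,4) \<eta> assms(7,8,10,11)]
  have "set_integrable ?S ?M (\<lambda>y. cauchy_op p \<eta> xp r \<omega> y (?n y \<odot> f y)) \<and>
        set_integrable ?V ?G (\<lambda>y. cauchy_op p \<eta> xp r \<omega> y (slice_dirac p \<eta> f y)) \<and>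
        f x = (LINT y:?M|?S. cauchy_op p \<eta> xp r \<omega> y (?n y \<odot> f y))
              - (LINT y:?G|?V. cauchy_op p \<eta> xp r \<omega> y (slice_dirac p \<eta> f y))"
  proof (cases "x \<in> ?G")
    case True
    have dir: "r *\<^sub>R \<omega> = r *\<^sub>R \<eta> \<or> r *\<^sub>R \<omega> = (- r) *\<^sub>R \<eta>"
      using True assms(13) by (intro slice_direction[OF p \<eta> \<omega> xp]) (simp add: slice_def)
    have op: "cauchy_op p \<eta> xp r \<omega> y a = cauchy_E p (y - x) \<odot> a" for y a
      using cauchy_op_same_point[OF p \<eta> dir] assms(13) by simp
    show ?thesis
      unfolding op set_integrable_def set_lebesgue_integral_def using CP[OF True] by blast
  next
    case False
    then have U: "xp + r *\<^sub>R \<eta> \<in> U" "xp - r *\<^sub>R \<eta> \<in> U" using assms(17) by auto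
    let ?a = "xp + r *\<^sub>R \<eta>" and ?b = "xp - r *\<^sub>R \<eta>"
    have G: "?a \<in> ?G" "?b \<in> ?G"
      using U slice_point_in_span[OF p \<eta> xp, of r] slice_point_in_span[OF p \<eta> xp, of "- r"] by (auto simp: slice_def)
    define \<Lambda>1 where "\<Lambda>1 a = (1/2) *\<^sub>R a - (1/2) *\<^sub>R (\<omega> \<odot> (\<eta> \<odot> a))" for a
    define \<Lambda>2 where "\<Lambda>2 a = (1/2) *\<^sub>R a + (1/2) *\<^sub>R (\<omega> \<odot> (\<eta> \<odot> a))" for a
    have bl: "bounded_linear \<Lambda>1" "bounded_linear \<Lambda>2"
      unfolding \<Lambda>1_def[abs_def] \<Lambda>2_def[abs_def]
      by (intro bounded_linear_sub bounded_linear_add bounded_linear_scaleR_right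
          bounded_linear_compose[OF bounded_linear_scaleR_right]
          bounded_linear_compose[OF oct.bounded_linear_right] oct.bounded_linear_right)+
    have op: "cauchy_op p \<eta> xp r \<omega> y c = \<Lambda>1 (cauchy_E p (y - ?a) \<odot> c) + \<Lambda>2 (cauchy_E p (y - ?b) \<odot> c)" for y c
      by (simp add: cauchy_op_def Let_def \<Lambda>1_def \<Lambda>2_def oct.add_left oct.diff_left oct.diff_right algebra_simps)
    have push: "k *\<^sub>R (\<Lambda>1 s + \<Lambda>2 t) = \<Lambda>1 (k *\<^sub>R s) + \<Lambda>2 (k *\<^sub>R t)" for k s t
      using bl by (simp add: linear_cmul[OF bounded_linear.linear] scaleR_add_right)
    note Ca = CP[OF G(1)] and Cb = CP[OF G(2)]
    have lin: "integrable N (\<lambda>y. \<Lambda>1 (s y) + \<Lambda>2 (t y))"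
      "(\<integral> y. \<Lambda>1 (s y) + \<Lambda>2 (t y) \<partial>N) = \<Lambda>1 (\<integral> y. s y \<partial>N) + \<Lambda>2 (\<integral> y. t y \<partial>N)"
      if "integrable N s" "integrable N t" for N :: "octonion measure" and s t
      using that bl by (simp_all add: integrable_bounded_linear integral_bounded_linear)
    obtain F1 F2 where stem: "stem_function D F1 F2"
      and fF: "\<forall>xp\<in>Rp p. \<forall>r\<ge>0. \<forall>\<omega>\<in>SS p. (xp, r) \<in> D \<longrightarrow> f (xp + r *\<^sub>R \<omega>) = F1 (xp, r) + \<omega> \<odot> F2 (xp, r)"
      using assms(3) unfolding GS1_def by blast
    have rD: "(xp, r) \<in> D"
      using G(1) assms(7) slice_completion_iff[OF p \<eta> assms(2), of ?a] slice_coords_point[OF p \<eta> xp, of r] by auto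
    have rep: "f x = \<Lambda>1 (f ?a) + \<Lambda>2 (f ?b)"
    proof -
      have fx: "f x = F1 (xp, r) + \<omega> \<odot> F2 (xp, r)" using fF xp assms(15) \<omega> rD assms(13) by blast
      have fa: "f ?a = F1 (xp, r) + \<eta> \<odot> F2 (xp, r)" using fF xp assms(15) \<eta> rD by blast
      have fb: "f ?b = F1 (xp, r) - \<eta> \<odot> F2 (xp, r)"
        using fF xp assms(15) SS_uminus[OF p \<eta>] rD oct.minus_left[of \<eta>] by fastforce
      show ?thesis unfolding fx fa fb
        by (simp add: \<Lambda>1_def \<Lambda>2_def oct.add_right oct.diff_right SS_mult_mult[OF p \<eta>] oct.minus_right algebra_simps
            flip: scaleR_add_left)
    qed
    show ?thesis
      unfolding op set_integrable_def set_lebesgue_integral_def push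
      using lin[OF Ca(1) Cb(1)] lin[OF Ca(2) Cb(2)] rep Ca(3) Cb(3) bl
      by (simp add: linear_diff[OF bounded_linear.linear])
  qed
  then show ?thesis unfolding Let_def .
qed

end
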